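(* Suppose that we observe $N$ i.i.d. copies of $X\circ\Omega$, as described in the context, and that $\inf_{x_{S_0}}\min_{S\in\mathbb S_+}M_S(x_{S_0})>0$. For any measurable estimator sequence $(\theta_N)$ we have $$\sup_{I\subset L^2}\ \liminf_{N\to\infty}\ \max_{h\in I}\ \mathbb E_{f_{N^{-1/2}h}}\bigl[N\{\theta_N-\theta(f_{N^{-1/2}h})\}^2\bigr]\ \ge\ \mathrm{Var}\bigl(a_{S_0}(X_{S_0})\bigr)+\inf_{\alpha_{\mathbb S}\in H_{\mathbb S}^{S_0}}\mathcal L(\alpha_{\mathbb S},M_{\mathbb S}),$$ where the supremum is taken over all finite subsets $I$ of $L^2$.
   Context: Let $d\ge 2$, $[d]=\{1,\dots,d\}$, let $f$ be a probability density on $\mathbb R^d$ and $X\sim f$. For $x\in\mathbb R^d$ and $S\subseteq[d]$ write $x_S=(x_j:j\in S)\in\mathbb R^S$. Let $a:\mathbb R^d\to\mathbb R$ be a known measurable function with $\int a^2f<\infty$; $\theta(g)=\int ag$ for a density $g$; $a_{S_0}(x_{S_0})=\mathbb E\{a(X)\mid X_{S_0}=x_{S_0}\}$. Missing data model. $\Omega$ is a random element of $\{0,1\}^d$, and $(x\circ\omega)_j=x_j$ if $\omega_j=1$ and $=\texttt{NA}$ otherwise. For $S\subseteq[d]$ let $\mathbf 1_S\in\{0,1\}^d$ be its indicator vector and $p_S=\mathbb P(\Omega=\mathbf 1_S)$. Let $\mathbb S=\{S\subsetneq[d]:p_S>0\}$ and $\mathbb S_+=\mathbb S\cup\{[d]\}$.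 There is $S_0\subseteq[d]$ with $S_0\subseteq S$ for all $S\in\mathbb S$ and functions $M_S:\mathbb R^{S_0}\to[0,1]$, $S\in\mathbb S_+$, with $\mathbb P(\Omega=\mathbf 1_S\mid X=x)=M_S(x_{S_0})$; $M_{\mathbb S}$ denotes this collection. $\mathbb E_g$ denotes expectation when $X$ has density $g$ and the conditional law of $\Omega$ given $X$ is unchanged. Estimators are measurable functions of the observed data. Function spaces. $L^2=\{\alpha:\mathbb R^d\to\mathbb R:\int\alpha^2f<\infty\}$; $H_S^{S_0}$ is the set of $\alpha_S\in L^2$ depending on $x$ only through $x_S$ with $\int\alpha_S f=0$ and $\mathbb E\{\alpha_S(X_S)\mid X_{S_0}\}=0$ almost surely; $H_{\mathbb S}^{S_0}=\prod_{S\in\mathbb S}H_S^{S_0}$. For $\alpha_{\mathbb S}\in H_{\mathbb S}^{S_0}$, $$\mathcal L(\alpha_{\mathbb S},M_{\mathbb S})=\mathbb E\Bigl[\frac1{M_{[d]}(X_{S_0})}\Bigl\{a(X)-a_{S_0}(X_{S_0})-\sum_{S\in\mathbb S}\alpha_S(X_S)\Bigr\}^2+\sum_{S\in\mathbb S}\frac{\alpha_S(X_S)^2}{M_S(X_{S_0})}\Bigr].$$ Perturbations. Let $k(u)=1/2+(1+e^{-4u})^{-1}$; for $h\in L^2$, $f_h$ is the probability density with $f_h(x)\propto k(h(x))f(x)$. *)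

theory Defs
  imports "HOL-Probability.Probability"
begin

text \<open>The space \<open>\<real>\<^sup>S\<close> consists of the functions that are \<open>undefined\<close> off \<open>S\<close>;
  \<open>restr S x\<close> is \<open>x\<^sub>S\<close>.\<close>

definition coord_space :: "'n set \<Rightarrow> ('n \<Rightarrow> real) measure" where
  "coord_space S = (\<Pi>\<^sub>M j\<in>S. borel)"

definition restr :: "'n set \<Rightarrow> real ^ 'n \<Rightarrow> 'n \<Rightarrow> real" where
  "restr S x = (\<lambda>j\<in>S. x $ j)"

definition prob_density :: "(real ^ 'n \<Rightarrow> real) \<Rightarrow> bool" where
  "prob_density f \<longleftrightarrow> f \<in> borel_measurable borel \<and> (\<forall>x. 0 \<le> f x) \<and>
     (\<integral>\<^sup>+x. ennreal (f x) \<partial>lborel) = 1"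

definition law :: "(real ^ 'n \<Rightarrow> real) \<Rightarrow> (real ^ 'n) measure" where
  "law g = density lborel (\<lambda>x. ennreal (g x))"

definition theta :: "(real ^ 'n \<Rightarrow> real) \<Rightarrow> (real ^ 'n \<Rightarrow> real) \<Rightarrow> real" where
  "theta a g = (\<integral>x. a x * g x \<partial>lborel)"

text \<open>\<open>cond_given f S b\<close> is \<open>E(b(X) | X\<^sub>S)\<close> for \<open>X\<close> the identity on the probability space
  \<open>law f\<close>. It is measurable with respect to the sigma-algebra generated by \<open>X\<^sub>S\<close>.\<close>

definition cond_given ::
    "(real ^ 'n \<Rightarrow> real) \<Rightarrow> 'n set \<Rightarrow> (real ^ 'n \<Rightarrow> real) \<Rightarrow> real ^ 'n \<Rightarrow> real" where
  "cond_given f S b = real_cond_exp (law f) (vimage_algebra UNIV (restr S) (coord_space S)) b"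


text \<open>Missing data. A missingness pattern in \<open>{0,1}\<^sup>d\<close> is a function \<open>'n \<Rightarrow> bool\<close>, and
  \<open>NA\<close> is \<^const>\<open>None\<close>. The conditional law of \<open>\<Omega>\<close> given \<open>X\<close> is the Markov kernel \<open>K\<close>;
  \<open>full_law g K\<close> is the joint law of \<open>(X, \<Omega>)\<close> when \<open>X\<close> has density \<open>g\<close>.\<close>

definition one_vec :: "'n set \<Rightarrow> 'n \<Rightarrow> bool" where
  "one_vec S = (\<lambda>j. j \<in> S)"

definition markov_kernel :: "(real ^ 'n \<Rightarrow> ('n \<Rightarrow> bool) pmf) \<Rightarrow> bool" where
  "markov_kernel K \<longleftrightarrow> (\<forall>\<omega>. (\<lambda>x. pmf (K x) \<omega>) \<in> borel_measurable borel)"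

definition full_law ::
    "(real ^ 'n \<Rightarrow> real) \<Rightarrow> (real ^ 'n \<Rightarrow> ('n \<Rightarrow> bool) pmf) \<Rightarrow> ((real ^ 'n) \<times> ('n \<Rightarrow> bool)) measure" where
  "full_law g K =
     density (lborel \<Otimes>\<^sub>M count_space UNIV) (\<lambda>(x, \<omega>). ennreal (g x * pmf (K x) \<omega>))"

definition pat_prob ::
    "(real ^ 'n \<Rightarrow> real) \<Rightarrow> (real ^ 'n \<Rightarrow> ('n \<Rightarrow> bool) pmf) \<Rightarrow> 'n set \<Rightarrow> real" where
  "pat_prob f K S = measure (full_law f K) {z. snd z = one_vec S}"

definition incomplete_patterns ::
    "(real ^ 'n \<Rightarrow> real) \<Rightarrow> (real ^ 'n \<Rightarrow> ('n \<Rightarrow> bool) pmf) \<Rightarrow> 'n set set" where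
  "incomplete_patterns f K = {S. S \<subset> UNIV \<and> pat_prob f K S > 0}"

definition mask :: "(real ^ 'n) \<times> ('n \<Rightarrow> bool) \<Rightarrow> 'n \<Rightarrow> real option" where
  "mask = (\<lambda>(x, \<omega>) j. if \<omega> j then Some (x $ j) else None)"

text \<open>The disjoint union of the Borel space \<open>\<real>\<close> and the point \<open>NA\<close>.\<close>

definition option_borel :: "real option measure" where
  "option_borel = sigma UNIV {A. Some -` A \<in> sets borel}"

definition obs_space :: "('n \<Rightarrow> real option) measure" where
  "obs_space = (\<Pi>\<^sub>M j\<in>UNIV. option_borel)"

definition obs_law ::
    "(real ^ 'n \<Rightarrow> real) \<Rightarrow> (real ^ 'n \<Rightarrow> ('n \<Rightarrow> bool) pmf) \<Rightarrow> ('n \<Rightarrow> real option) measure" where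
  "obs_law g K = distr (full_law g K) obs_space mask"

definition sample_space :: "nat \<Rightarrow> (nat \<Rightarrow> 'n \<Rightarrow> real option) measure" where
  "sample_space N = (\<Pi>\<^sub>M i\<in>{..<N}. obs_space)"

definition sample_law :: "nat \<Rightarrow> (real ^ 'n \<Rightarrow> real) \<Rightarrow>
    (real ^ 'n \<Rightarrow> ('n \<Rightarrow> bool) pmf) \<Rightarrow> (nat \<Rightarrow> 'n \<Rightarrow> real option) measure" where
  "sample_law N g K = (\<Pi>\<^sub>M i\<in>{..<N}. obs_law g K)"


definition L2 :: "(real ^ 'n \<Rightarrow> real) \<Rightarrow> (real ^ 'n \<Rightarrow> real) set" where
  "L2 f = {\<alpha> \<in> borel_measurable borel. integrable lborel (\<lambda>x. (\<alpha> x)\<^sup>2 * f x)}"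

definition H :: "(real ^ 'n \<Rightarrow> real) \<Rightarrow> 'n set \<Rightarrow> 'n set \<Rightarrow> (real ^ 'n \<Rightarrow> real) set" where
  "H f S0 S = {\<alpha> \<in> L2 f. (\<forall>x y. restr S x = restr S y \<longrightarrow> \<alpha> x = \<alpha> y) \<and>
     (\<integral>x. \<alpha> x * f x \<partial>lborel) = 0 \<and> (AE x in law f. cond_given f S0 \<alpha> x = 0)}"

definition Lfun ::
    "(real ^ 'n \<Rightarrow> real) \<Rightarrow> (real ^ 'n \<Rightarrow> real) \<Rightarrow> 'n set \<Rightarrow> 'n set set \<Rightarrow>
     ('n set \<Rightarrow> real ^ 'n \<Rightarrow> real) \<Rightarrow> ('n set \<Rightarrow> ('n \<Rightarrow> real) \<Rightarrow> real) \<Rightarrow> real" where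
  "Lfun f a S0 SS \<alpha> M = (\<integral>x.
      1 / M UNIV (restr S0 x) * (a x - cond_given f S0 a x - (\<Sum>S\<in>SS. \<alpha> S x))\<^sup>2
      + (\<Sum>S\<in>SS. (\<alpha> S x)\<^sup>2 / M S (restr S0 x)) \<partial>law f)"

definition kfun :: "real \<Rightarrow> real" where
  "kfun u = 1 / 2 + inverse (1 + exp (- 4 * u))"

definition perturb :: "(real ^ 'n \<Rightarrow> real) \<Rightarrow> (real ^ 'n \<Rightarrow> real) \<Rightarrow> real ^ 'n \<Rightarrow> real" where
  "perturb f h x = kfun (h x) * f x / (\<integral>y. kfun (h y) * f y \<partial>lborel)"

text \<open>\<open>E\<^sub>g[N {T - \<theta>(g)}\<^sup>2]\<close>, with value \<open>\<infinity>\<close> allowed.\<close>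

definition scaled_risk :: "(real ^ 'n \<Rightarrow> real) \<Rightarrow> (real ^ 'n \<Rightarrow> ('n \<Rightarrow> bool) pmf) \<Rightarrow> nat \<Rightarrow>
    ((nat \<Rightarrow> 'n \<Rightarrow> real option) \<Rightarrow> real) \<Rightarrow> (real ^ 'n \<Rightarrow> real) \<Rightarrow> ennreal" where
  "scaled_risk a K N T g = (\<integral>\<^sup>+z. ennreal (real N * (T z - theta a g)\<^sup>2) \<partial>sample_law N g K)"


lemma sets_option_borel: "sets option_borel = {A. Some -` A \<in> sets borel}"
proof -
  have "sigma_algebra (UNIV :: real option set) {A. Some -` A \<in> sets borel}"
    unfolding sigma_algebra_iff2
  proof (intro conjI allI ballI impI)
    fix A :: "real option set" assume "A \<in> {A. Some -` A \<in> sets borel}"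
    then have "UNIV - Some -` A \<in> sets borel" using sets.compl_sets[of "Some -` A" borel] by simp
    then show "UNIV - A \<in> {A. Some -` A \<in> sets borel}" by (simp add: vimage_Diff)
  next
    fix A :: "nat \<Rightarrow> real option set" assume "range A \<subseteq> {A. Some -` A \<in> sets borel}"
    then have "(\<Union>i. Some -` A i) \<in> sets borel" by blast
    then show "\<Union> (range A) \<in> {A. Some -` A \<in> sets borel}" by (simp add: vimage_UN)
  qed auto
  then show ?thesis
    unfolding option_borel_def by (simp add: sigma_algebra.sigma_sets_eq)
qed

lemma space_option_borel: "space option_borel = UNIV"
  unfolding option_borel_def by simp

lemma measurable_restr: "restr S \<in> borel \<rightarrow>\<^sub>M coord_space S"
  unfolding restr_def coord_space_def by measurable

lemma measurable_mask:
  "(mask :: (real ^ 'a) \<times> ('a \<Rightarrow> bool) \<Rightarrow> _) \<in> borel \<Otimes>\<^sub>M count_space UNIV \<rightarrow>\<^sub>M obs_space"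
proof -
  have Some: "Some \<in> borel \<rightarrow>\<^sub>M option_borel"
    by (rule measurableI) (auto simp: sets_option_borel space_option_borel)
  have "(\<lambda>z. mask z j) \<in> borel \<Otimes>\<^sub>M count_space UNIV \<rightarrow>\<^sub>M option_borel" for j :: 'a
  proof -
    have 1: "(\<lambda>z. Some (fst z $ j)) \<in>
        (borel :: (real ^ 'a) measure) \<Otimes>\<^sub>M (count_space UNIV :: ('a \<Rightarrow> bool) measure) \<rightarrow>\<^sub>M option_borel"
      by (rule measurable_compose[OF _ Some], rule measurable_compose[OF measurable_fst])
         (intro borel_measurable_continuous_onI continuous_intros)
    have 2: "(\<lambda>z. None) \<in>
        (borel :: (real ^ 'a) measure) \<Otimes>\<^sub>M (count_space UNIV :: ('a \<Rightarrow> bool) measure) \<rightarrow>\<^sub>M option_borel"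
      by (simp add: space_option_borel)
    have 3: "Measurable.pred
        ((borel :: (real ^ 'a) measure) \<Otimes>\<^sub>M (count_space UNIV :: ('a \<Rightarrow> bool) measure)) (\<lambda>z. snd z j)"
      by (rule measurable_compose[OF measurable_snd]) simp
    show ?thesis
      using measurable_If[OF 1 2, of "\<lambda>z. snd z j"] 3
      by (simp add: mask_def case_prod_beta pred_def)
  qed
  then show ?thesis
    unfolding obs_space_def by (intro measurable_PiM_single') (auto simp: space_option_borel)
qed

lemma prob_space_full_law:
  assumes "prob_density g" "markov_kernel K"
  shows "prob_space (full_law g K)"
proof
  interpret C: finite_measure "count_space (UNIV :: ('a \<Rightarrow> bool) set)"
    by (rule finite_measure_count_space) simp
  have [measurable]: "g \<in> borel_measurable borel"
    "\<And>\<omega>. (\<lambda>x. pmf (K x) \<omega>) \<in> borel_measurable borel"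
    and g0: "\<And>x. 0 \<le> g x" and g1: "(\<integral>\<^sup>+x. ennreal (g x) \<partial>lborel) = 1"
    using assms by (auto simp: prob_density_def markov_kernel_def)
  have m: "(\<lambda>(x, \<omega>). ennreal (g x * pmf (K x) \<omega>))
      \<in> borel_measurable (lborel \<Otimes>\<^sub>M count_space UNIV)"
  proof -
    have "(\<lambda>z. ennreal (g (fst z) * pmf (K (fst z)) (snd z)))
        \<in> borel_measurable (lborel \<Otimes>\<^sub>M count_space UNIV)"
      by (rule measurable_compose_countable'[where I = UNIV and g = snd]) auto
    then show ?thesis by (simp add: case_prod_beta)
  qed
  have s: "(\<Sum>\<omega>\<in>UNIV. ennreal (g x * pmf (K x) \<omega>)) = ennreal (g x)" for x
    using g0 by (simp add: sum_ennreal flip: sum_distrib_left) (simp add: sum_pmf_eq_1)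
  show "emeasure (full_law g K) (space (full_law g K)) = 1"
    unfolding full_law_def
    by (simp add: emeasure_density m C.nn_integral_fst[symmetric] nn_integral_count_space_finite s g1)
qed

end

theory Submission
  imports Defs "HOL-Real_Asymp.Real_Asymp"
begin

text \<open>
  Let \<open>P\<close> be the law with density \<open>f\<close>, write \<open>E\<^sub>S\<close> for conditional expectation given \<open>X\<^sub>S\<close> under \<open>P\<close>, and
  let \<open>w\<^sub>S(x) = M\<^sub>S(x\<^bsub>S0\<^esub>)\<close> for \<open>S\<close> in the set \<open>SS\<^sub>+\<close> of patterns. Patterns outside \<open>SS\<^sub>+\<close> have probability
  zero, so these weights sum to one almost surely. If the density moves in a direction \<open>h\<close> of mean
  zero, the score of one observation with pattern \<open>S\<close> is \<open>E\<^sub>S h\<close>. Hence the Fisher information of an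
  observation is \<open>J(h) = \<Sum>\<^sub>S E[w\<^sub>S (E\<^sub>S h)\<^sup>2]\<close>, while \<open>\<theta>\<close> has derivative \<open>\<langle>a, h\<rangle> = E[a h]\<close>. The
  theorem has two halves: a bound of Cramer-Rao type for each direction, and the choice of an almost
  least favourable direction.

  \<^emph>\<open>The risk bound.\<close> Let \<open>B\<close> be the left-hand side of the theorem, taken to be finite. For a bounded
  \<open>h\<close> of mean zero the finite set \<open>{0, \<delta>h, 2\<delta>h, \<dots>, n\<delta>h}\<close> is used. For two neighbouring points of
  this grid, the inequality of Hammersley, Chapman and Robbins for biased estimators says that
  the change of the bias plus the change of \<open>\<theta>\<close> is at most the square root of the risk times that of
  the chi-square divergence of the two samples (\<open>bias_change_le\<close>). Summed over the grid, the biases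
  telescope, and the two that remain are bounded by the square root of the risk
  (\<open>chain_lower_bound\<close>). As \<open>N \<rightarrow> \<infinity>\<close>, the chi-square divergence for
  \<open>N\<close> observations is asymptotically at most \<open>exp(\<delta>\<^sup>2 J(h)) - 1\<close>, because \<open>N\<close> times the divergence for
  one observation tends to \<open>\<delta>\<^sup>2 J(h)\<close> (\<open>chi_square_limit\<close>). This gives
  \<open>n \<delta> \<langle>a, h\<rangle> \<le> \<surd>B (2 + n \<surd>(exp(\<delta>\<^sup>2 J(h)) - 1))\<close> up to an arbitrarily small error, and \<open>n \<rightarrow> \<infinity>\<close>
  followed by \<open>\<delta> \<rightarrow> 0\<close> yields \<open>\<langle>a, h\<rangle> \<le> \<surd>(B J(h))\<close> (\<open>linear_functional_le_risk\<close>). Consequently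
  \<open>2\<langle>a, h\<rangle> - J(h) \<le> B\<close>, and in this form the bound passes from bounded directions to all
  directions of mean zero in \<open>L\<^sup>2\<close>, by truncation.

  \<^emph>\<open>The direction.\<close> On functions of mean zero, the concave functional \<open>2\<langle>a, h\<rangle> - J(h)\<close> is maximal where
  \<open>\<Sum>\<^sub>S w\<^sub>S E\<^sub>S h = a - E a\<close>. Put \<open>a\<^sub>0 = E\<^bsub>S0\<^esub> a\<close>. With \<open>h = a\<^sub>0 - E a + g\<close> and \<open>E\<^bsub>S0\<^esub> g = 0\<close> the equation
  becomes \<open>\<Sum>\<^sub>S w\<^sub>S E\<^sub>S g = a - a\<^sub>0\<close>, and a solution \<open>g\<close> turns \<open>\<alpha>\<^sub>S = w\<^sub>S E\<^sub>S g\<close> into an admissible family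
  for which \<open>Var(a\<^sub>0) + \<L>(\<alpha>) = 2\<langle>a, h\<rangle> - J(h)\<close>. This is at most \<open>B\<close>, and the infimum in the theorem
  is at most \<open>\<L>(\<alpha>)\<close>. It is enough to solve the equation approximately: the map
  \<open>g \<mapsto> g - \<Sum>\<^sub>S w\<^sub>S E\<^sub>S g\<close> is a contraction because the complete pattern has weight at least \<open>c > 0\<close>
  (\<open>residual_contraction\<close>), so finitely many steps of the Richardson iteration leave a residual
  \<open>r\<close> with \<open>E r\<^sup>2\<close> as small as desired (\<open>approximate_solution\<close>), and the residual costs only
  \<open>E r\<^sup>2 / c\<close> (\<open>loss_le_dual_value\<close>).
\<close>

section \<open>Square-integrable functions\<close>

definition square_integrable :: "'a measure \<Rightarrow> ('a \<Rightarrow> real) \<Rightarrow> bool" where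
  "square_integrable M u \<longleftrightarrow> u \<in> borel_measurable M \<and> integrable M (\<lambda>x. (u x)\<^sup>2)"

lemma square_integrableD:
  assumes "square_integrable M u"
  shows "u \<in> borel_measurable M" "integrable M (\<lambda>x. (u x)\<^sup>2)"
  using assms by (auto simp: square_integrable_def)

lemma integrable_mult_square_integrable:
  assumes u: "square_integrable M u" and v: "square_integrable M v"
  shows "integrable M (\<lambda>x. u x * v x)"
proof (rule Bochner_Integration.integrable_bound)
  note [measurable] = square_integrableD(1)[OF u] square_integrableD(1)[OF v]
  show "integrable M (\<lambda>x. (u x)\<^sup>2 + (v x)\<^sup>2)"
    using u v by (auto simp: square_integrable_def)
  show "(\<lambda>x. u x * v x) \<in> borel_measurable M" by measurable
  have "norm (s * t) \<le> norm (s\<^sup>2 + t\<^sup>2)" for s t :: real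
  proof -
    have "2 * \<bar>s * t\<bar> \<le> s\<^sup>2 + t\<^sup>2"
      using sum_squares_bound[of "\<bar>s\<bar>" "\<bar>t\<bar>"] by (simp add: abs_mult mult.assoc)
    then show ?thesis unfolding real_norm_def by linarith
  qed
  then show "AE x in M. norm (u x * v x) \<le> norm ((u x)\<^sup>2 + (v x)\<^sup>2)" by simp
qed

lemma square_integrable_add:
  assumes u: "square_integrable M u" and v: "square_integrable M v"
  shows "square_integrable M (\<lambda>x. u x + v x)"
proof -
  note [measurable] = square_integrableD(1)[OF u] square_integrableD(1)[OF v]
  have "integrable M (\<lambda>x. (u x)\<^sup>2 + (v x)\<^sup>2 + 2 * (u x * v x))"
    using u v integrable_mult_square_integrable[OF u v] by (auto simp: square_integrable_def)
  then show ?thesis by (simp add: square_integrable_def power2_sum mult.assoc)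
qed

lemma square_integrable_mult_bounded:
  assumes u: "square_integrable M u" and [measurable]: "m \<in> borel_measurable M"
    and m: "AE x in M. \<bar>m x\<bar> \<le> b"
  shows "square_integrable M (\<lambda>x. m x * u x)"
proof -
  note [measurable] = square_integrableD(1)[OF u]
  have "integrable M (\<lambda>x. (m x * u x)\<^sup>2)"
  proof (rule Bochner_Integration.integrable_bound)
    show "integrable M (\<lambda>x. b\<^sup>2 * (u x)\<^sup>2)" using u by (auto simp: square_integrable_def)
    show "AE x in M. norm ((m x * u x)\<^sup>2) \<le> norm (b\<^sup>2 * (u x)\<^sup>2)"
      using m by eventually_elim
        (auto simp: power_mult_distrib intro!: mult_right_mono simp flip: abs_le_square_iff)
  qed measurable
  then show ?thesis by (simp add: square_integrable_def)
qed

lemma square_integrable_cmult: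
  "square_integrable M u \<Longrightarrow> square_integrable M (\<lambda>x. c * u x)"
  using square_integrable_mult_bounded[of M u "\<lambda>_. c" "\<bar>c\<bar>"] by simp

lemma square_integrable_diff:
  assumes u: "square_integrable M u" and v: "square_integrable M v"
  shows "square_integrable M (\<lambda>x. u x - v x)"
  using square_integrable_add[OF u square_integrable_cmult[OF v, of "-1"]] by simp

lemma square_integrable_sum:
  assumes "\<And>i. i \<in> I \<Longrightarrow> square_integrable M (u i)"
  shows "square_integrable M (\<lambda>x. \<Sum>i\<in>I. u i x)"
  using assms
proof (induction I rule: infinite_finite_induct)
  case (insert i I)
  then show ?case by (simp add: square_integrable_add)
qed (auto simp: square_integrable_def)

lemma (in finite_measure) square_integrable_bounded:
  assumes [measurable]: "u \<in> borel_measurable M" and u: "AE x in M. \<bar>u x\<bar> \<le> b"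
  shows "square_integrable M u"
  unfolding square_integrable_def
proof (intro conjI integrable_const_bound[where B = "b\<^sup>2"])
  show "AE x in M. norm ((u x)\<^sup>2) \<le> b\<^sup>2"
    using u by eventually_elim (metis abs_le_square_iff abs_ge_self norm_power order_trans power2_abs real_norm_def)
qed measurable

lemma (in finite_measure) square_integrable_const: "square_integrable M (\<lambda>_. t)"
  by (rule square_integrable_bounded[of _ "\<bar>t\<bar>"]) auto

lemma (in finite_measure) integrable_square_integrable:
  "square_integrable M u \<Longrightarrow> integrable M u"
  using integrable_mult_square_integrable[of M u "\<lambda>_. 1"] by (simp add: square_integrable_def)

lemma Cauchy_Schwarz_integral:
  assumes u: "square_integrable M u" and v: "square_integrable M v"
  shows "\<bar>\<integral>x. u x * v x \<partial>M\<bar> \<le> sqrt (\<integral>x. (u x)\<^sup>2 \<partial>M) * sqrt (\<integral>x. (v x)\<^sup>2 \<partial>M)"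
proof -
  note [measurable] = square_integrableD(1)[OF u] square_integrableD(1)[OF v]
  have uv: "integrable M (\<lambda>x. u x * v x)" by (rule integrable_mult_square_integrable[OF u v])
  have "(\<integral>\<^sup>+x. ennreal \<bar>u x\<bar> * ennreal \<bar>v x\<bar> \<partial>M)\<^sup>2 \<le> (\<integral>\<^sup>+x. ennreal \<bar>u x\<bar> ^ 2 \<partial>M) * (\<integral>\<^sup>+x. ennreal \<bar>v x\<bar> ^ 2 \<partial>M)"
    by (rule Cauchy_Schwarz_nn_integral) measurable
  also have "(\<integral>\<^sup>+x. ennreal \<bar>u x\<bar> ^ 2 \<partial>M) = ennreal (\<integral>x. (u x)\<^sup>2 \<partial>M)"
    using u by (simp add: ennreal_power square_integrable_def nn_integral_eq_integral)
  also have "(\<integral>\<^sup>+x. ennreal \<bar>v x\<bar> ^ 2 \<partial>M) = ennreal (\<integral>x. (v x)\<^sup>2 \<partial>M)"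
    using v by (simp add: ennreal_power square_integrable_def nn_integral_eq_integral)
  also have "(\<integral>\<^sup>+x. ennreal \<bar>u x\<bar> * ennreal \<bar>v x\<bar> \<partial>M) = ennreal (\<integral>x. \<bar>u x * v x\<bar> \<partial>M)"
    using nn_integral_eq_integral[OF integrable_abs[OF uv]] by (simp add: ennreal_mult' abs_mult)
  finally have "(\<integral>x. \<bar>u x * v x\<bar> \<partial>M)\<^sup>2 \<le> (\<integral>x. (u x)\<^sup>2 \<partial>M) * (\<integral>x. (v x)\<^sup>2 \<partial>M)"
    by (simp add: ennreal_power flip: ennreal_mult)
  then have "(\<integral>x. \<bar>u x * v x\<bar> \<partial>M) \<le> sqrt ((\<integral>x. (u x)\<^sup>2 \<partial>M) * (\<integral>x. (v x)\<^sup>2 \<partial>M))"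
    by (rule real_le_rsqrt)
  then show ?thesis
    using order_trans[OF integral_abs_bound[of M "\<lambda>x. u x * v x"]] by (simp add: real_sqrt_mult)
qed

text \<open>Conditional expectation is a contraction of \<open>L\<^sup>2\<close>, by Jensen's inequality for the square.\<close>

lemma (in finite_measure_subalgebra) square_integrable_cond_exp:
  assumes u: "square_integrable M u"
  shows "square_integrable M (real_cond_exp M F u)"
    and "(\<integral>x. (real_cond_exp M F u x)\<^sup>2 \<partial>M) \<le> (\<integral>x. (u x)\<^sup>2 \<partial>M)"
proof -
  have int: "integrable M u" "integrable M (\<lambda>x. (u x)\<^sup>2)"
    by (rule integrable_square_integrable[OF u], rule square_integrableD(2)[OF u])
  have conv: "convex_on UNIV (\<lambda>x::real. x\<^sup>2)" 
    by (rule convex_power_even) simp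
  have i2: "integrable M (\<lambda>x. (real_cond_exp M F u x)\<^sup>2)"
    by (rule integrable_convex_cond_exp[OF int(1) _ _ int(2) conv]) simp_all
  then show "square_integrable M (real_cond_exp M F u)" by (simp add: square_integrable_def)
  have "AE x in M. (real_cond_exp M F u x)\<^sup>2 \<le> real_cond_exp M F (\<lambda>x. (u x)\<^sup>2) x"
    by (rule real_cond_exp_jensens_inequality(2)[OF int(1) _ _ int(2) conv]) simp_all
  then have "(\<integral>x. (real_cond_exp M F u x)\<^sup>2 \<partial>M) \<le> (\<integral>x. real_cond_exp M F (\<lambda>x. (u x)\<^sup>2) x \<partial>M)"
    by (intro integral_mono_AE i2 real_cond_exp_int(1)[OF int(2)])
  then show "(\<integral>x. (real_cond_exp M F u x)\<^sup>2 \<partial>M) \<le> (\<integral>x. (u x)\<^sup>2 \<partial>M)"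
    using real_cond_exp_int(2)[OF int(2)] by simp
qed

section \<open>Weighted families of conditional expectations\<close>

text \<open>The part of the argument that only concerns conditional expectations. The \<open>F i\<close> stand for the
  sigma-algebras generated by the coordinates seen under a missingness pattern, and \<open>F0\<close> for the
  coordinates that decide about missingness; the index \<open>top\<close> stands for complete observation.
  Two features drive everything below: the weights are measurable with respect to every
  \<open>F i\<close>, so that they commute with the projections, and the weight of \<open>top\<close> is bounded away
  from zero.\<close>

locale weighted_projections = prob_space +
  fixes F0 :: "'a measure" and F :: "'i \<Rightarrow> 'a measure" and I :: "'i set" and top :: 'i
    and w :: "'i \<Rightarrow> 'a \<Rightarrow> real" and c :: real
  assumes finite_I: "finite I" and top_I: "top \<in> I"
    and subalg_F: "\<And>i. i \<in> I \<Longrightarrow> subalgebra M (F i)"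
    and subalg_F0: "\<And>i. i \<in> I \<Longrightarrow> subalgebra (F i) F0"
    and sets_top: "sets (F top) = sets M"
    and w_meas0: "\<And>i. i \<in> I \<Longrightarrow> w i \<in> borel_measurable F0"
    and w_ge: "\<And>i x. i \<in> I \<Longrightarrow> c \<le> w i x"
    and w_le: "\<And>i x. i \<in> I \<Longrightarrow> w i x \<le> 1"
    and w_sum: "AE x in M. (\<Sum>i\<in>I. w i x) = 1"
    and c_pos: "0 < c"
begin

abbreviation proj :: "'i \<Rightarrow> ('a \<Rightarrow> real) \<Rightarrow> 'a \<Rightarrow> real" where
  "proj i \<equiv> real_cond_exp M (F i)"

abbreviation proj0 :: "('a \<Rightarrow> real) \<Rightarrow> 'a \<Rightarrow> real" where
  "proj0 \<equiv> real_cond_exp M F0"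

text \<open>The Fisher information about a direction \<open>u\<close> when, with conditional probability \<open>w i\<close>, only the
  information in \<open>F i\<close> is observed: the score is then the conditional expectation of \<open>u\<close>.\<close>

definition information :: "('a \<Rightarrow> real) \<Rightarrow> real" where
  "information u = (\<Sum>i\<in>I. \<integral>x. w i x * (proj i u x)\<^sup>2 \<partial>M)"

lemma subalg0: "subalgebra M F0"
  using subalg_F[OF top_I] subalg_F0[OF top_I] by (auto simp: subalgebra_def)

lemma subalg_cond_exp: "i \<in> I \<Longrightarrow> finite_measure_subalgebra M (F i)"
  using subalg_F by unfold_locales

lemma subalg_cond_exp0: "finite_measure_subalgebra M F0"
  using subalg0 by unfold_locales

lemma measurable_F0_F: "i \<in> I \<Longrightarrow> u \<in> borel_measurable F0 \<Longrightarrow> u \<in> borel_measurable (F i)"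
  using subalg_F0 measurable_from_subalg by blast

lemma w_meas: "i \<in> I \<Longrightarrow> w i \<in> borel_measurable M"
  using w_meas0 measurable_from_subalg[OF subalg0] by blast

lemma w_abs: "i \<in> I \<Longrightarrow> \<bar>w i x\<bar> \<le> 1"
  using w_ge[of i x] w_le[of i x] c_pos by simp

lemma w_nonneg: "i \<in> I \<Longrightarrow> 0 \<le> w i x"
  using w_ge[of i x] c_pos by simp

lemma square_integrable_w:
  assumes "i \<in> I" "square_integrable M u"
  shows "square_integrable M (\<lambda>x. w i x * u x)"
  by (rule square_integrable_mult_bounded[OF assms(2) w_meas[OF assms(1)], where b = 1])
    (simp add: w_abs[OF assms(1)])

lemma square_integrable_proj: "i \<in> I \<Longrightarrow> square_integrable M u \<Longrightarrow> square_integrable M (proj i u)"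
  using finite_measure_subalgebra.square_integrable_cond_exp(1)[OF subalg_cond_exp] .

lemma square_integrable_proj0: "square_integrable M u \<Longrightarrow> square_integrable M (proj0 u)"
  using finite_measure_subalgebra.square_integrable_cond_exp(1)[OF subalg_cond_exp0] .

lemma information_nonneg: "0 \<le> information u"
  unfolding information_def by (intro sum_nonneg integral_nonneg_AE) (simp add: w_nonneg)

lemma proj_adjoint:
  assumes i: "i \<in> I" and m: "m \<in> borel_measurable (F i)" and sm: "square_integrable M m"
    and u: "square_integrable M u"
  shows "(\<integral>x. m x * proj i u x \<partial>M) = (\<integral>x. m x * u x \<partial>M)"
proof -
  interpret Fi: finite_measure_subalgebra M "F i" by (rule subalg_cond_exp[OF i])
  show ?thesis
    by (rule Fi.real_cond_exp_intg(2)[OF integrable_mult_square_integrable[OF sm u] m square_integrableD(1)[OF u]])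
qed

lemma proj0_adjoint:
  assumes m: "m \<in> borel_measurable F0" and sm: "square_integrable M m"
    and u: "square_integrable M u"
  shows "(\<integral>x. m x * proj0 u x \<partial>M) = (\<integral>x. m x * u x \<partial>M)"
proof -
  interpret Fi: finite_measure_subalgebra M F0 by (rule subalg_cond_exp0)
  show ?thesis
    by (rule Fi.real_cond_exp_intg(2)[OF integrable_mult_square_integrable[OF sm u] m square_integrableD(1)[OF u]])
qed

lemma proj0_orthogonal:
  assumes m: "m \<in> borel_measurable F0" and sm: "square_integrable M m"
    and u: "square_integrable M u" and u0: "AE x in M. proj0 u x = 0"
  shows "(\<integral>x. m x * u x \<partial>M) = 0"
proof -
  have "(\<integral>x. m x * proj0 u x \<partial>M) = (\<integral>x. 0 \<partial>M)"
    by (rule integral_cong_AE)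
      (use u0 square_integrableD(1)[OF sm] in auto)
  then show ?thesis using proj0_adjoint[OF m sm u] by simp
qed

lemma proj_top:
  assumes u: "square_integrable M u"
  shows "AE x in M. proj top u x = u x"
proof -
  interpret Fi: finite_measure_subalgebra M "F top" by (rule subalg_cond_exp[OF top_I])
  have sp: "space (F top) = space M" using subalg_F[OF top_I] by (simp add: subalgebra_def)
  have "u \<in> borel_measurable (F top)"
    using square_integrableD(1)[OF u] sets_top sp by (simp add: measurable_def)
  then show ?thesis
    by (rule Fi.real_cond_exp_F_meas[OF integrable_square_integrable[OF u]])
qed

lemma integral_w_proj_sq:
  assumes i: "i \<in> I" and u: "square_integrable M u"
  shows "(\<integral>x. w i x * (proj i u x)\<^sup>2 \<partial>M) = (\<integral>x. w i x * proj i u x * u x \<partial>M)"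
proof -
  have "(\<integral>x. (w i x * proj i u x) * proj i u x \<partial>M) = (\<integral>x. (w i x * proj i u x) * u x \<partial>M)"
    by (rule proj_adjoint[OF i _ square_integrable_w[OF i square_integrable_proj[OF i u]] u])
      (use measurable_F0_F[OF i w_meas0[OF i]] in simp)
  then show ?thesis by (simp add: power2_eq_square mult.assoc)
qed

text \<open>The positive operator whose quadratic form is \<open>information\<close>.\<close>

definition avg :: "('a \<Rightarrow> real) \<Rightarrow> 'a \<Rightarrow> real" where
  "avg u = (\<lambda>x. \<Sum>i\<in>I. w i x * proj i u x)"

lemma square_integrable_avg: "square_integrable M u \<Longrightarrow> square_integrable M (avg u)"
  unfolding avg_def by (intro square_integrable_sum square_integrable_w square_integrable_proj)

text \<open>On \<open>F0\<close> nothing is lost: by the tower property each summand contributes \<open>w i\<close> times the same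
  function, and the weights add up to one. This keeps the iteration below among the functions whose
  conditional expectation given \<open>F0\<close> vanishes.\<close>

lemma proj0_avg:
  assumes u: "square_integrable M u"
  shows "AE x in M. proj0 (avg u) x = proj0 u x"
proof -
  interpret F0: finite_measure_subalgebra M F0 by (rule subalg_cond_exp0)
  have int: "integrable M (\<lambda>x. if i \<in> I then w i x * proj i u x else 0)" for i
    using integrable_square_integrable[OF square_integrable_w[OF _ square_integrable_proj[OF _ u]], of i i] by (cases "i \<in> I") auto
  have sum_if: "(\<lambda>x. \<Sum>i\<in>I. if i \<in> I then w i x * proj i u x else 0) = avg u"
    unfolding avg_def by (intro ext sum.cong) auto
  have 1: "AE x in M. proj0 (avg u) x
      = (\<Sum>i\<in>I. proj0 (\<lambda>x. if i \<in> I then w i x * proj i u x else 0) x)"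
    using F0.real_cond_exp_sum[of "\<lambda>i x. if i \<in> I then w i x * proj i u x else 0" I, OF int] unfolding sum_if .
  have 2: "AE x in M. proj0 (\<lambda>x. if i \<in> I then w i x * proj i u x else 0) x = w i x * proj0 u x"
    if i: "i \<in> I" for i
  proof -
    have "AE x in M. proj0 (\<lambda>x. w i x * proj i u x) x = w i x * proj0 (proj i u) x"
      using int[of i] i
      by (intro F0.real_cond_exp_mult w_meas0 square_integrableD(1)[OF square_integrable_proj] u) auto
    moreover have "AE x in M. proj0 (proj i u) x = proj0 u x"
      by (rule F0.real_cond_exp_nested_subalg[OF subalg_F[OF i] subalg_F0[OF i] integrable_square_integrable[OF u]])
    ultimately show ?thesis using i by auto
  qed
  have "AE x in M. \<forall>i\<in>I. proj0 (\<lambda>x. if i \<in> I then w i x * proj i u x else 0) x = w i x * proj0 u x"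
    using 2 finite_I by (simp add: AE_finite_all)
  with 1 w_sum show ?thesis
  proof eventually_elim
    case (elim x)
    have "proj0 (avg u) x = (\<Sum>i\<in>I. w i x * proj0 u x)" using elim by simp
    also have "\<dots> = proj0 u x" using elim by (simp flip: sum_distrib_right)
    finally show ?case .
  qed
qed

text \<open>Almost surely \<open>u - avg u = \<Sum> w i * (u - proj i u)\<close>, where the index \<open>top\<close> contributes nothing, so
  the weights that matter have sum at most \<open>1 - c\<close>. One factor \<open>1 - c\<close> comes from Cauchy-Schwarz for
  this weighted sum. The second one comes from summing
  \<open>E[w i * (u - proj i u)\<^sup>2] \<le> E[w i * u\<^sup>2]\<close>, which is Pythagoras with a weight, over the same indices.\<close>

lemma residual_contraction:
  assumes u: "square_integrable M u"
  shows "(\<integral>x. (u x - avg u x)\<^sup>2 \<partial>M) \<le> (1 - c)\<^sup>2 * (\<integral>x. (u x)\<^sup>2 \<partial>M)"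
proof -
  let ?J = "I - {top}"
  note [measurable] = square_integrableD(1)[OF u] square_integrableD(1)[OF square_integrable_avg[OF u]] w_meas
  have J: "i \<in> I" if "i \<in> ?J" for i using that by simp
  have pw: "AE x in M. (u x - avg u x)\<^sup>2 \<le> (1 - c) * (\<Sum>i\<in>?J. w i x * (u x - proj i u x)\<^sup>2)"
    using w_sum proj_top[OF u]
  proof eventually_elim
    case (elim x)
    have "(\<Sum>i\<in>I. w i x) = w top x + (\<Sum>i\<in>?J. w i x)"
      by (rule sum.remove[OF finite_I top_I])
    then have wJ: "(\<Sum>i\<in>?J. w i x) = 1 - w top x" using elim by simp
    have "avg u x = w top x * u x + (\<Sum>i\<in>?J. w i x * proj i u x)"
      unfolding avg_def using sum.remove[OF finite_I top_I, of "\<lambda>i. w i x * proj i u x"] elim by simp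
    moreover have "u x = w top x * u x + (\<Sum>i\<in>?J. w i x * u x)"
      by (simp add: wJ left_diff_distrib flip: sum_distrib_right)
    ultimately have "u x - avg u x = (\<Sum>i\<in>?J. w i x * (u x - proj i u x))"
      by (simp add: right_diff_distrib sum_subtractf)
    \<comment> \<open>The weight is split evenly, so that Cauchy-Schwarz keeps one power of it in each factor.\<close>
    also have "\<dots> = (\<Sum>i\<in>?J. sqrt (w i x) * (sqrt (w i x) * (u x - proj i u x)))"
      by (intro sum.cong refl) (simp add: w_nonneg[OF J] flip: mult.assoc)
    finally have "(u x - avg u x)\<^sup>2 = (\<Sum>i\<in>?J. sqrt (w i x) * (sqrt (w i x) * (u x - proj i u x)))\<^sup>2"
      by simp
    also have "\<dots> \<le> (\<Sum>i\<in>?J. (sqrt (w i x))\<^sup>2) * (\<Sum>i\<in>?J. (sqrt (w i x) * (u x - proj i u x))\<^sup>2)"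
      by (rule Cauchy_Schwarz_ineq_sum)
    also have "\<dots> = (1 - w top x) * (\<Sum>i\<in>?J. w i x * (u x - proj i u x)\<^sup>2)"
      by (simp add: power_mult_distrib w_nonneg[OF J] wJ)
    also have "\<dots> \<le> (1 - c) * (\<Sum>i\<in>?J. w i x * (u x - proj i u x)\<^sup>2)"
      using w_ge[OF top_I, of x] by (intro mult_right_mono sum_nonneg mult_nonneg_nonneg w_nonneg J) auto
    finally show ?case .
  qed
  have int: "integrable M (\<lambda>x. w i x * (u x - proj i u x)\<^sup>2)" if i: "i \<in> I" for i
  proof -
    have s: "square_integrable M (\<lambda>x. u x - proj i u x)"
      by (intro square_integrable_diff u square_integrable_proj i)
    show ?thesis
      using integrable_mult_square_integrable[OF square_integrable_w[OF i s] s] by (simp add: power2_eq_square mult.assoc)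
  qed
  have int2: "integrable M (\<lambda>x. w i x * (v x)\<^sup>2)" if i: "i \<in> I" and s: "square_integrable M v" for i v
    using integrable_mult_square_integrable[OF square_integrable_w[OF i s] s] by (simp add: power2_eq_square mult.assoc)
  have int3: "integrable M (\<lambda>x. w i x * proj i u x * u x)" if i: "i \<in> I" for i
    by (rule integrable_mult_square_integrable[OF square_integrable_w[OF i square_integrable_proj[OF i u]] u])
  have le: "(\<integral>x. w i x * (u x - proj i u x)\<^sup>2 \<partial>M) \<le> (\<integral>x. w i x * (u x)\<^sup>2 \<partial>M)" if i: "i \<in> I" for i
  proof -
    have "(\<integral>x. w i x * (u x - proj i u x)\<^sup>2 \<partial>M)
        = (\<integral>x. w i x * (u x)\<^sup>2 - 2 * (w i x * proj i u x * u x) + w i x * (proj i u x)\<^sup>2 \<partial>M)"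
      by (intro Bochner_Integration.integral_cong refl) (simp add: power2_eq_square algebra_simps)
    also have "\<dots> = (\<integral>x. w i x * (u x)\<^sup>2 \<partial>M) - (\<integral>x. w i x * (proj i u x)\<^sup>2 \<partial>M)"
      using int2[OF i u] int3[OF i] int2[OF i square_integrable_proj[OF i u]] integral_w_proj_sq[OF i u] by simp
    also have "\<dots> \<le> (\<integral>x. w i x * (u x)\<^sup>2 \<partial>M)"
      by (simp add: integral_nonneg_AE w_nonneg[OF i])
    finally show ?thesis .
  qed
  have c1: "c \<le> 1" using w_ge[OF top_I, of undefined] w_le[OF top_I, of undefined] by simp
  have "(\<integral>x. (u x - avg u x)\<^sup>2 \<partial>M) \<le> (\<integral>x. (1 - c) * (\<Sum>i\<in>?J. w i x * (u x - proj i u x)\<^sup>2) \<partial>M)"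
    by (rule integral_mono_AE[OF square_integrableD(2)[OF square_integrable_diff[OF u square_integrable_avg[OF u]]] _ pw])
      (rule integrable_mult_right, rule Bochner_Integration.integrable_sum, rule int, erule J)
  also have "\<dots> = (1 - c) * (\<Sum>i\<in>?J. \<integral>x. w i x * (u x - proj i u x)\<^sup>2 \<partial>M)"
    by (simp only: integral_mult_right_zero Bochner_Integration.integral_sum[OF int[OF J]])
  also have "\<dots> \<le> (1 - c) * (\<Sum>i\<in>?J. \<integral>x. w i x * (u x)\<^sup>2 \<partial>M)"
    by (intro mult_left_mono sum_mono le J) (simp_all add: c1)
  also have "(\<Sum>i\<in>?J. \<integral>x. w i x * (u x)\<^sup>2 \<partial>M) = (\<integral>x. (\<Sum>i\<in>?J. w i x * (u x)\<^sup>2) \<partial>M)"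
    by (rule Bochner_Integration.integral_sum[OF int2[OF J u], symmetric])
  also have "(1 - c) * \<dots> \<le> (1 - c) * (\<integral>x. (1 - c) * (u x)\<^sup>2 \<partial>M)"
  proof (intro mult_left_mono integral_mono_AE)
    show "AE x in M. (\<Sum>i\<in>?J. w i x * (u x)\<^sup>2) \<le> (1 - c) * (u x)\<^sup>2"
      using w_sum
    proof eventually_elim
      case (elim x)
      have "(\<Sum>i\<in>I. w i x) = w top x + (\<Sum>i\<in>?J. w i x)"
        by (rule sum.remove[OF finite_I top_I])
      then have "(\<Sum>i\<in>?J. w i x) \<le> 1 - c" using elim w_ge[OF top_I, of x] by simp
      then show ?case by (simp add: mult_right_mono flip: sum_distrib_right)
    qed
    show "integrable M (\<lambda>x. \<Sum>i\<in>?J. w i x * (u x)\<^sup>2)"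
      by (rule Bochner_Integration.integrable_sum, rule int2[OF J u])
    show "integrable M (\<lambda>x. (1 - c) * (u x)\<^sup>2)"
      by (rule integrable_mult_right, rule square_integrableD(2)[OF u])
  qed (simp add: c1)
  finally show ?thesis by (simp add: power2_eq_square mult.assoc)
qed

text \<open>Richardson iteration for the equation \<open>avg g = b\<close>. Adding the current residual \<open>r\<close> to \<open>g\<close> replaces
  the residual by \<open>r - avg r\<close>, which \<open>residual_contraction\<close> makes smaller by a fixed factor.\<close>

lemma approximate_solution:
  assumes b: "square_integrable M b" and b0: "AE x in M. proj0 b x = 0" and "0 < \<epsilon>"
  obtains g r where "square_integrable M g" "square_integrable M r" "AE x in M. proj0 g x = 0"
    "AE x in M. b x = avg g x + r x" "(\<integral>x. (r x)\<^sup>2 \<partial>M) \<le> \<epsilon>"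
proof -
  interpret F0: finite_measure_subalgebra M F0 by (rule subalg_cond_exp0)
  let ?B = "\<integral>x. (b x)\<^sup>2 \<partial>M"
  have iter: "\<exists>g r. square_integrable M g \<and> square_integrable M r \<and> (AE x in M. proj0 g x = 0) \<and>
      (AE x in M. proj0 r x = 0) \<and> (AE x in M. b x = avg g x + r x) \<and>
      (\<integral>x. (r x)\<^sup>2 \<partial>M) \<le> ((1 - c)\<^sup>2) ^ n * ?B" for n
  proof (induction n)
    case 0
    have "square_integrable M (\<lambda>_. 0)" by (simp add: square_integrable_def)
    moreover have p0: "AE x in M. proj0 (\<lambda>_. 0) x = 0"
      using F0.real_cond_exp_F_meas[of "\<lambda>_. 0"] by simp
    moreover have "AE x in M. b x = avg (\<lambda>_. 0) x + b x"
    proof -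
      have "AE x in M. \<forall>i\<in>I. proj i (\<lambda>_. 0) x = 0"
      proof (subst AE_finite_all[OF finite_I], intro ballI)
        fix i assume "i \<in> I"
        then interpret Fi: finite_measure_subalgebra M "F i" by (rule subalg_cond_exp)
        show "AE x in M. proj i (\<lambda>_. 0) x = 0"
          using Fi.real_cond_exp_F_meas[of "\<lambda>_. 0"] by simp
      qed
      then show ?thesis by eventually_elim (simp add: avg_def)
    qed
    ultimately show ?case using b b0 by (intro exI[of _ "\<lambda>_. 0"] exI[of _ b]) simp
  next
    case (Suc n)
    then obtain g r where g: "square_integrable M g" and r: "square_integrable M r"
      and g0: "AE x in M. proj0 g x = 0" and r0: "AE x in M. proj0 r x = 0"
      and eq: "AE x in M. b x = avg g x + r x"
      and le: "(\<integral>x. (r x)\<^sup>2 \<partial>M) \<le> ((1 - c)\<^sup>2) ^ n * ?B" by blast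
    let ?g = "\<lambda>x. g x + r x" and ?r = "\<lambda>x. r x - avg r x"
    have "AE x in M. proj0 ?g x = proj0 g x + proj0 r x"
      by (intro F0.real_cond_exp_add integrable_square_integrable g r)
    with g0 r0 have g0': "AE x in M. proj0 ?g x = 0" by auto
    have "AE x in M. proj0 ?r x = proj0 r x - proj0 (avg r) x"
      by (intro F0.real_cond_exp_diff integrable_square_integrable square_integrable_avg r)
    with proj0_avg[OF r] have r0': "AE x in M. proj0 ?r x = 0" by auto
    have "AE x in M. \<forall>i\<in>I. proj i ?g x = proj i g x + proj i r x"
    proof (subst AE_finite_all[OF finite_I], intro ballI)
      fix i assume "i \<in> I"
      then interpret Fi: finite_measure_subalgebra M "F i" by (rule subalg_cond_exp)
      show "AE x in M. proj i ?g x = proj i g x + proj i r x"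
        by (intro Fi.real_cond_exp_add integrable_square_integrable g r)
    qed
    with eq have eq': "AE x in M. b x = avg ?g x + ?r x"
      by eventually_elim (simp add: avg_def distrib_left sum.distrib)
    have "(\<integral>x. (?r x)\<^sup>2 \<partial>M) \<le> (1 - c)\<^sup>2 * (\<integral>x. (r x)\<^sup>2 \<partial>M)" by (rule residual_contraction[OF r])
    also have "\<dots> \<le> (1 - c)\<^sup>2 * (((1 - c)\<^sup>2) ^ n * ?B)" using le by (intro mult_left_mono) auto
    finally have le': "(\<integral>x. (?r x)\<^sup>2 \<partial>M) \<le> ((1 - c)\<^sup>2) ^ Suc n * ?B" by (simp add: mult.assoc)
    show ?case
      using square_integrable_add[OF g r] square_integrable_diff[OF r square_integrable_avg[OF r]] g0' r0' eq' le' by blast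
  qed
  have c1: "c \<le> 1" using w_ge[OF top_I, of undefined] w_le[OF top_I, of undefined] by simp
  have "(1 - c)\<^sup>2 < 1" using c_pos c1 by (simp add: abs_square_less_1)
  then have "(\<lambda>n. ((1 - c)\<^sup>2) ^ n * ?B) \<longlonglongrightarrow> 0 * ?B"
    by (intro tendsto_mult LIMSEQ_power_zero) auto
  then have "eventually (\<lambda>n. ((1 - c)\<^sup>2) ^ n * ?B < \<epsilon>) sequentially"
    using \<open>0 < \<epsilon>\<close> by (intro order_tendstoD) auto
  then obtain n where n: "((1 - c)\<^sup>2) ^ n * ?B < \<epsilon>" by (auto simp: eventually_sequentially)
  from iter[of n] obtain g r where "square_integrable M g" "square_integrable M r" "AE x in M. proj0 g x = 0"
    "AE x in M. b x = avg g x + r x" "(\<integral>x. (r x)\<^sup>2 \<partial>M) \<le> ((1 - c)\<^sup>2) ^ n * ?B" by blast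
  with n show ?thesis by (intro that[of g r]) auto
qed


text \<open>The duality step. For \<open>r = 0\<close> the inequality is an equality: with \<open>v\<close> the variance of \<open>proj0 a\<close> and
  \<open>j\<close> the quadratic form of \<open>avg\<close> at \<open>g\<close>, both sides are \<open>v + j\<close>, since
  \<open>E[a h] = information h = v + j\<close>. A residual adds \<open>2 E[g r]\<close> to both sides, and on the left
  also the integral of \<open>r\<^sup>2 / w top\<close>, which is at most \<open>E r\<^sup>2 / c\<close>. The estimate is thus uniform
  in \<open>g\<close>, whose norm may grow during the iteration.\<close>

lemma loss_le_dual_value:
  fixes a g r :: "'a \<Rightarrow> real"
  defines "h \<equiv> \<lambda>x. proj0 a x - expectation a + g x"
  assumes a: "square_integrable M a" and g: "square_integrable M g" and r: "square_integrable M r"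
    and g0: "AE x in M. proj0 g x = 0"
    and eq: "AE x in M. a x - proj0 a x = avg g x + r x"
  shows "square_integrable M h" and "expectation h = 0"
    and "variance (proj0 a)
        + (\<integral>x. 1 / w top x * (a x - proj0 a x - (\<Sum>i\<in>I - {top}. w i x * proj i g x))\<^sup>2
             + (\<Sum>i\<in>I - {top}. (w i x * proj i g x)\<^sup>2 / w i x) \<partial>M)
      \<le> 2 * (\<integral>x. a x * h x \<partial>M) - information h + (\<integral>x. (r x)\<^sup>2 \<partial>M) / c"
proof -
  interpret F0: finite_measure_subalgebra M F0 by (rule subalg_cond_exp0)
  let ?m = "expectation a" and ?J = "I - {top}"
  define h0 where "h0 = (\<lambda>x. proj0 a x - ?m)"
  define v where "v = (\<integral>x. (h0 x)\<^sup>2 \<partial>M)"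
  define j where "j = (\<Sum>i\<in>I. \<integral>x. w i x * (proj i g x)\<^sup>2 \<partial>M)"
  define e where "e = (\<integral>x. g x * r x \<partial>M)"
  note const = square_integrable_const
  have a0: "square_integrable M (proj0 a)" by (rule square_integrable_proj0[OF a])
  have h0: "square_integrable M h0" unfolding h0_def by (rule square_integrable_diff[OF a0 const])
  have h0_F0: "h0 \<in> borel_measurable F0" unfolding h0_def by measurable
  have h_eq: "h = (\<lambda>x. h0 x + g x)" unfolding h_def h0_def by simp
  show h: "square_integrable M h" unfolding h_eq by (rule square_integrable_add[OF h0 g])
  note int = integrable_square_integrable
  have Ea0: "expectation (proj0 a) = ?m" by (rule F0.real_cond_exp_int(2)[OF int[OF a]])
  have Eh0: "expectation h0 = 0" unfolding h0_def using int[OF a0] Ea0 by (simp add: prob_space)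
  have Eg: "expectation g = 0" using proj0_orthogonal[OF _ const g g0, of 1] by simp
  show "expectation h = 0" unfolding h_eq using int[OF h0] int[OF g] Eh0 Eg by simp
  have var: "variance (proj0 a) = v" unfolding v_def h0_def Ea0 by simp

  have int_w: "integrable M (\<lambda>x. w i x * (s x * t x))"
    if "i \<in> I" "square_integrable M s" "square_integrable M t" for i s t
    using integrable_mult_square_integrable[OF square_integrable_w[OF that(1,2)] that(3)] by (simp add: mult.assoc)

  \<comment> \<open>The mixed terms vanish, because \<open>w i * h0\<close> is \<open>F0\<close>-measurable and \<open>g\<close> is orthogonal to such functions.\<close>
  have info: "information h = v + j"
  proof -
    have one: "(\<integral>x. w i x * (proj i h x)\<^sup>2 \<partial>M)
        = (\<integral>x. w i x * (h0 x)\<^sup>2 \<partial>M) + (\<integral>x. w i x * (proj i g x)\<^sup>2 \<partial>M)" if i: "i \<in> I" for i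
    proof -
      interpret Fi: finite_measure_subalgebra M "F i" by (rule subalg_cond_exp[OF i])
      have pg: "square_integrable M (proj i g)" by (rule square_integrable_proj[OF i g])
      note [measurable] = w_meas[OF i] square_integrableD(1)[OF h0] square_integrableD(1)[OF pg]
      have "AE x in M. proj i h x = proj i h0 x + proj i g x"
        unfolding h_eq by (intro Fi.real_cond_exp_add int h0 g)
      moreover have "AE x in M. proj i h0 x = h0 x"
        by (intro Fi.real_cond_exp_F_meas int h0 measurable_F0_F[OF i] h0_F0)
      ultimately have "AE x in M. w i x * (proj i h x)\<^sup>2
          = w i x * (h0 x * h0 x) + 2 * (w i x * (h0 x * proj i g x)) + w i x * (proj i g x * proj i g x)"
        by eventually_elim (simp add: power2_eq_square algebra_simps)
      then have "(\<integral>x. w i x * (proj i h x)\<^sup>2 \<partial>M) = (\<integral>x. w i x * (h0 x * h0 x)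
          + 2 * (w i x * (h0 x * proj i g x)) + w i x * (proj i g x * proj i g x) \<partial>M)"
        by (intro integral_cong_AE) measurable
      also have "\<dots> = (\<integral>x. w i x * (h0 x * h0 x) \<partial>M) + 2 * (\<integral>x. w i x * (h0 x * proj i g x) \<partial>M)
          + (\<integral>x. w i x * (proj i g x * proj i g x) \<partial>M)"
        using int_w[OF i h0 h0] int_w[OF i h0 pg] int_w[OF i pg pg] by simp
      also have "(\<integral>x. w i x * (h0 x * proj i g x) \<partial>M) = (\<integral>x. (w i x * h0 x) * proj i g x \<partial>M)"
        by (simp add: mult.assoc)
      also have "\<dots> = (\<integral>x. (w i x * h0 x) * g x \<partial>M)"
        by (rule proj_adjoint[OF i _ square_integrable_w[OF i h0] g])
          (intro measurable_F0_F[OF i] borel_measurable_times w_meas0[OF i] h0_F0)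
      also have "\<dots> = 0"
        by (rule proj0_orthogonal[OF _ square_integrable_w[OF i h0] g g0])
          (intro borel_measurable_times w_meas0[OF i] h0_F0)
      finally show ?thesis by (simp add: power2_eq_square)
    qed
    have "(\<Sum>i\<in>I. \<integral>x. w i x * (h0 x)\<^sup>2 \<partial>M) = (\<integral>x. (\<Sum>i\<in>I. w i x * (h0 x)\<^sup>2) \<partial>M)"
      using int_w[OF _ h0 h0] by (simp add: power2_eq_square Bochner_Integration.integral_sum)
    also have "\<dots> = v"
      unfolding v_def
    proof (rule integral_cong_AE)
      show "AE x in M. (\<Sum>i\<in>I. w i x * (h0 x)\<^sup>2) = (h0 x)\<^sup>2"
        using w_sum by eventually_elim (simp flip: sum_distrib_right)
    qed (use w_meas square_integrableD(1)[OF h0] in measurable)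
    finally show ?thesis
      unfolding information_def j_def using one by (simp add: sum.distrib)
  qed

  have lin: "(\<integral>x. a x * h x \<partial>M) = v + j + e"
  proof -
    have "(\<integral>x. a x * h0 x \<partial>M) = (\<integral>x. h0 x * proj0 a x \<partial>M)"
      using proj0_adjoint[OF h0_F0 h0 a] by (simp add: mult.commute)
    also have "\<dots> = (\<integral>x. h0 x * h0 x + ?m * h0 x \<partial>M)"
      by (simp add: h0_def algebra_simps)
    also have "\<dots> = v"
      using integrable_mult_square_integrable[OF h0 h0] int[OF h0] Eh0 by (simp add: v_def power2_eq_square)
    finally have 1: "(\<integral>x. a x * h0 x \<partial>M) = v" .
    note [measurable] = square_integrableD(1)[OF a] square_integrableD(1)[OF g] square_integrableD(1)[OF r]
      square_integrableD(1)[OF square_integrable_avg[OF g]]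
    have igg: "integrable M (\<lambda>x. w i x * (proj i g x)\<^sup>2)" if i: "i \<in> I" for i
      using int_w[OF i square_integrable_proj[OF i g] square_integrable_proj[OF i g]] by (simp add: power2_eq_square)
    have ig: "integrable M (\<lambda>x. w i x * proj i g x * g x)" if i: "i \<in> I" for i
      using int_w[OF i square_integrable_proj[OF i g] g] by (simp add: mult.assoc)
    have "(\<integral>x. proj0 a x * g x \<partial>M) = 0"
      by (rule proj0_orthogonal[OF _ a0 g g0]) measurable
    then have "(\<integral>x. a x * g x \<partial>M) = (\<integral>x. (a x - proj0 a x) * g x \<partial>M)"
      using integrable_mult_square_integrable[OF a g] integrable_mult_square_integrable[OF a0 g]
      by (simp add: left_diff_distrib)
    also have "\<dots> = (\<integral>x. (\<Sum>i\<in>I. w i x * proj i g x * g x) + g x * r x \<partial>M)"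
    proof (rule integral_cong_AE)
      show "AE x in M. (a x - proj0 a x) * g x = (\<Sum>i\<in>I. w i x * proj i g x * g x) + g x * r x"
        using eq by eventually_elim (simp add: avg_def algebra_simps sum_distrib_left)
    qed (use w_meas in measurable)
    also have "\<dots> = (\<Sum>i\<in>I. \<integral>x. w i x * proj i g x * g x \<partial>M) + e"
      unfolding e_def
      by (subst Bochner_Integration.integral_add)
        (simp_all add: Bochner_Integration.integral_sum ig Bochner_Integration.integrable_sum
          integrable_mult_square_integrable[OF g r])
    also have "\<dots> = j + e"
      unfolding j_def using integral_w_proj_sq[OF _ g] by simp
    finally have 2: "(\<integral>x. a x * g x \<partial>M) = j + e" .
    show ?thesis
      unfolding h_eq using integrable_mult_square_integrable[OF a h0] integrable_mult_square_integrable[OF a g]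
      by (simp add: distrib_left 1 2)
  qed

  let ?L = "\<lambda>x. 1 / w top x * (a x - proj0 a x - (\<Sum>i\<in>?J. w i x * proj i g x))\<^sup>2
             + (\<Sum>i\<in>?J. (w i x * proj i g x)\<^sup>2 / w i x)"
  let ?R = "\<lambda>x. (\<Sum>i\<in>I. w i x * (proj i g x)\<^sup>2) + 2 * (g x * r x) + (r x)\<^sup>2 / c"
  have pos: "0 < w i x" if "i \<in> I" for i x using w_ge[OF that, of x] c_pos by simp
  have LR: "AE x in M. ?L x \<le> ?R x \<and> 0 \<le> ?R x"
    using eq proj_top[OF g]
  proof eventually_elim
    case (elim x)
    have split: "(\<Sum>i\<in>I. f i) = f top + (\<Sum>i\<in>?J. f i)" for f :: "'i \<Rightarrow> real"
      by (rule sum.remove[OF finite_I top_I])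
    \<comment> \<open>What the other indices leave over is the term of \<open>top\<close>, where the projection is the identity.\<close>
    have "a x - proj0 a x - (\<Sum>i\<in>?J. w i x * proj i g x) = w top x * g x + r x"
      using elim unfolding avg_def split by simp
    moreover have "1 / w top x * (w top x * g x + r x)\<^sup>2
        = w top x * (g x)\<^sup>2 + 2 * (g x * r x) + (r x)\<^sup>2 / w top x"
      using pos[OF top_I, of x] by (simp add: field_simps power2_eq_square)
    moreover have "(r x)\<^sup>2 / w top x \<le> (r x)\<^sup>2 / c"
      using w_ge[OF top_I, of x] c_pos by (intro divide_left_mono) auto
    moreover have "(\<Sum>i\<in>?J. (w i x * proj i g x)\<^sup>2 / w i x) = (\<Sum>i\<in>?J. w i x * (proj i g x)\<^sup>2)"
    proof (intro sum.cong refl)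
      fix i assume "i \<in> ?J"
      then have "w i x \<noteq> 0" using pos[of i x] by simp
      then show "(w i x * proj i g x)\<^sup>2 / w i x = w i x * (proj i g x)\<^sup>2"
        by (simp add: power2_eq_square)
    qed
    ultimately have le: "?L x \<le> ?R x" using elim(2) unfolding split by simp
    have "0 \<le> ?L x"
      using pos by (intro add_nonneg_nonneg mult_nonneg_nonneg sum_nonneg divide_nonneg_nonneg less_imp_le[OF pos]) (auto simp: top_I less_imp_le)
    with le show ?case by simp
  qed
  have igg: "integrable M (\<lambda>x. w i x * (proj i g x)\<^sup>2)" if i: "i \<in> I" for i
    using int_w[OF i square_integrable_proj[OF i g] square_integrable_proj[OF i g]] by (simp add: power2_eq_square)
  have gr: "integrable M (\<lambda>x. g x * r x)" by (rule integrable_mult_square_integrable[OF g r])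
  have i1: "integrable M (\<lambda>x. \<Sum>i\<in>I. w i x * (proj i g x)\<^sup>2)"
    by (rule Bochner_Integration.integrable_sum[OF igg])
  have "integral\<^sup>L M ?L \<le> integral\<^sup>L M ?R"
  proof (rule integral_mono_AE')
    show "integrable M ?R"
      using i1 gr square_integrableD(2)[OF r] by simp
  qed (use LR in auto)
  also have "\<dots> = j + 2 * e + (\<integral>x. (r x)\<^sup>2 \<partial>M) / c"
    using i1 gr square_integrableD(2)[OF r] igg by (simp add: j_def e_def Bochner_Integration.integral_sum)
  finally show "variance (proj0 a) + integral\<^sup>L M ?L \<le> 2 * (\<integral>x. a x * h x \<partial>M) - information h + (\<integral>x. (r x)\<^sup>2 \<partial>M) / c"
    unfolding var info lin by simp
qed


lemma information_add_le:
  assumes h: "square_integrable M h" and u: "square_integrable M u"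
  shows "information (\<lambda>x. h x + u x) \<le> information h
    + card I * (2 * (sqrt (\<integral>x. (h x)\<^sup>2 \<partial>M) * sqrt (\<integral>x. (u x)\<^sup>2 \<partial>M)) + (\<integral>x. (u x)\<^sup>2 \<partial>M))"
proof -
  have one: "(\<integral>x. w i x * (proj i (\<lambda>x. h x + u x) x)\<^sup>2 \<partial>M) \<le> (\<integral>x. w i x * (proj i h x)\<^sup>2 \<partial>M)
    + (2 * (sqrt (\<integral>x. (h x)\<^sup>2 \<partial>M) * sqrt (\<integral>x. (u x)\<^sup>2 \<partial>M)) + (\<integral>x. (u x)\<^sup>2 \<partial>M))" (is "_ \<le> _ + ?B")
    if i: "i \<in> I" for i
  proof -
    interpret Fi: finite_measure_subalgebra M "F i" by (rule subalg_cond_exp[OF i])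
    have ph: "square_integrable M (proj i h)" and pu: "square_integrable M (proj i u)"
      by (rule square_integrable_proj[OF i h], rule square_integrable_proj[OF i u])
    have wph: "square_integrable M (\<lambda>x. w i x * proj i h x)"
      by (rule square_integrable_w[OF i ph])
    have wpu: "square_integrable M (\<lambda>x. w i x * proj i u x)"
      by (rule square_integrable_w[OF i pu])
    have ihh: "integrable M (\<lambda>x. w i x * (proj i h x)\<^sup>2)"
      using integrable_mult_square_integrable[OF wph ph] by (simp add: power2_eq_square mult.assoc)
    have iuu: "integrable M (\<lambda>x. w i x * (proj i u x)\<^sup>2)"
      using integrable_mult_square_integrable[OF wpu pu] by (simp add: power2_eq_square mult.assoc)
    have ihu: "integrable M (\<lambda>x. w i x * proj i h x * proj i u x)"
      by (rule integrable_mult_square_integrable[OF wph pu])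
    note [measurable] = w_meas[OF i] square_integrableD(1)[OF h] square_integrableD(1)[OF u]
    have "AE x in M. proj i (\<lambda>x. h x + u x) x = proj i h x + proj i u x"
      by (intro Fi.real_cond_exp_add integrable_square_integrable h u)
    then have "AE x in M. w i x * (proj i (\<lambda>x. h x + u x) x)\<^sup>2
        = w i x * (proj i h x)\<^sup>2 + 2 * (w i x * proj i h x * proj i u x) + w i x * (proj i u x)\<^sup>2"
      by eventually_elim (simp add: power2_eq_square algebra_simps)
    then have "(\<integral>x. w i x * (proj i (\<lambda>x. h x + u x) x)\<^sup>2 \<partial>M) = (\<integral>x. w i x * (proj i h x)\<^sup>2
        + 2 * (w i x * proj i h x * proj i u x) + w i x * (proj i u x)\<^sup>2 \<partial>M)"
      by (intro integral_cong_AE) measurable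
    also have "\<dots> = (\<integral>x. w i x * (proj i h x)\<^sup>2 \<partial>M) + 2 * (\<integral>x. w i x * proj i h x * proj i u x \<partial>M)
        + (\<integral>x. w i x * (proj i u x)\<^sup>2 \<partial>M)"
      using ihh iuu ihu by simp
    finally have eq: "(\<integral>x. w i x * (proj i (\<lambda>x. h x + u x) x)\<^sup>2 \<partial>M) = (\<integral>x. w i x * (proj i h x)\<^sup>2 \<partial>M)
        + 2 * (\<integral>x. w i x * proj i h x * proj i u x \<partial>M) + (\<integral>x. w i x * (proj i u x)\<^sup>2 \<partial>M)" .
    have hn: "(\<integral>x. (proj i h x)\<^sup>2 \<partial>M) \<le> (\<integral>x. (h x)\<^sup>2 \<partial>M)"
      by (rule Fi.square_integrable_cond_exp(2)[OF h])
    have un: "(\<integral>x. (proj i u x)\<^sup>2 \<partial>M) \<le> (\<integral>x. (u x)\<^sup>2 \<partial>M)"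
      by (rule Fi.square_integrable_cond_exp(2)[OF u])
    have "(w i x * proj i h x)\<^sup>2 \<le> (proj i h x)\<^sup>2" for x
      using w_abs[OF i, of x] by (simp add: power_mult_distrib mult_left_le_one_le abs_square_le_1)
    then have whn: "(\<integral>x. (w i x * proj i h x)\<^sup>2 \<partial>M) \<le> (\<integral>x. (proj i h x)\<^sup>2 \<partial>M)"
      by (intro integral_mono square_integrableD(2) wph ph)
    have "\<bar>\<integral>x. w i x * proj i h x * proj i u x \<partial>M\<bar>
        \<le> sqrt (\<integral>x. (w i x * proj i h x)\<^sup>2 \<partial>M) * sqrt (\<integral>x. (proj i u x)\<^sup>2 \<partial>M)"
      by (rule Cauchy_Schwarz_integral[OF wph pu])
    also have "\<dots> \<le> sqrt (\<integral>x. (h x)\<^sup>2 \<partial>M) * sqrt (\<integral>x. (u x)\<^sup>2 \<partial>M)"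
      using whn hn un by (intro mult_mono) auto
    finally have 1: "(\<integral>x. w i x * proj i h x * proj i u x \<partial>M)
        \<le> sqrt (\<integral>x. (h x)\<^sup>2 \<partial>M) * sqrt (\<integral>x. (u x)\<^sup>2 \<partial>M)" by simp
    have "(\<integral>x. w i x * (proj i u x)\<^sup>2 \<partial>M) \<le> (\<integral>x. (proj i u x)\<^sup>2 \<partial>M)"
      using w_le[OF i] w_nonneg[OF i]
      by (intro integral_mono iuu square_integrableD(2) pu) (simp add: mult_left_le_one_le)
    with un 1 eq show ?thesis by simp
  qed
  have "information (\<lambda>x. h x + u x) \<le> (\<Sum>i\<in>I. (\<integral>x. w i x * (proj i h x)\<^sup>2 \<partial>M)
    + (2 * (sqrt (\<integral>x. (h x)\<^sup>2 \<partial>M) * sqrt (\<integral>x. (u x)\<^sup>2 \<partial>M)) + (\<integral>x. (u x)\<^sup>2 \<partial>M)))"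
    unfolding information_def by (rule sum_mono[OF one])
  then show ?thesis by (simp add: sum.distrib information_def)
qed

text \<open>The dual objective is continuous in \<open>L\<^sup>2\<close>, so truncating a direction far out and restoring its
  mean to zero changes the value only slightly.\<close>

lemma bounded_direction_approximation:
  assumes a: "square_integrable M a" and h: "square_integrable M h" and Eh: "expectation h = 0" and "0 < \<epsilon>"
  obtains k b where "k \<in> borel_measurable M" "\<And>x. \<bar>k x\<bar> \<le> b" "expectation k = 0"
    "2 * (\<integral>x. a x * h x \<partial>M) - information h - \<epsilon> \<le> 2 * (\<integral>x. a x * k x \<partial>M) - information k"
proof -
  define t where "t = (\<lambda>(n::nat) x. max (- real n) (min (real n) (h x)))"
  define d where "d = (\<lambda>n x. t n x - h x)"
  note [measurable] = square_integrableD(1)[OF h]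
  have tm[measurable]: "t n \<in> borel_measurable M" for n unfolding t_def by measurable
  have tb: "\<bar>t n x\<bar> \<le> real n" for n x unfolding t_def by auto
  have st: "square_integrable M (t n)" for n
    by (rule square_integrable_bounded[of _ "real n"]) (auto simp: tb)
  have sd: "square_integrable M (d n)" for n
    unfolding d_def by (rule square_integrable_diff[OF st h])
  note int = integrable_square_integrable
  have dlim: "(\<lambda>n. \<integral>x. (d n x)\<^sup>2 \<partial>M) \<longlonglongrightarrow> (\<integral>x. 0 \<partial>M)"
  proof (rule integral_dominated_convergence[where w = "\<lambda>x. (h x)\<^sup>2"])
    show "AE x in M. (\<lambda>n. (d n x)\<^sup>2) \<longlonglongrightarrow> 0"
    proof (rule AE_I2)
      fix x
      obtain n0 :: nat where n0: "\<bar>h x\<bar> \<le> real n0" using real_arch_simple by blast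
      have "eventually (\<lambda>n. (d n x)\<^sup>2 = 0) sequentially"
        using eventually_ge_at_top[of n0]
        by eventually_elim (use n0 in \<open>auto simp: d_def t_def max_def min_def\<close>)
      then show "(\<lambda>n. (d n x)\<^sup>2) \<longlonglongrightarrow> 0" by (rule tendsto_eventually)
    qed
    show "AE x in M. norm ((d n x)\<^sup>2) \<le> (h x)\<^sup>2" for n
      by (rule AE_I2) (auto simp: d_def t_def simp flip: abs_le_square_iff)
  qed (use square_integrableD(2)[OF h] square_integrableD(1)[OF sd] in auto)
  define k where "k = (\<lambda>n x. t n x - expectation (t n))"
  define u where "u = (\<lambda>n x. k n x - h x)"
  have sk: "square_integrable M (k n)" for n
    unfolding k_def by (intro square_integrable_diff st square_integrable_bounded[of _ "\<bar>expectation (t n)\<bar>"]) auto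
  have su: "square_integrable M (u n)" for n
    unfolding u_def by (rule square_integrable_diff[OF sk h])
  have Ek: "expectation (k n) = 0" for n
    unfolding k_def using int[OF st[of n]] by (simp add: prob_space)
  have ule: "(\<integral>x. (u n x)\<^sup>2 \<partial>M) \<le> (\<integral>x. (d n x)\<^sup>2 \<partial>M)" for n
  proof -
    have "expectation (d n) = expectation (t n)"
      unfolding d_def using int[OF st[of n]] int[OF h] Eh by simp
    then have "(\<integral>x. (u n x)\<^sup>2 \<partial>M) = variance (d n)"
      by (simp add: u_def k_def d_def algebra_simps)
    also have "\<dots> = expectation (\<lambda>x. (d n x)\<^sup>2) - (expectation (d n))\<^sup>2"
      by (rule variance_eq[OF int[OF sd] square_integrableD(2)[OF sd]])
    finally show ?thesis by simp
  qed
  have ulim: "(\<lambda>n. \<integral>x. (u n x)\<^sup>2 \<partial>M) \<longlonglongrightarrow> 0"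
    by (rule tendsto_sandwich[OF _ _ tendsto_const]) (use ule dlim in auto)
  let ?A = "sqrt (\<integral>x. (a x)\<^sup>2 \<partial>M)" and ?H = "sqrt (\<integral>x. (h x)\<^sup>2 \<partial>M)"
  let ?err = "\<lambda>U::real. 2 * (?A * sqrt U) + card I * (2 * (?H * sqrt U) + U)"
  have "(\<lambda>n. ?err (\<integral>x. (u n x)\<^sup>2 \<partial>M)) \<longlonglongrightarrow> ?err 0"
    by (intro tendsto_intros ulim)
  then have "eventually (\<lambda>n. ?err (\<integral>x. (u n x)\<^sup>2 \<partial>M) < \<epsilon>) sequentially"
    using \<open>0 < \<epsilon>\<close> by (intro order_tendstoD) auto
  then obtain n where n: "?err (\<integral>x. (u n x)\<^sup>2 \<partial>M) < \<epsilon>" by (auto simp: eventually_sequentially)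
  have ku: "k n = (\<lambda>x. h x + u n x)" by (simp add: u_def)
  have "information (k n) \<le> information h + card I * (2 * (?H * sqrt (\<integral>x. (u n x)\<^sup>2 \<partial>M)) + (\<integral>x. (u n x)\<^sup>2 \<partial>M))"
    unfolding ku by (rule information_add_le[OF h su])
  moreover have "(\<integral>x. a x * k n x \<partial>M) = (\<integral>x. a x * h x \<partial>M) + (\<integral>x. a x * u n x \<partial>M)"
    unfolding ku distrib_left
    by (intro Bochner_Integration.integral_add integrable_mult_square_integrable a h su)
  moreover have "\<bar>\<integral>x. a x * u n x \<partial>M\<bar> \<le> ?A * sqrt (\<integral>x. (u n x)\<^sup>2 \<partial>M)"
    by (rule Cauchy_Schwarz_integral[OF a su])
  ultimately have main: "2 * (\<integral>x. a x * h x \<partial>M) - information h - \<epsilon> \<le> 2 * (\<integral>x. a x * k n x \<partial>M) - information (k n)"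
    using n by linarith
  show ?thesis
  proof (rule that[OF square_integrableD(1)[OF sk] _ Ek main])
    fix x
    show "\<bar>k n x\<bar> \<le> real n + \<bar>expectation (t n)\<bar>"
      unfolding k_def using tb[of n x] by linarith
  qed
qed

end

section \<open>A risk bound along a chain of distributions\<close>

lemma PiM_density:
  fixes q :: "'a \<Rightarrow> real"
  assumes J: "finite J" and Q: "prob_space Q" and q[measurable]: "q \<in> borel_measurable Q"
    and q0: "\<And>x. 0 \<le> q x" and Qq: "prob_space (density Q (\<lambda>x. ennreal (q x)))"
  shows "(\<Pi>\<^sub>M i\<in>J. density Q (\<lambda>x. ennreal (q x)))
    = density (\<Pi>\<^sub>M i\<in>J. Q) (\<lambda>z. ennreal (\<Prod>i\<in>J. q (z i)))"
proof -
  interpret Q: prob_space Q by (rule Q)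
  interpret Qq: prob_space "density Q (\<lambda>x. ennreal (q x))" by (rule Qq)
  interpret P: product_sigma_finite "\<lambda>i::'b. Q" by standard
  interpret D: product_sigma_finite "\<lambda>i::'b. density Q (\<lambda>x. ennreal (q x))" by standard
  show ?thesis
  proof (rule D.PiM_eqI[OF J, symmetric])
    show "sets (density (\<Pi>\<^sub>M i\<in>J. Q) (\<lambda>z. ennreal (\<Prod>i\<in>J. q (z i))))
        = sets (\<Pi>\<^sub>M i\<in>J. density Q (\<lambda>x. ennreal (q x)))"
      by (simp cong: sets_PiM_cong)
  next
    fix A :: "'b \<Rightarrow> 'a set"
    assume "\<And>i. i \<in> J \<Longrightarrow> A i \<in> sets (density Q (\<lambda>x. ennreal (q x)))"
    then have A: "A i \<in> sets Q" if "i \<in> J" for i using that by simp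
    have meas: "(\<lambda>z. ennreal (\<Prod>i\<in>J. q (z i))) \<in> borel_measurable (\<Pi>\<^sub>M i\<in>J. Q)"
      by measurable
    have "emeasure (density (\<Pi>\<^sub>M i\<in>J. Q) (\<lambda>z. ennreal (\<Prod>i\<in>J. q (z i)))) (Pi\<^sub>E J A)
        = (\<integral>\<^sup>+z. ennreal (\<Prod>i\<in>J. q (z i)) * indicator (Pi\<^sub>E J A) z \<partial>(\<Pi>\<^sub>M i\<in>J. Q))"
      by (rule emeasure_density[OF meas sets_PiM_I_finite[OF J A]])
    also have "\<dots> = (\<integral>\<^sup>+z. (\<Prod>i\<in>J. ennreal (q (z i)) * indicator (A i) (z i)) \<partial>(\<Pi>\<^sub>M i\<in>J. Q))"
    proof (rule nn_integral_cong)
      fix z assume "z \<in> space (\<Pi>\<^sub>M i\<in>J. Q)"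
      then have ext: "z \<in> extensional J" by (simp add: space_PiM PiE_def)
      have "(indicator (Pi\<^sub>E J A) z :: ennreal) = (\<Prod>i\<in>J. indicator (A i) (z i))"
      proof (cases "z \<in> Pi\<^sub>E J A")
        case True
        then show ?thesis by (auto simp: PiE_def Pi_def intro!: prod.neutral[symmetric])
      next
        case False
        with ext obtain i where "i \<in> J" "z i \<notin> A i" by (auto simp: PiE_def Pi_def)
        then have "(\<Prod>i\<in>J. indicator (A i) (z i)) = (0::ennreal)" by (intro prod_zero J bexI[of _ i]) auto
        with False show ?thesis by simp
      qed
      then show "ennreal (\<Prod>i\<in>J. q (z i)) * indicator (Pi\<^sub>E J A) z
          = (\<Prod>i\<in>J. ennreal (q (z i)) * indicator (A i) (z i))"
        using q0 by (simp add: prod.distrib prod_ennreal)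
    qed
    also have "\<dots> = (\<Prod>i\<in>J. \<integral>\<^sup>+x. ennreal (q x) * indicator (A i) x \<partial>Q)"
      by (rule P.product_nn_integral_prod[OF J]) (use A in measurable)
    also have "\<dots> = (\<Prod>i\<in>J. emeasure (density Q (\<lambda>x. ennreal (q x))) (A i))"
      using A by (intro prod.cong refl emeasure_density[symmetric]) auto
    finally show "emeasure (density (\<Pi>\<^sub>M i\<in>J. Q) (\<lambda>z. ennreal (\<Prod>i\<in>J. q (z i)))) (Pi\<^sub>E J A)
        = (\<Prod>i\<in>J. emeasure (density Q (\<lambda>x. ennreal (q x))) (A i))" .
  qed
qed

context prob_space begin

text \<open>The inequality of Hammersley, Chapman and Robbins, for estimators that may be biased. The left-hand
  side is the integral of \<open>(T - \<tau>) (p' - p)\<close>, since the terms with \<open>\<tau>'\<close> cancel; Cauchy-Schwarz with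
  the weight \<open>p\<close> separates the risk under \<open>p\<close> from the chi-square divergence.\<close>

lemma bias_change_le:
  fixes p p' T :: "'a \<Rightarrow> real"
  assumes p[measurable]: "p \<in> borel_measurable M" and p'[measurable]: "p' \<in> borel_measurable M"
    and lo: "0 < lo" and plo: "\<And>x. lo \<le> p x" and phi: "\<And>x. p x \<le> hi" and p'b: "\<And>x. \<bar>p' x\<bar> \<le> hi"
    and p1: "expectation p = 1" and p'1: "expectation p' = 1"
    and T: "square_integrable M T"
    and risk: "expectation (\<lambda>x. (T x - \<tau>)\<^sup>2 * p x) \<le> R"
    and chi: "expectation (\<lambda>x. (p' x)\<^sup>2 / p x) \<le> e"
  shows "expectation (\<lambda>x. (T x - \<tau>') * p' x) - expectation (\<lambda>x. (T x - \<tau>) * p x) + (\<tau>' - \<tau>)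
    \<le> sqrt R * sqrt (e - 1)"
proof -
  note [measurable] = square_integrableD(1)[OF T]
  have pp: "0 < p x" for x using lo plo[of x] by simp
  have sp: "square_integrable M p"
    by (rule square_integrable_bounded[of _ hi]) (use pp phi in \<open>auto simp: less_imp_le abs_of_pos\<close>)
  have sp': "square_integrable M p'" by (rule square_integrable_bounded[of _ hi]) (use p'b in auto)
  note const = square_integrable_const
  note int = integrable_square_integrable integrable_mult_square_integrable
  have iT: "integrable M (\<lambda>x. T x * p x)" "integrable M (\<lambda>x. T x * p' x)"
    "integrable M p" "integrable M p'"
    by (rule int(2)[OF T sp], rule int(2)[OF T sp'], rule int(1)[OF sp], rule int(1)[OF sp'])
  have lhs: "expectation (\<lambda>x. (T x - \<tau>') * p' x) - expectation (\<lambda>x. (T x - \<tau>) * p x) + (\<tau>' - \<tau>)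
      = expectation (\<lambda>x. (T x - \<tau>) * (p' x - p x))"
    using iT p1 p'1 by (simp add: left_diff_distrib right_diff_distrib)
  have sqb: "\<bar>sqrt (p x)\<bar> \<le> sqrt hi" for x using phi pp[of x] by (simp add: less_imp_le)
  have s1: "square_integrable M (\<lambda>x. sqrt (p x) * (T x - \<tau>))"
    by (rule square_integrable_mult_bounded[OF square_integrable_diff[OF T const], where b = "sqrt hi"]) (use sqb in auto)
  have "\<bar>1 / sqrt (p x)\<bar> \<le> 1 / sqrt lo" for x
    using lo pp[of x] plo[of x] by (simp add: frac_le)
  then have s2: "square_integrable M (\<lambda>x. 1 / sqrt (p x) * (p' x - p x))"
    by (intro square_integrable_mult_bounded[OF square_integrable_diff[OF sp' sp], where b = "1 / sqrt lo"]) auto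
  have r1: "(sqrt (p x) * (T x - \<tau>))\<^sup>2 = (T x - \<tau>)\<^sup>2 * p x" for x
    using pp[of x] by (simp add: power_mult_distrib less_imp_le)
  have r2: "(1 / sqrt (p x) * (p' x - p x))\<^sup>2 = (p' x)\<^sup>2 / p x - 2 * p' x + p x" for x
    using pp[of x] by (simp add: power_mult_distrib power_divide less_imp_le field_simps power2_eq_square)
  have ichi: "integrable M (\<lambda>x. (p' x)\<^sup>2 / p x)"
  proof -
    have "(\<lambda>x. (p' x)\<^sup>2 / p x) = (\<lambda>x. (1 / sqrt (p x) * (p' x - p x))\<^sup>2 + 2 * p' x - p x)"
      unfolding r2 by simp
    then show ?thesis using square_integrableD(2)[OF s2] iT by simp
  qed
  have "expectation (\<lambda>x. (T x - \<tau>) * (p' x - p x))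
      = expectation (\<lambda>x. sqrt (p x) * (T x - \<tau>) * (1 / sqrt (p x) * (p' x - p x)))"
    by (intro Bochner_Integration.integral_cong refl) (use pp in \<open>simp add: less_imp_neq[symmetric]\<close>)
  also have "\<dots> \<le> sqrt (expectation (\<lambda>x. (sqrt (p x) * (T x - \<tau>))\<^sup>2))
      * sqrt (expectation (\<lambda>x. (1 / sqrt (p x) * (p' x - p x))\<^sup>2))"
    using Cauchy_Schwarz_integral[OF s1 s2] by linarith
  also have "expectation (\<lambda>x. (1 / sqrt (p x) * (p' x - p x))\<^sup>2) = expectation (\<lambda>x. (p' x)\<^sup>2 / p x) - 1"
    unfolding r2 using ichi iT p1 p'1 by simp
  also have "sqrt (expectation (\<lambda>x. (sqrt (p x) * (T x - \<tau>))\<^sup>2)) * sqrt (expectation (\<lambda>x. (p' x)\<^sup>2 / p x) - 1)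
      \<le> sqrt R * sqrt (e - 1)"
  proof (intro mult_mono)
    show "sqrt (expectation (\<lambda>x. (sqrt (p x) * (T x - \<tau>))\<^sup>2)) \<le> sqrt R" unfolding r1 using risk by simp
    have "0 \<le> expectation (\<lambda>x. (sqrt (p x) * (T x - \<tau>))\<^sup>2)" by simp
    then show "0 \<le> sqrt R" unfolding r1 using risk by simp
    have "0 \<le> expectation (\<lambda>x. (1 / sqrt (p x) * (p' x - p x))\<^sup>2)" by simp
    also have "\<dots> = expectation (\<lambda>x. (p' x)\<^sup>2 / p x) - 1"
      unfolding r2 using ichi iT p1 p'1 by simp
    finally show "0 \<le> sqrt (expectation (\<lambda>x. (p' x)\<^sup>2 / p x) - 1)" by simp
  qed (use chi in simp)
  finally show ?thesis unfolding lhs .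
qed

text \<open>In the sum of \<open>bias_change_le\<close> over the chain only the first and the last bias survive. Their size is
  at most \<open>\<surd>R\<close>, which explains the \<open>2\<close>. For a long chain the bias is therefore negligible against the
  \<open>n\<close> other terms.\<close>

lemma chain_lower_bound:
  fixes p :: "nat \<Rightarrow> 'a \<Rightarrow> real" and \<tau> :: "nat \<Rightarrow> real"
  assumes p[measurable]: "\<And>i. p i \<in> borel_measurable M"
    and lo: "0 < lo" and plo: "\<And>i x. lo \<le> p i x" and phi: "\<And>i x. p i x \<le> hi"
    and p1: "\<And>i. expectation (p i) = 1"
    and T: "square_integrable M T"
    and risk: "\<And>i. i \<le> n \<Longrightarrow> expectation (\<lambda>x. (T x - \<tau> i)\<^sup>2 * p i x) \<le> R"
    and chi: "\<And>i. i < n \<Longrightarrow> expectation (\<lambda>x. (p (Suc i) x)\<^sup>2 / p i x) \<le> e"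
  shows "\<tau> n - \<tau> 0 \<le> sqrt R * (2 + n * sqrt (e - 1))"
proof -
  note [measurable] = square_integrableD(1)[OF T]
  define b where "b = (\<lambda>i. expectation (\<lambda>x. (T x - \<tau> i) * p i x))"
  have pp: "0 < p i x" for i x using lo plo[of i x] by simp
  have pb: "\<bar>p i x\<bar> \<le> hi" for i x using pp[of i x] phi[of i x] by simp
  note const = square_integrable_const
  have bb: "\<bar>b i\<bar> \<le> sqrt R" if i: "i \<le> n" for i
  proof -
    have sqb: "\<bar>sqrt (p i x)\<bar> \<le> sqrt hi" for x using phi[of i x] pp[of i x] by (simp add: less_imp_le)
    have s1: "square_integrable M (\<lambda>x. sqrt (p i x) * (T x - \<tau> i))"
      by (rule square_integrable_mult_bounded[OF square_integrable_diff[OF T const], where b = "sqrt hi"]) (use sqb in auto)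
    have s2: "square_integrable M (\<lambda>x. sqrt (p i x))"
      by (rule square_integrable_bounded[where b = "sqrt hi"]) (use sqb in auto)
    have "b i = expectation (\<lambda>x. sqrt (p i x) * (T x - \<tau> i) * sqrt (p i x))"
      unfolding b_def
    proof (intro Bochner_Integration.integral_cong refl)
      fix x
      have "sqrt (p i x) * (T x - \<tau> i) * sqrt (p i x) = (T x - \<tau> i) * (sqrt (p i x) * sqrt (p i x))"
        by (simp only: mult_ac)
      then show "(T x - \<tau> i) * p i x = sqrt (p i x) * (T x - \<tau> i) * sqrt (p i x)"
        using pp[of i x] by simp
    qed
    then have "\<bar>b i\<bar> \<le> sqrt (expectation (\<lambda>x. (sqrt (p i x) * (T x - \<tau> i))\<^sup>2))
        * sqrt (expectation (\<lambda>x. (sqrt (p i x))\<^sup>2))"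
      using Cauchy_Schwarz_integral[OF s1 s2] by simp
    also have "expectation (\<lambda>x. (sqrt (p i x))\<^sup>2) = 1"
      using pp p1[of i] by (simp add: less_imp_le)
    also have "(\<lambda>x. (sqrt (p i x) * (T x - \<tau> i))\<^sup>2) = (\<lambda>x. (T x - \<tau> i)\<^sup>2 * p i x)"
      using pp by (simp add: power_mult_distrib less_imp_le mult.commute)
    finally have "\<bar>b i\<bar> \<le> sqrt (expectation (\<lambda>x. (T x - \<tau> i)\<^sup>2 * p i x))" by simp
    also have "\<dots> \<le> sqrt R" using risk[OF i] by simp
    finally show ?thesis .
  qed
  have "b k - b 0 + (\<tau> k - \<tau> 0) \<le> k * (sqrt R * sqrt (e - 1))" if "k \<le> n" for k
    using that
  proof (induction k)
    case (Suc k)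
    have "b (Suc k) - b k + (\<tau> (Suc k) - \<tau> k) \<le> sqrt R * sqrt (e - 1)"
      unfolding b_def
      by (rule bias_change_le[OF p p lo plo phi pb p1 p1 T risk chi]) (use Suc.prems in auto)
    with Suc show ?case by (simp add: algebra_simps)
  qed simp
  from this[of n] bb[of n] bb[of 0] show ?thesis by (simp add: algebra_simps)
qed

end

text \<open>The chi-square divergence of two densities with total mass one is the integral of
  \<open>(p' - p)\<^sup>2 / p\<close>. Here \<open>p' - p\<close> is \<open>s (t' - t) l\<close> up to \<open>O(s\<^sup>2)\<close> and \<open>p\<close> tends to one; the bounds on
  \<open>l\<close> and \<open>p\<close> justify dominated convergence.\<close>

lemma (in prob_space) chi_square_limit:
  fixes p p' :: "nat \<Rightarrow> 'a \<Rightarrow> real"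
  assumes s: "\<And>N. 0 < s N" "\<And>N. s N \<le> 1" "s \<longlonglongrightarrow> 0"
    and p[measurable]: "\<And>N. p N \<in> borel_measurable M" and p'[measurable]: "\<And>N. p' N \<in> borel_measurable M"
    and lo: "0 < lo" and plo: "\<And>N x. lo \<le> p N x" and p_hi: "\<And>N x. p N x \<le> hi"
    and p'_hi: "\<And>N x. \<bar>p' N x\<bar> \<le> hi"
    and p1: "\<And>N. expectation (p N) = 1" and p'1: "\<And>N. expectation (p' N) = 1"
    and o[measurable]: "l \<in> borel_measurable M" and lb: "AE x in M. \<bar>l x\<bar> \<le> b"
    and ex: "\<And>N. AE x in M. \<bar>p N x - 1 - s N * (t * l x)\<bar> \<le> C * (s N)\<^sup>2"
    and ex': "\<And>N. AE x in M. \<bar>p' N x - 1 - s N * (t' * l x)\<bar> \<le> C' * (s N)\<^sup>2"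
  shows "(\<lambda>N. (expectation (\<lambda>x. (p' N x)\<^sup>2 / p N x) - 1) / (s N)\<^sup>2) \<longlonglongrightarrow> (t' - t)\<^sup>2 * expectation (\<lambda>x. (l x)\<^sup>2)"
proof -
  have pp: "0 < p N x" for N x using lo plo[of N x] by simp
  have ip: "integrable M (p N)" for N
    by (rule integrable_const_bound[where B = hi]) (use pp p_hi in \<open>auto simp: less_imp_le\<close>)
  have ip': "integrable M (p' N)" for N
    by (rule integrable_const_bound[where B = hi]) (use p'_hi in auto)
  have ir: "integrable M (\<lambda>x. (p' N x)\<^sup>2 / p N x)" for N
  proof (rule integrable_const_bound[where B = "hi\<^sup>2 / lo"])
    have "norm ((p' N x)\<^sup>2 / p N x) \<le> hi\<^sup>2 / lo" for x
    proof -
      have "(p' N x)\<^sup>2 \<le> hi\<^sup>2" using p'_hi[of N x] by (metis abs_ge_zero power2_abs power_mono)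
      then show ?thesis using pp[of N x] plo[of N x] lo by (simp add: frac_le less_imp_le)
    qed
    then show "AE x in M. norm ((p' N x)\<^sup>2 / p N x) \<le> hi\<^sup>2 / lo" by simp
  qed measurable
  have eq: "(expectation (\<lambda>x. (p' N x)\<^sup>2 / p N x) - 1) / (s N)\<^sup>2
      = expectation (\<lambda>x. ((p' N x - p N x) / s N)\<^sup>2 / p N x)" for N
  proof -
    have "((p' N x - p N x) / s N)\<^sup>2 / p N x = ((p' N x)\<^sup>2 / p N x - 2 * p' N x + p N x) / (s N)\<^sup>2" for x
      using pp[of N x] by (simp add: power_divide field_simps power2_eq_square)
    then show ?thesis using ip[of N] ip'[of N] ir[of N] p1[of N] p'1[of N] by simp
  qed
  let ?D = "C + C'"
  have ae: "AE x in M. \<forall>N. \<bar>(p' N x - p N x) / s N - (t' - t) * l x\<bar> \<le> ?D * s N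
      \<and> \<bar>p N x - 1 - s N * (t * l x)\<bar> \<le> C * (s N)\<^sup>2"
    unfolding AE_all_countable
  proof
    fix N
    show "AE x in M. \<bar>(p' N x - p N x) / s N - (t' - t) * l x\<bar> \<le> ?D * s N
      \<and> \<bar>p N x - 1 - s N * (t * l x)\<bar> \<le> C * (s N)\<^sup>2"
      using ex[of N] ex'[of N]
    proof eventually_elim
      case (elim x)
      have "\<bar>(p' N x - p N x) / s N - (t' - t) * l x\<bar> = \<bar>(p' N x - p N x) - s N * ((t' - t) * l x)\<bar> / s N"
        using s(1)[of N] by (simp add: field_simps abs_divide[symmetric])
      also have "\<dots> \<le> (?D * (s N)\<^sup>2) / s N"
        using elim s(1)[of N] by (intro divide_right_mono) (auto simp: algebra_simps)
      also have "\<dots> = ?D * s N" using s(1)[of N] by (simp add: power2_eq_square)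
      finally show ?case using elim by simp
    qed
  qed
  have "(\<lambda>N. expectation (\<lambda>x. ((p' N x - p N x) / s N)\<^sup>2 / p N x)) \<longlonglongrightarrow> expectation (\<lambda>x. ((t' - t) * l x)\<^sup>2 / 1)"
  proof (rule integral_dominated_convergence[where w = "\<lambda>_. (\<bar>t' - t\<bar> * b + \<bar>?D\<bar>)\<^sup>2 / lo"])
    show "AE x in M. (\<lambda>N. ((p' N x - p N x) / s N)\<^sup>2 / p N x) \<longlonglongrightarrow> ((t' - t) * l x)\<^sup>2 / 1"
      using ae
    proof eventually_elim
      case (elim x)
      have "(\<lambda>N. (p' N x - p N x) / s N) \<longlonglongrightarrow> (t' - t) * l x"
      proof (rule LIM_zero_cancel, rule Lim_null_comparison)
        show "(\<lambda>N. ?D * s N) \<longlonglongrightarrow> 0" using tendsto_mult[OF tendsto_const s(3), of ?D] by simp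
      qed (use elim in auto)
      moreover have "(\<lambda>N. p N x) \<longlonglongrightarrow> 1"
      proof -
        have "(\<lambda>N. p N x - 1 - s N * (t * l x)) \<longlonglongrightarrow> 0"
        proof (rule Lim_null_comparison)
          show "(\<lambda>N. C * (s N)\<^sup>2) \<longlonglongrightarrow> 0" using tendsto_mult[OF tendsto_const tendsto_power[OF s(3)], of C 2] by simp
        qed (use elim in auto)
        moreover have "(\<lambda>N. 1 + s N * (t * l x)) \<longlonglongrightarrow> 1 + 0 * (t * l x)"
          by (intro tendsto_intros s(3))
        ultimately have "(\<lambda>N. (p N x - 1 - s N * (t * l x)) + (1 + s N * (t * l x))) \<longlonglongrightarrow> 0 + (1 + 0 * (t * l x))"
          by (rule tendsto_add)
        then show ?thesis by simp
      qed
      ultimately show ?case by (intro tendsto_divide tendsto_power) auto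
    qed
    fix N
    show "AE x in M. norm (((p' N x - p N x) / s N)\<^sup>2 / p N x) \<le> (\<bar>t' - t\<bar> * b + \<bar>?D\<bar>)\<^sup>2 / lo"
      using ae lb
    proof eventually_elim
      case (elim x)
      have "?D * s N \<le> \<bar>?D\<bar> * 1"
        using s(1)[of N] s(2)[of N] by (intro mult_mono) auto
      moreover have "\<bar>(t' - t) * l x\<bar> \<le> \<bar>t' - t\<bar> * b"
        using elim(2) by (simp add: abs_mult mult_left_mono)
      moreover have "\<bar>(p' N x - p N x) / s N - (t' - t) * l x\<bar> \<le> ?D * s N" using elim(1) by blast
      moreover have "\<bar>A\<bar> \<le> G + H" if "E \<le> H * 1" "\<bar>B\<bar> \<le> G" "\<bar>A - B\<bar> \<le> E" for A B E G H :: real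
        using that by linarith
      ultimately have "\<bar>(p' N x - p N x) / s N\<bar> \<le> \<bar>t' - t\<bar> * b + \<bar>?D\<bar>" by blast
      then have "((p' N x - p N x) / s N)\<^sup>2 \<le> (\<bar>t' - t\<bar> * b + \<bar>?D\<bar>)\<^sup>2"
        by (metis abs_ge_zero power2_abs power_mono)
      then show ?case using pp[of N x] plo[of N x] lo
        by (simp add: frac_le less_imp_le)
    qed
  qed (use lo in measurable)
  then show ?thesis unfolding eq by (simp add: power_mult_distrib)
qed

text \<open>For \<open>N\<close> independent observations, \<open>1\<close> plus the chi-square divergence is multiplicative. If it is at
  most \<open>1 + y / N\<close> for one observation, it is at most \<open>exp y\<close> for the sample. The estimator is square
  integrable because its risk is finite under a density that is bounded away from zero.\<close>

lemma (in prob_space) sample_chain_lower_bound: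
  fixes q :: "nat \<Rightarrow> 'a \<Rightarrow> real" and \<tau> :: "nat \<Rightarrow> real"
  assumes q[measurable]: "\<And>i. q i \<in> borel_measurable M"
    and lo: "0 < lo" and qlo: "\<And>i x. lo \<le> q i x" and qhi: "\<And>i x. q i x \<le> hi"
    and q1: "\<And>i. expectation (q i) = 1"
    and T[measurable]: "T \<in> borel_measurable (\<Pi>\<^sub>M k\<in>{..<N}. M)" and N: "0 < N" and \<rho>: "0 \<le> \<rho>"
    and risk: "\<And>i. i \<le> n \<Longrightarrow>
      (\<integral>\<^sup>+z. ennreal (real N * (T z - \<tau> i)\<^sup>2) \<partial>(\<Pi>\<^sub>M k\<in>{..<N}. density M (\<lambda>x. ennreal (q i x)))) \<le> ennreal \<rho>"
    and chi: "\<And>i. i < n \<Longrightarrow> expectation (\<lambda>x. (q (Suc i) x)\<^sup>2 / q i x) \<le> 1 + y / real N"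
  shows "sqrt (real N) * (\<tau> n - \<tau> 0) \<le> sqrt \<rho> * (2 + n * sqrt (exp y - 1))"
proof -
  have qp: "0 < q i x" for i x using lo qlo[of i x] by simp
  have hi: "0 < hi" using qp[of 0] qhi[of 0] by (meson less_le_trans)
  have qb: "\<bar>q i x\<bar> \<le> hi" for i x using qp[of i x] qhi[of i x] by simp
  have iq: "integrable M (q i)" for i
    by (rule integrable_const_bound[where B = hi]) (use qb in auto)
  interpret PS: product_sigma_finite "\<lambda>k::nat. M" by standard
  interpret P: prob_space "\<Pi>\<^sub>M k\<in>{..<N}. M" by (rule prob_space_PiM) (rule prob_space_axioms)
  let ?P = "\<Pi>\<^sub>M k\<in>{..<N}. M"
  define p where "p = (\<lambda>i z. \<Prod>k<N. q i (z k))"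
  have pm[measurable]: "p i \<in> borel_measurable ?P" for i unfolding p_def by measurable
  have plo: "lo ^ N \<le> p i z" for i z
    unfolding p_def using prod_mono[of "{..<N}" "\<lambda>_. lo" "\<lambda>k. q i (z k)"] lo qlo by (simp add: less_imp_le)
  have phi: "p i z \<le> hi ^ N" for i z
    unfolding p_def using prod_mono[of "{..<N}" "\<lambda>k. q i (z k)" "\<lambda>_. hi"] qp qhi by (simp add: less_imp_le)
  have pp: "0 < p i z" for i z unfolding p_def using qp by (intro prod_pos) auto
  have p1: "P.expectation (p i) = 1" for i
    unfolding p_def by (subst PS.product_integral_prod) (simp_all add: iq q1)
  have pdens: "(\<Pi>\<^sub>M k\<in>{..<N}. density M (\<lambda>x. ennreal (q i x))) = density ?P (\<lambda>z. ennreal (p i z))" for i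
    unfolding p_def
  proof (rule PiM_density)
    show "prob_space (density M (\<lambda>x. ennreal (q i x)))"
    proof (rule prob_spaceI)
      have "(\<integral>\<^sup>+x. ennreal (q i x) \<partial>M) = ennreal (expectation (q i))"
        by (rule nn_integral_eq_integral[OF iq]) (simp add: qp less_imp_le)
      then show "emeasure (density M (\<lambda>x. ennreal (q i x))) (space (density M (\<lambda>x. ennreal (q i x)))) = 1"
        by (simp add: emeasure_density q1 nn_integral_set_ennreal[symmetric] cong: nn_integral_cong)
    qed
  qed (simp_all add: prob_space_axioms qp less_imp_le)
  have riskP: "(\<integral>\<^sup>+z. ennreal (real N * ((T z - \<tau> i)\<^sup>2 * p i z)) \<partial>?P) \<le> ennreal \<rho>" if "i \<le> n" for i
  proof -
    have "(\<integral>\<^sup>+z. ennreal (real N * ((T z - \<tau> i)\<^sup>2 * p i z)) \<partial>?P)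
        = (\<integral>\<^sup>+z. ennreal (p i z) * ennreal (real N * (T z - \<tau> i)\<^sup>2) \<partial>?P)"
      by (intro nn_integral_cong) (simp add: pp less_imp_le mult_ac flip: ennreal_mult)
    also have "\<dots> = (\<integral>\<^sup>+z. ennreal (real N * (T z - \<tau> i)\<^sup>2) \<partial>(\<Pi>\<^sub>M k\<in>{..<N}. density M (\<lambda>x. ennreal (q i x))))"
      unfolding pdens by (rule nn_integral_density[symmetric]) measurable
    finally show ?thesis using risk[OF that] by simp
  qed
  have ir: "integrable ?P (\<lambda>z. real N * ((T z - \<tau> i)\<^sup>2 * p i z))" if "i \<le> n" for i
  proof (rule integrableI_nonneg)
    show "(\<integral>\<^sup>+z. ennreal (real N * ((T z - \<tau> i)\<^sup>2 * p i z)) \<partial>?P) < \<infinity>"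
      using riskP[OF that] by (rule order_le_less_trans) simp
  qed (auto simp: pp less_imp_le)
  have riskR: "P.expectation (\<lambda>z. (T z - \<tau> i)\<^sup>2 * p i z) \<le> \<rho> / N" if "i \<le> n" for i
  proof -
    have "ennreal (P.expectation (\<lambda>z. real N * ((T z - \<tau> i)\<^sup>2 * p i z))) \<le> ennreal \<rho>"
      using riskP[OF that] by (subst nn_integral_eq_integral[OF ir[OF that], symmetric]) (auto simp: pp less_imp_le)
    then show ?thesis using \<rho> N by (simp add: field_simps)
  qed
  have sT0: "square_integrable ?P (\<lambda>z. T z - \<tau> 0)"
    unfolding square_integrable_def
  proof
    show "integrable ?P (\<lambda>z. (T z - \<tau> 0)\<^sup>2)"
    proof (rule Bochner_Integration.integrable_bound)
      show "integrable ?P (\<lambda>z. (1 / (N * lo ^ N)) * (real N * ((T z - \<tau> 0)\<^sup>2 * p 0 z)))"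
        using ir[of 0] by (intro integrable_mult_right) simp
      have "(T z - \<tau> 0)\<^sup>2 * 1 \<le> (T z - \<tau> 0)\<^sup>2 * (p 0 z / lo ^ N)" for z
        using plo[of 0 z] lo by (intro mult_left_mono) auto
      then show "AE z in ?P. norm ((T z - \<tau> 0)\<^sup>2) \<le> norm ((1 / (N * lo ^ N)) * (real N * ((T z - \<tau> 0)\<^sup>2 * p 0 z)))"
        using N lo pp[of 0] by (intro AE_I2) (simp add: less_imp_le abs_mult)
    qed measurable
  qed measurable
  have sT: "square_integrable ?P T"
    using square_integrable_add[OF sT0 P.square_integrable_bounded[of "\<lambda>_. \<tau> 0" "\<bar>\<tau> 0\<bar>"]] by simp
  have chiP: "P.expectation (\<lambda>z. (p (Suc i) z)\<^sup>2 / p i z) \<le> exp y" if i: "i < n" for i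
  proof -
    have int: "integrable M (\<lambda>x. (q (Suc i) x)\<^sup>2 / q i x)"
    proof (rule integrable_const_bound[where B = "hi\<^sup>2 / lo"])
      have "norm ((q (Suc i) x)\<^sup>2 / q i x) \<le> hi\<^sup>2 / lo" for x
      proof -
        have "(q (Suc i) x)\<^sup>2 \<le> hi\<^sup>2" using qp qhi by (intro power_mono) (auto simp: less_imp_le)
        then show ?thesis using qp[of i x] qlo[of i x] lo by (simp add: frac_le less_imp_le)
      qed
      then show "AE x in M. norm ((q (Suc i) x)\<^sup>2 / q i x) \<le> hi\<^sup>2 / lo" by simp
    qed measurable
    have "P.expectation (\<lambda>z. (p (Suc i) z)\<^sup>2 / p i z) = P.expectation (\<lambda>z. \<Prod>k<N. (q (Suc i) (z k))\<^sup>2 / q i (z k))"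
      unfolding p_def by (simp add: prod_dividef prod_power_distrib)
    also have "\<dots> = (expectation (\<lambda>x. (q (Suc i) x)\<^sup>2 / q i x)) ^ N"
      by (subst PS.product_integral_prod) (simp_all add: int)
    also have "\<dots> \<le> (1 + y / N) ^ N"
      by (intro power_mono chi i integral_nonneg_AE) (simp add: qp less_imp_le)
    also have "\<dots> \<le> (exp (y / N)) ^ N"
    proof (intro power_mono exp_ge_add_one_self)
      have "0 \<le> expectation (\<lambda>x. (q (Suc i) x)\<^sup>2 / q i x)" by (intro integral_nonneg_AE) (simp add: qp less_imp_le)
      also have "\<dots> \<le> 1 + y / N" by (rule chi[OF i])
      finally show "0 \<le> 1 + y / N" .
    qed
    also have "\<dots> = exp y" using N by (simp flip: exp_of_nat_mult)
    finally show ?thesis .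
  qed
  have "\<tau> n - \<tau> 0 \<le> sqrt (\<rho> / N) * (2 + n * sqrt (exp y - 1))"
    by (rule P.chain_lower_bound[where p = p and lo = "lo ^ N" and hi = "hi ^ N", OF pm _ plo phi p1 sT riskR chiP])
      (use lo in auto)
  then have "sqrt N * (\<tau> n - \<tau> 0) \<le> sqrt N * (sqrt (\<rho> / N) * (2 + n * sqrt (exp y - 1)))"
    by (intro mult_left_mono) auto
  also have "\<dots> = sqrt \<rho> * (2 + n * sqrt (exp y - 1))"
    using N by (simp add: real_sqrt_divide)
  finally show ?thesis .
qed

text \<open>The limits are taken in the order \<open>n \<rightarrow> \<infinity>\<close>, \<open>\<delta> \<rightarrow> 0\<close>, \<open>\<rho> \<rightarrow> B\<close>. The term \<open>\<delta> ^ 3\<close> is a margin that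
  turns asymptotic bounds into eventual ones; it disappears against \<open>\<delta>\<^sup>2\<close>.\<close>

lemma slope_le_of_chain_bounds:
  fixes A B J :: real
  assumes J: "0 \<le> J" and B: "0 \<le> B"
    and bound: "\<And>n \<delta> \<rho>. 0 < \<delta> \<Longrightarrow> \<delta> < 1 \<Longrightarrow> B < \<rho> \<Longrightarrow>
      real n * \<delta> * A \<le> sqrt \<rho> * (2 + real n * sqrt (exp (\<delta>\<^sup>2 * J + \<delta> ^ 3) - 1))"
  shows "A \<le> sqrt B * sqrt J"
proof -
  have 1: "\<delta> * A \<le> sqrt \<rho> * sqrt (exp (\<delta>\<^sup>2 * J + \<delta> ^ 3) - 1)" if d: "0 < \<delta>" "\<delta> < 1" and r: "B < \<rho>" for \<delta> \<rho>
  proof (rule tendsto_lowerbound)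
    let ?e = "sqrt (exp (\<delta>\<^sup>2 * J + \<delta> ^ 3) - 1)"
    have "(\<lambda>n. sqrt \<rho> * (2 / real n + ?e)) \<longlonglongrightarrow> sqrt \<rho> * (0 + ?e)"
      by (intro tendsto_intros real_tendsto_divide_at_top filterlim_real_sequentially)
    then show "(\<lambda>n. sqrt \<rho> * (2 / real n + ?e)) \<longlonglongrightarrow> sqrt \<rho> * ?e" by simp
    show "\<forall>\<^sub>F n in sequentially. \<delta> * A \<le> sqrt \<rho> * (2 / real n + ?e)"
      using eventually_gt_at_top[of 0]
    proof eventually_elim
      case (elim n)
      have "real n * (\<delta> * A) \<le> real n * (sqrt \<rho> * (2 / real n + ?e))"
      proof -
        have eq: "real n * (sqrt \<rho> * (2 / real n + ?e)) = sqrt \<rho> * (2 + real n * ?e)"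
          using elim by (simp add: algebra_simps)
        show ?thesis unfolding eq using bound[OF d r, of n] by (simp only: mult.assoc)
      qed
      then show ?case using elim by simp
    qed
  qed simp
  have 2: "A \<le> sqrt \<rho> * sqrt J" if r: "B < \<rho>" for \<rho>
  proof (rule tendsto_lowerbound)
    have "((\<lambda>\<delta>. (exp (\<delta>\<^sup>2 * J + \<delta> ^ 3) - 1) / \<delta>\<^sup>2) \<longlongrightarrow> J) (at_right 0)"
      by real_asymp
    then show "((\<lambda>\<delta>. sqrt \<rho> * sqrt ((exp (\<delta>\<^sup>2 * J + \<delta> ^ 3) - 1) / \<delta>\<^sup>2)) \<longlongrightarrow> sqrt \<rho> * sqrt J) (at_right 0)"
      by (intro tendsto_intros)
    have "eventually (\<lambda>\<delta>::real. 0 < \<delta> \<and> \<delta> < 1) (at_right 0)"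
      by (auto simp: eventually_at_right_field intro: exI[of _ 1])
    then show "\<forall>\<^sub>F \<delta> in at_right 0. A \<le> sqrt \<rho> * sqrt ((exp (\<delta>\<^sup>2 * J + \<delta> ^ 3) - 1) / \<delta>\<^sup>2)"
    proof eventually_elim
      case (elim \<delta>)
      have "A = (\<delta> * A) / \<delta>" using elim by simp
      also have "\<dots> \<le> (sqrt \<rho> * sqrt (exp (\<delta>\<^sup>2 * J + \<delta> ^ 3) - 1)) / \<delta>"
        using 1[of \<delta>, OF _ _ r] elim by (intro divide_right_mono) auto
      also have "\<dots> = sqrt \<rho> * sqrt ((exp (\<delta>\<^sup>2 * J + \<delta> ^ 3) - 1) / \<delta>\<^sup>2)"
        using elim by (simp add: real_sqrt_divide)
      finally show ?case .
    qed
  qed simp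
  show ?thesis
  proof (rule tendsto_lowerbound)
    show "((\<lambda>\<rho>. sqrt \<rho> * sqrt J) \<longlongrightarrow> sqrt B * sqrt J) (at_right B)"
      by (intro tendsto_intros)
    show "\<forall>\<^sub>F \<rho> in at_right B. A \<le> sqrt \<rho> * sqrt J"
      using eventually_at_right_less[of B] by eventually_elim (rule 2)
  qed simp
qed

section \<open>The law of the observed data\<close>

definition observed_pattern :: "('n \<Rightarrow> real option) \<Rightarrow> 'n set" where
  "observed_pattern z = {j. z j \<noteq> None}"

text \<open>The value \<open>0\<close> at missing coordinates is arbitrary: \<open>zero_fill\<close> is only composed with functions of the
  observed coordinates. It makes such functions, which live on \<open>\<real>\<^sup>d\<close>, into functions of the data.\<close>

definition zero_fill :: "('n::finite \<Rightarrow> real option) \<Rightarrow> real ^ 'n" where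
  "zero_fill z = (\<chi> j. case z j of None \<Rightarrow> 0 | Some r \<Rightarrow> r)"

abbreviation restr_algebra :: "'n set \<Rightarrow> (real ^ 'n::finite) measure" where
  "restr_algebra S \<equiv> vimage_algebra UNIV (restr S) (coord_space S)"

lemma restr_eq_iff: "restr S x = restr S y \<longleftrightarrow> (\<forall>j\<in>S. x $ j = y $ j)"
  unfolding restr_def fun_eq_iff restrict_def by auto

lemma observed_pattern_mask [simp]: "observed_pattern (mask (x, one_vec S)) = S"
  by (auto simp: observed_pattern_def mask_def one_vec_def)

lemma restr_zero_fill_mask [simp]: "restr S (zero_fill (mask (x, one_vec S))) = restr S x"
  by (auto simp: restr_eq_iff zero_fill_def mask_def one_vec_def)

lemma space_coord_space: "restr S x \<in> space (coord_space S)"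
  by (auto simp: coord_space_def restr_def space_PiM)

lemma measurable_restr_algebra: "restr S \<in> restr_algebra S \<rightarrow>\<^sub>M coord_space S"
  by (rule measurable_vimage_algebra1) (simp add: space_coord_space)

lemma measurable_component_restr_algebra:
  fixes S :: "'n::finite set"
  assumes "j \<in> S"
  shows "(\<lambda>x. x $ j) \<in> borel_measurable (restr_algebra S)"
proof -
  have "(\<lambda>y. y j) \<in> coord_space S \<rightarrow>\<^sub>M borel"
    unfolding coord_space_def by (rule measurable_component_singleton[OF assms])
  from measurable_compose[OF measurable_restr_algebra this] show ?thesis
    using assms by (simp add: restr_def)
qed

lemma restr_algebra_mono:
  fixes S :: "'n::finite set"
  assumes "R \<subseteq> S"
  shows "subalgebra (restr_algebra S) (restr_algebra R)"
proof -
  have "(\<lambda>f. restrict f R) \<in> coord_space S \<rightarrow>\<^sub>M coord_space R"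
    unfolding coord_space_def by (rule measurable_restrict_subset[OF assms])
  from measurable_compose[OF measurable_restr_algebra this]
  have "(\<lambda>x. restrict (restr S x) R) \<in> restr_algebra S \<rightarrow>\<^sub>M coord_space R" .
  also have "(\<lambda>x. restrict (restr S x) R) = restr R"
    using assms by (auto simp: restr_def fun_eq_iff restrict_def)
  finally show ?thesis
    unfolding subalgebra_def by (simp add: sets_image_in_sets)
qed

lemma borel_measurable_vecI:
  fixes f :: "'a \<Rightarrow> real ^ 'n::finite"
  assumes "\<And>j. (\<lambda>x. f x $ j) \<in> borel_measurable M"
  shows "f \<in> borel_measurable M"
  unfolding borel_measurable_euclidean_space[of f]
  using assms by (auto simp: Basis_vec_def inner_axis)

lemma sets_restr_algebra_UNIV: "sets (restr_algebra (UNIV :: 'n::finite set)) = sets borel"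
proof
  show "sets (restr_algebra (UNIV :: 'n set)) \<subseteq> sets borel"
    by (rule sets_image_in_sets[OF _ measurable_restr]) simp
  have "(\<lambda>x. x) \<in> borel_measurable (restr_algebra (UNIV :: 'n set))"
    by (rule borel_measurable_vecI) (simp add: measurable_component_restr_algebra)
  from measurable_sets[OF this] show "sets borel \<subseteq> sets (restr_algebra (UNIV :: 'n set))"
    by auto
qed

text \<open>A set in the sigma-algebra generated by \<open>x\<^sub>S\<close> is a preimage under \<open>restr S\<close>, so a measurable function
  factors through \<open>restr S\<close> at every point, not merely almost everywhere.\<close>

lemma restr_algebra_function_eq:
  fixes v :: "real ^ 'n::finite \<Rightarrow> real"
  assumes v: "v \<in> borel_measurable (restr_algebra S)" and eq: "restr S x = restr S y"
  shows "v x = v y"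
proof -
  have "v -` {v x} \<inter> space (restr_algebra S) \<in> sets (restr_algebra S)"
    by (rule measurable_sets[OF v]) simp
  then obtain A where "v -` {v x} = restr S -` A"
    by (auto simp: sets_vimage_algebra2 space_coord_space)
  then have "y \<in> v -` {v x}" using eq by (metis singletonI vimage_eq)
  then show ?thesis by simp
qed

lemma measurable_observed_pattern:
  "observed_pattern \<in> (obs_space :: ('n::finite \<Rightarrow> real option) measure) \<rightarrow>\<^sub>M count_space UNIV"
proof -
  have "observed_pattern -` {S} \<inter> space (obs_space :: ('n \<Rightarrow> real option) measure) \<in> sets obs_space" for S :: "'n set"
  proof -
    have N: "{None} \<in> sets option_borel" "{y. y \<noteq> None} \<in> sets option_borel"
      by (auto simp: sets_option_borel vimage_def)
    have "(if j \<in> S then {y. y \<noteq> None} else {None}) \<in> sets option_borel" for j using N by simp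
    then have "Pi\<^sub>E UNIV (\<lambda>j. if j \<in> S then {y. y \<noteq> None} else {None}) \<in> sets (obs_space :: ('n \<Rightarrow> real option) measure)"
      unfolding obs_space_def by (intro sets_PiM_I_finite) auto
    also have "Pi\<^sub>E UNIV (\<lambda>j. if j \<in> S then {y. y \<noteq> None} else {None})
        = observed_pattern -` {S} \<inter> space (obs_space :: ('n \<Rightarrow> real option) measure)"
    proof (rule set_eqI)
      fix z :: "'n \<Rightarrow> real option"
      have "z \<in> Pi\<^sub>E UNIV (\<lambda>j. if j \<in> S then {y. y \<noteq> None} else {None}) \<longleftrightarrow> (\<forall>j. (z j \<noteq> None) = (j \<in> S))"
        unfolding PiE_UNIV_domain Pi_iff by (metis (mono_tags, lifting) UNIV_I mem_Collect_eq singletonD singletonI)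
      also have "\<dots> \<longleftrightarrow> observed_pattern z = S" unfolding observed_pattern_def by blast
      finally show "z \<in> Pi\<^sub>E UNIV (\<lambda>j. if j \<in> S then {y. y \<noteq> None} else {None})
          \<longleftrightarrow> z \<in> observed_pattern -` {S} \<inter> space (obs_space :: ('n \<Rightarrow> real option) measure)"
        by (simp add: obs_space_def space_PiM space_option_borel)
    qed
    finally show ?thesis .
  qed
  then show ?thesis by (simp add: measurable_count_space_eq2)
qed

lemma measurable_zero_fill:
  "zero_fill \<in> (obs_space :: ('n::finite \<Rightarrow> real option) measure) \<rightarrow>\<^sub>M borel"
proof (rule borel_measurable_vecI)
  fix j :: 'n
  have 1: "(\<lambda>y. case y of None \<Rightarrow> 0 :: real | Some r \<Rightarrow> r) \<in> option_borel \<rightarrow>\<^sub>M borel"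
  proof (rule measurableI)
    fix A :: "real set" assume "A \<in> sets borel"
    moreover have "Some -` ((\<lambda>y. case y of None \<Rightarrow> 0 :: real | Some r \<Rightarrow> r) -` A) = A" by auto
    ultimately show "(\<lambda>y. case y of None \<Rightarrow> 0 :: real | Some r \<Rightarrow> r) -` A \<inter> space option_borel \<in> sets option_borel"
      by (simp add: sets_option_borel space_option_borel)
  qed simp
  have 2: "(\<lambda>z. z j) \<in> (obs_space :: ('n \<Rightarrow> real option) measure) \<rightarrow>\<^sub>M option_borel"
    unfolding obs_space_def by (rule measurable_component_singleton) simp
  show "(\<lambda>z. zero_fill z $ j) \<in> borel_measurable (obs_space :: ('n \<Rightarrow> real option) measure)"
    using measurable_compose[OF 2 1] by (simp add: zero_fill_def)
qed

lemma measurable_mask_pattern: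
  "(\<lambda>x. mask (x, one_vec S)) \<in> restr_algebra S \<rightarrow>\<^sub>M (obs_space :: ('n::finite \<Rightarrow> real option) measure)"
proof -
  have Some: "Some \<in> borel \<rightarrow>\<^sub>M option_borel"
    by (rule measurableI) (auto simp: sets_option_borel space_option_borel)
  have "(\<lambda>x. mask (x, one_vec S) j) \<in> restr_algebra S \<rightarrow>\<^sub>M option_borel" for j
  proof (cases "j \<in> S")
    case True
    then show ?thesis
      using measurable_compose[OF measurable_component_restr_algebra[OF True] Some]
      by (simp add: mask_def one_vec_def)
  next
    case False
    then show ?thesis by (simp add: mask_def one_vec_def space_option_borel)
  qed
  then show ?thesis
    unfolding obs_space_def by (intro measurable_PiM_single') (auto simp: space_option_borel)
qed

lemma prob_space_law:
  assumes "prob_density g"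
  shows "prob_space (law g)"
  using assms unfolding prob_density_def law_def
  by (intro prob_spaceI) (simp add: emeasure_density)

lemma sets_law [measurable_cong, simp]: "sets (law g) = sets borel" and space_law [simp]: "space (law g) = UNIV"
  by (simp_all add: law_def)

lemma bij_one_vec: "bij (one_vec :: 'n set \<Rightarrow> 'n \<Rightarrow> bool)"
proof (rule bijI)
  show "inj (one_vec :: 'n set \<Rightarrow> _)" by (auto simp: inj_def one_vec_def fun_eq_iff)
  have "\<omega> = one_vec (Collect \<omega>)" for \<omega> :: "'n \<Rightarrow> bool" by (simp add: one_vec_def)
  then show "surj (one_vec :: 'n set \<Rightarrow> _)" by (rule surjI[OF sym])
qed

lemma joint_density_meas:
  fixes g :: "real ^ 'n::finite \<Rightarrow> real"
  assumes g[measurable]: "g \<in> borel_measurable borel" and K: "markov_kernel K"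
  shows "(\<lambda>(x, \<omega>). ennreal (g x * pmf (K x) \<omega>)) \<in> borel_measurable (lborel \<Otimes>\<^sub>M count_space UNIV)"
proof -
  have [measurable]: "\<And>\<omega>. (\<lambda>x. pmf (K x) \<omega>) \<in> borel_measurable borel"
    using K by (auto simp: markov_kernel_def)
  have "(\<lambda>z. ennreal (g (fst z) * pmf (K (fst z)) (snd z))) \<in> borel_measurable (lborel \<Otimes>\<^sub>M count_space UNIV)"
    by (rule measurable_compose_countable'[where I = UNIV and g = snd]) auto
  then show ?thesis by (simp add: case_prod_beta)
qed

lemma nn_integral_obs_law:
  fixes g :: "real ^ 'n::finite \<Rightarrow> real"
  assumes g[measurable]: "g \<in> borel_measurable borel" and g0: "\<And>x. 0 \<le> g x"
    and K: "markov_kernel K" and p[measurable]: "\<phi> \<in> borel_measurable obs_space"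
  shows "(\<integral>\<^sup>+z. \<phi> z \<partial>obs_law g K)
    = (\<Sum>S\<in>UNIV. \<integral>\<^sup>+x. \<phi> (mask (x, one_vec S)) * (ennreal (pmf (K x) (one_vec S)) * ennreal (g x)) \<partial>lborel)"
proof -
  interpret C: finite_measure "count_space (UNIV :: ('n \<Rightarrow> bool) set)"
    by (rule finite_measure_count_space) simp
  have [measurable]: "\<And>\<omega>. (\<lambda>x. pmf (K x) \<omega>) \<in> borel_measurable borel"
    using K by (auto simp: markov_kernel_def)
  note m = joint_density_meas[OF g K]
  have sets_eq: "sets (lborel \<Otimes>\<^sub>M count_space (UNIV :: ('n \<Rightarrow> bool) set)) = sets (borel \<Otimes>\<^sub>M count_space UNIV)"
    by (intro sets_pair_measure_cong) auto
  have mm: "mask \<in> (lborel \<Otimes>\<^sub>M count_space (UNIV :: ('n \<Rightarrow> bool) set)) \<rightarrow>\<^sub>M obs_space"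
    using measurable_mask unfolding measurable_cong_sets[OF sets_eq refl] .
  have mm': "mask \<in> full_law g K \<rightarrow>\<^sub>M obs_space"
    using mm by (simp add: full_law_def)
  have pm: "(\<lambda>z. \<phi> (mask z)) \<in> borel_measurable (lborel \<Otimes>\<^sub>M count_space (UNIV :: ('n \<Rightarrow> bool) set))"
    by (rule measurable_compose[OF mm p])
  have pmS: "(\<lambda>x. \<phi> (mask (x, \<omega>))) \<in> borel_measurable lborel" for \<omega>
    by (rule measurable_compose[OF _ pm]) (rule measurable_Pair2', simp)
  have "(\<integral>\<^sup>+z. \<phi> z \<partial>obs_law g K) = (\<integral>\<^sup>+z. \<phi> (mask z) \<partial>full_law g K)"
    unfolding obs_law_def by (rule nn_integral_distr[OF mm']) (simp add: p)
  also have "\<dots> = (\<integral>\<^sup>+z. (case z of (x, \<omega>) \<Rightarrow> ennreal (g x * pmf (K x) \<omega>)) * \<phi> (mask z) \<partial>(lborel \<Otimes>\<^sub>M count_space UNIV))"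
    unfolding full_law_def by (rule nn_integral_density[OF m pm])
  also have "\<dots> = (\<integral>\<^sup>+x. \<integral>\<^sup>+\<omega>. ennreal (g x * pmf (K x) \<omega>) * \<phi> (mask (x, \<omega>)) \<partial>count_space UNIV \<partial>lborel)"
    by (subst C.nn_integral_fst[OF borel_measurable_times_ennreal[OF m pm], symmetric]) (simp only: case_prod_conv)
  also have "\<dots> = (\<integral>\<^sup>+x. (\<Sum>\<omega>\<in>UNIV. ennreal (g x * pmf (K x) \<omega>) * \<phi> (mask (x, \<omega>))) \<partial>lborel)"
    by (simp add: nn_integral_count_space_finite)
  also have "\<dots> = (\<Sum>\<omega>\<in>UNIV. \<integral>\<^sup>+x. ennreal (g x * pmf (K x) \<omega>) * \<phi> (mask (x, \<omega>)) \<partial>lborel)"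
    by (intro nn_integral_sum borel_measurable_times_ennreal pmS) measurable
  also have "\<dots> = (\<Sum>S\<in>UNIV. \<integral>\<^sup>+x. ennreal (g x * pmf (K x) (one_vec S)) * \<phi> (mask (x, one_vec S)) \<partial>lborel)"
    by (rule sum.reindex_bij_betw[OF bij_one_vec, symmetric])
  also have "\<dots> = (\<Sum>S\<in>UNIV. \<integral>\<^sup>+x. \<phi> (mask (x, one_vec S)) * (ennreal (pmf (K x) (one_vec S)) * ennreal (g x)) \<partial>lborel)"
  proof (intro sum.cong nn_integral_cong refl)
    fix S :: "'n set" and x
    have "ennreal (g x * pmf (K x) (one_vec S)) = ennreal (pmf (K x) (one_vec S)) * ennreal (g x)"
      by (subst mult.commute, rule ennreal_mult) (simp_all add: g0)
    then show "ennreal (g x * pmf (K x) (one_vec S)) * \<phi> (mask (x, one_vec S))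
        = \<phi> (mask (x, one_vec S)) * (ennreal (pmf (K x) (one_vec S)) * ennreal (g x))"
      by (simp only: mult.commute)
  qed
  finally show ?thesis .
qed

text \<open>The missing data model with the lower bound \<open>c\<close> for the observation probabilities made explicit.\<close>

locale missing_data =
  fixes f :: "real ^ 'n::finite \<Rightarrow> real" and K :: "real ^ 'n \<Rightarrow> ('n \<Rightarrow> bool) pmf"
    and S0 :: "'n set" and M :: "'n set \<Rightarrow> ('n \<Rightarrow> real) \<Rightarrow> real" and c :: real
  assumes density_f: "prob_density f" and kernel_K: "markov_kernel K"
    and S0_subset: "\<And>S. S \<in> incomplete_patterns f K \<Longrightarrow> S0 \<subseteq> S"
    and M_meas: "\<And>S. S \<in> insert UNIV (incomplete_patterns f K) \<Longrightarrow> M S \<in> borel_measurable (coord_space S0)"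
    and M_ge: "\<And>S y. S \<in> insert UNIV (incomplete_patterns f K) \<Longrightarrow> y \<in> space (coord_space S0) \<Longrightarrow> c \<le> M S y"
    and M_le: "\<And>S y. S \<in> insert UNIV (incomplete_patterns f K) \<Longrightarrow> y \<in> space (coord_space S0) \<Longrightarrow> M S y \<le> 1"
    and M_pmf: "\<And>S. S \<in> insert UNIV (incomplete_patterns f K) \<Longrightarrow>
      AE x in law f. pmf (K x) (one_vec S) = M S (restr S0 x)"
    and c_pos: "0 < c"
begin

abbreviation patterns :: "'n set set" where
  "patterns \<equiv> insert UNIV (incomplete_patterns f K)"

definition weight :: "'n set \<Rightarrow> real ^ 'n \<Rightarrow> real" where
  "weight S x = M S (restr S0 x)"

lemma f_meas [measurable]: "f \<in> borel_measurable borel" and f_nonneg: "0 \<le> f x"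
  using density_f by (auto simp: prob_density_def)

lemma pmf_meas [measurable]: "(\<lambda>x. pmf (K x) \<omega>) \<in> borel_measurable borel"
  using kernel_K by (auto simp: markov_kernel_def)

text \<open>A pattern outside \<open>patterns\<close> has probability zero, which is the integral of the joint density of
  \<open>X\<close> and \<open>\<Omega>\<close> over the slice of this pattern.\<close>

lemma AE_law_pmf_zero:
  assumes "S \<notin> patterns"
  shows "AE x in law f. pmf (K x) (one_vec S) = 0"
proof -
  interpret C: finite_measure "count_space (UNIV :: ('n \<Rightarrow> bool) set)"
    by (rule finite_measure_count_space) simp
  interpret J: prob_space "full_law f K" by (rule prob_space_full_law[OF density_f kernel_K])
  note m = joint_density_meas[OF f_meas kernel_K]
  let ?A = "(UNIV :: (real ^ 'n) set) \<times> {one_vec S}"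
  have A: "?A \<in> sets (lborel \<Otimes>\<^sub>M count_space UNIV)" by (intro pair_measureI) auto
  have Aeq: "{z. snd z = one_vec S} = ?A" by auto
  have "pat_prob f K S = 0"
  proof -
    have "\<not> 0 < pat_prob f K S" using assms by (auto simp: incomplete_patterns_def)
    moreover have "0 \<le> pat_prob f K S" unfolding pat_prob_def by (rule measure_nonneg)
    ultimately show ?thesis by simp
  qed
  then have "emeasure (full_law f K) ?A = 0"
    unfolding pat_prob_def Aeq by (simp add: J.emeasure_eq_measure)
  then have "(\<integral>\<^sup>+z. (case z of (x, \<omega>) \<Rightarrow> ennreal (f x * pmf (K x) \<omega>)) * indicator ?A z
      \<partial>(lborel \<Otimes>\<^sub>M count_space UNIV)) = 0"
    unfolding full_law_def by (subst (asm) emeasure_density[OF m A])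
  also have "(\<integral>\<^sup>+z. (case z of (x, \<omega>) \<Rightarrow> ennreal (f x * pmf (K x) \<omega>)) * indicator ?A z \<partial>(lborel \<Otimes>\<^sub>M count_space UNIV))
      = (\<integral>\<^sup>+x. \<integral>\<^sup>+\<omega>. ennreal (f x * pmf (K x) \<omega>) * indicator ?A (x, \<omega>) \<partial>count_space UNIV \<partial>lborel)"
    by (subst C.nn_integral_fst[OF borel_measurable_times_ennreal[OF m borel_measurable_indicator[OF A]], symmetric])
      (simp only: case_prod_conv)
  also have "\<dots> = (\<integral>\<^sup>+x. ennreal (f x * pmf (K x) (one_vec S)) \<partial>lborel)"
  proof (rule nn_integral_cong)
    fix x
    have "(\<integral>\<^sup>+\<omega>. ennreal (f x * pmf (K x) \<omega>) * indicator ?A (x, \<omega>) \<partial>count_space UNIV)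
        = (\<integral>\<^sup>+\<omega>. ennreal (f x * pmf (K x) (one_vec S)) * indicator {one_vec S} \<omega> \<partial>count_space UNIV)"
      by (intro nn_integral_cong) (auto simp: indicator_def)
    also have "\<dots> = ennreal (f x * pmf (K x) (one_vec S))"
      by (subst nn_integral_cmult_indicator) auto
    finally show "(\<integral>\<^sup>+\<omega>. ennreal (f x * pmf (K x) \<omega>) * indicator ?A (x, \<omega>) \<partial>count_space UNIV)
        = ennreal (f x * pmf (K x) (one_vec S))" .
  qed
  finally have "(\<integral>\<^sup>+x. ennreal (f x * pmf (K x) (one_vec S)) \<partial>lborel) = 0" .
  then have "AE x in lborel. ennreal (f x * pmf (K x) (one_vec S)) = 0"
    by (subst (asm) nn_integral_0_iff_AE) auto
  then show ?thesis
    unfolding law_def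
  proof (subst AE_density, (measurable)[1], eventually_elim)
    fix x assume z: "ennreal (f x * pmf (K x) (one_vec S)) = 0"
    show "0 < ennreal (f x) \<longrightarrow> pmf (K x) (one_vec S) = 0"
    proof
      assume "0 < ennreal (f x)"
      then have "0 < f x" by simp
      with z have "f x * pmf (K x) (one_vec S) \<le> 0" by (simp add: ennreal_eq_0_iff)
      with \<open>0 < f x\<close> pmf_nonneg[of "K x" "one_vec S"] show "pmf (K x) (one_vec S) = 0"
        by (simp add: mult_le_0_iff)
    qed
  qed
qed

lemma weight_sum: "AE x in law f. (\<Sum>S\<in>patterns. weight S x) = 1"
proof -
  have 1: "AE x in law f. \<forall>S\<in>patterns. pmf (K x) (one_vec S) = weight S x"
    by (subst AE_finite_all) (auto simp: weight_def intro: M_pmf simp del: insert_iff)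
  have 2: "AE x in law f. \<forall>S\<in>-patterns. pmf (K x) (one_vec S) = 0"
    by (subst AE_finite_all) (use AE_law_pmf_zero in \<open>auto simp del: insert_iff\<close>)
  show ?thesis
    using 1 2
  proof eventually_elim
    case (elim x)
    have "(\<Sum>S\<in>patterns. weight S x) = (\<Sum>S\<in>patterns. pmf (K x) (one_vec S))"
      using elim(1) by (intro sum.cong) auto
    also have "\<dots> = (\<Sum>S\<in>UNIV. pmf (K x) (one_vec S))"
      by (rule sum.mono_neutral_left) (use elim(2) in auto)
    also have "\<dots> = (\<Sum>\<omega>\<in>UNIV. pmf (K x) \<omega>)"
      by (rule sum.reindex_bij_betw[OF bij_one_vec])
    also have "\<dots> = 1" by (rule sum_pmf_eq_1) auto
    finally show ?case .
  qed
qed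

lemma weight_meas0: "S \<in> patterns \<Longrightarrow> weight S \<in> borel_measurable (restr_algebra S0)"
  unfolding weight_def by (rule measurable_compose[OF measurable_restr_algebra M_meas])

sublocale weighted_projections "law f" "restr_algebra S0" restr_algebra patterns UNIV weight c
proof (intro weighted_projections.intro weighted_projections_axioms.intro)
  show "prob_space (law f)" by (rule prob_space_law[OF density_f])
  show "subalgebra (law f) (restr_algebra S)" for S
    unfolding subalgebra_def by (auto dest: subsetD[OF sets_image_in_sets[OF _ measurable_restr], rotated])
  show "subalgebra (restr_algebra S) (restr_algebra S0)" if "S \<in> patterns" for S
    by (rule restr_algebra_mono) (use that S0_subset in auto)
  show "sets (restr_algebra UNIV) = sets (law f)" by (simp add: sets_restr_algebra_UNIV)
  show "c \<le> weight S x" "weight S x \<le> 1" if "S \<in> patterns" for S x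
    using M_ge[OF that] M_le[OF that] by (auto simp: weight_def space_coord_space)
qed (auto simp: weight_sum c_pos simp del: insert_iff intro: weight_meas0)

text \<open>The observed data as a mixture over the patterns. Their law is thereby
  expressed through integrals over \<open>X\<close> alone.\<close>

lemma nn_integral_obs:
  assumes u[measurable]: "u \<in> borel_measurable borel" and u0: "\<And>x. 0 \<le> u x"
    and p: "\<phi> \<in> borel_measurable obs_space"
  shows "(\<integral>\<^sup>+z. \<phi> z \<partial>obs_law (\<lambda>x. u x * f x) K)
    = (\<Sum>S\<in>patterns. \<integral>\<^sup>+x. \<phi> (mask (x, one_vec S)) * ennreal (weight S x * u x) \<partial>law f)"
proof -
  have m: "(\<lambda>x. \<phi> (mask (x, one_vec S))) \<in> borel_measurable borel" for S
    by (rule measurable_from_subalg[OF _ measurable_compose[OF measurable_mask_pattern p]])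
      (simp add: subalgebra_def sets_image_in_sets[OF _ measurable_restr])
  have "(\<integral>\<^sup>+z. \<phi> z \<partial>obs_law (\<lambda>x. u x * f x) K)
      = (\<Sum>S\<in>UNIV. \<integral>\<^sup>+x. \<phi> (mask (x, one_vec S)) * (ennreal (pmf (K x) (one_vec S)) * ennreal (u x * f x)) \<partial>lborel)"
    by (rule nn_integral_obs_law[OF _ _ kernel_K p]) (simp_all add: u0 f_nonneg)
  also have "\<dots> = (\<Sum>S\<in>UNIV. \<integral>\<^sup>+x. \<phi> (mask (x, one_vec S)) * ennreal (pmf (K x) (one_vec S) * u x) \<partial>law f)"
  proof (intro sum.cong refl)
    fix S :: "'n set"
    note [measurable] = m[of S]
    have "(\<integral>\<^sup>+x. \<phi> (mask (x, one_vec S)) * ennreal (pmf (K x) (one_vec S) * u x) \<partial>law f)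
      = (\<integral>\<^sup>+x. ennreal (f x) * (\<phi> (mask (x, one_vec S)) * ennreal (pmf (K x) (one_vec S) * u x)) \<partial>lborel)"
      unfolding law_def by (rule nn_integral_density) measurable
    then show "(\<integral>\<^sup>+x. \<phi> (mask (x, one_vec S)) * (ennreal (pmf (K x) (one_vec S)) * ennreal (u x * f x)) \<partial>lborel)
      = (\<integral>\<^sup>+x. \<phi> (mask (x, one_vec S)) * ennreal (pmf (K x) (one_vec S) * u x) \<partial>law f)"
      by (simp add: ennreal_mult u0 f_nonneg mult_ac)
  qed
  also have "\<dots> = (\<Sum>S\<in>patterns. \<integral>\<^sup>+x. \<phi> (mask (x, one_vec S)) * ennreal (pmf (K x) (one_vec S) * u x) \<partial>law f)"
  proof (rule sum.mono_neutral_right, simp, simp, intro ballI)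
    fix S assume "S \<in> UNIV - patterns"
    then have "AE x in law f. pmf (K x) (one_vec S) = 0" by (intro AE_law_pmf_zero) simp
    then have "(\<integral>\<^sup>+x. \<phi> (mask (x, one_vec S)) * ennreal (pmf (K x) (one_vec S) * u x) \<partial>law f) = (\<integral>\<^sup>+x. 0 \<partial>law f)"
      by (intro nn_integral_cong_AE) auto
    then show "(\<integral>\<^sup>+x. \<phi> (mask (x, one_vec S)) * ennreal (pmf (K x) (one_vec S) * u x) \<partial>law f) = 0" by simp
  qed
  also have "\<dots> = (\<Sum>S\<in>patterns. \<integral>\<^sup>+x. \<phi> (mask (x, one_vec S)) * ennreal (weight S x * u x) \<partial>law f)"
  proof (intro sum.cong refl nn_integral_cong_AE)
    fix S assume "S \<in> patterns"
    from M_pmf[OF this] show "AE x in law f. \<phi> (mask (x, one_vec S)) * ennreal (pmf (K x) (one_vec S) * u x)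
        = \<phi> (mask (x, one_vec S)) * ennreal (weight S x * u x)"
      by eventually_elim (simp add: weight_def)
  qed
  finally show ?thesis .
qed

abbreviation Q0 :: "('n \<Rightarrow> real option) measure" where
  "Q0 \<equiv> obs_law f K"

lemma sets_obs_law [measurable_cong, simp]: "sets (obs_law g K) = sets obs_space"
  by (simp add: obs_law_def)

lemma prob_space_obs_law:
  assumes "prob_density g"
  shows "prob_space (obs_law g K)"
proof -
  interpret J: prob_space "full_law g K" by (rule prob_space_full_law[OF assms kernel_K])
  have sets_eq: "sets (full_law g K) = sets (borel \<Otimes>\<^sub>M count_space UNIV)"
    unfolding full_law_def by (simp, intro sets_pair_measure_cong) auto
  show ?thesis
    unfolding obs_law_def
    by (rule J.prob_space_distr) (simp add: measurable_cong_sets[OF sets_eq refl] measurable_mask)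
qed

lemma nn_integral_Q0:
  assumes p: "\<phi> \<in> borel_measurable obs_space"
  shows "(\<integral>\<^sup>+z. \<phi> z \<partial>Q0) = (\<Sum>S\<in>patterns. \<integral>\<^sup>+x. \<phi> (mask (x, one_vec S)) * ennreal (weight S x) \<partial>law f)"
  using nn_integral_obs[OF _ _ p, of "\<lambda>_. 1"] by simp

lemma AE_Q0I:
  assumes P: "Measurable.pred obs_space P"
    and ae: "\<And>S. S \<in> patterns \<Longrightarrow> AE x in law f. P (mask (x, one_vec S))"
  shows "AE z in Q0. P z"
proof -
  have m: "{z \<in> space obs_space. \<not> P z} \<in> sets obs_space" using P by measurable
  have sp: "mask (x, one_vec S) \<in> space obs_space" for x S
    by (simp add: obs_space_def space_PiM space_option_borel)
  have "(\<integral>\<^sup>+z. indicator {z \<in> space obs_space. \<not> P z} z \<partial>Q0) = (\<Sum>S\<in>patterns. (\<integral>\<^sup>+x. 0 \<partial>law f))"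
  proof (subst nn_integral_Q0, use m in measurable, intro sum.cong refl nn_integral_cong_AE)
    fix S assume "S \<in> patterns"
    from ae[OF this] show "AE x in law f. indicator {z \<in> space obs_space. \<not> P z} (mask (x, one_vec S)) * ennreal (weight S x) = 0"
      by eventually_elim simp
  qed
  then have "emeasure Q0 {z \<in> space obs_space. \<not> P z} = 0" using m by simp
  then show ?thesis
    by (intro AE_I[of _ _ "{z \<in> space obs_space. \<not> P z}"]) (use m in \<open>auto simp: obs_law_def\<close>)
qed

text \<open>A version of the conditional expectation of \<open>u(X)\<close> given the observed data \<open>X \<circ> \<Omega>\<close>. Since missingness
  depends on \<open>X\<close> only through coordinates that are always observed, it suffices to condition on
  \<open>X\<^sub>S\<close>, with \<open>S\<close> the observed pattern.\<close>

definition observed_mean :: "(real ^ 'n \<Rightarrow> real) \<Rightarrow> ('n \<Rightarrow> real option) \<Rightarrow> real" where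
  "observed_mean u z = cond_given f (observed_pattern z) u (zero_fill z)"

lemma observed_mean_meas [measurable]: "observed_mean u \<in> borel_measurable obs_space"
  unfolding observed_mean_def[abs_def]
proof (rule measurable_compose_countable'[OF _ measurable_observed_pattern])
  show "(\<lambda>z. cond_given f S u (zero_fill z)) \<in> borel_measurable obs_space" for S
    using measurable_compose[OF measurable_zero_fill, of "cond_given f S u" borel]
    by (simp add: cond_given_def)
qed simp

lemma observed_mean_mask: "observed_mean u (mask (x, one_vec S)) = proj S u x"
proof -
  have "proj S u (zero_fill (mask (x, one_vec S))) = proj S u x"
    by (rule restr_algebra_function_eq[where S = S]) simp_all
  then show ?thesis by (simp add: observed_mean_def cond_given_def)
qed

text \<open>Multiplying the density of \<open>X\<close> by \<open>u\<close> multiplies the law of the observed data by the conditional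
  expectation of \<open>u\<close>: for each pattern, the event and the weight are functions of \<open>x\<^sub>S\<close>, so \<open>u\<close> may be
  replaced by its projection.\<close>

lemma obs_law_tilted:
  assumes u[measurable]: "u \<in> borel_measurable borel" and u0: "\<And>x. 0 \<le> u x" and ub: "\<And>x. u x \<le> b"
  shows "obs_law (\<lambda>x. u x * f x) K = density Q0 (\<lambda>z. ennreal (observed_mean u z))"
proof (rule measure_eqI)
  fix A assume "A \<in> sets (obs_law (\<lambda>x. u x * f x) K)"
  then have A[measurable]: "A \<in> sets obs_space" by (simp only: sets_obs_law)
  have "emeasure (obs_law (\<lambda>x. u x * f x) K) A = (\<integral>\<^sup>+z. indicator A z \<partial>obs_law (\<lambda>x. u x * f x) K)"
    by (rule nn_integral_indicator[symmetric]) (simp only: sets_obs_law A)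
  also have "\<dots> = (\<Sum>S\<in>patterns. \<integral>\<^sup>+x. indicator A (mask (x, one_vec S)) * ennreal (weight S x * u x) \<partial>law f)"
    by (rule nn_integral_obs) (simp_all add: u0)
  also have "\<dots> = (\<Sum>S\<in>patterns. \<integral>\<^sup>+x. ennreal (proj S u x) * indicator A (mask (x, one_vec S)) * ennreal (weight S x) \<partial>law f)"
  proof (intro sum.cong refl)
    fix S assume S: "S \<in> patterns"
    interpret FS: finite_measure_subalgebra "law f" "restr_algebra S" by (rule subalg_cond_exp[OF S])
    define m where "m = (\<lambda>x. indicator A (mask (x, one_vec S)) * weight S x :: real)"
    have mF: "m \<in> borel_measurable (restr_algebra S)"
      unfolding m_def
      by (intro borel_measurable_times measurable_F0_F[OF S] weight_meas0[OF S]
          measurable_compose[OF measurable_mask_pattern] borel_measurable_indicator A)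
    note mM[measurable] = measurable_from_subalg[OF subalg_F[OF S] mF]
    have m0: "0 \<le> m x" for x by (simp add: m_def w_nonneg[OF S])
    have m1: "\<bar>m x\<bar> \<le> 1" for x using w_abs[OF S, of x] by (simp add: m_def indicator_def)
    have um[measurable]: "u \<in> borel_measurable (law f)" by simp
    have mi: "integrable (law f) (\<lambda>x. m x * u x)"
      by (rule integrable_const_bound[where B = b])
        (auto simp: abs_mult u0 m0 intro!: AE_I2 order_trans[OF mult_left_le_one_le ub] abs_le_D1[OF m1])
    have "AE x in law f. 0 \<le> proj S u x"
      by (rule FS.real_cond_exp_pos) (simp_all add: u0)
    then have p: "AE x in law f. 0 \<le> m x * proj S u x" by eventually_elim (simp add: m0)
    have "(\<integral>\<^sup>+x. indicator A (mask (x, one_vec S)) * ennreal (weight S x * u x) \<partial>law f)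
        = (\<integral>\<^sup>+x. ennreal (m x * u x) \<partial>law f)"
      by (intro nn_integral_cong) (auto simp: m_def indicator_def)
    also have "\<dots> = ennreal (\<integral>x. m x * u x \<partial>law f)"
      by (rule nn_integral_eq_integral[OF mi]) (simp add: m0 u0)
    also have "(\<integral>x. m x * u x \<partial>law f) = (\<integral>x. m x * proj S u x \<partial>law f)"
      by (rule FS.real_cond_exp_intg(2)[OF mi mF um, symmetric])
    also have "ennreal \<dots> = (\<integral>\<^sup>+x. ennreal (m x * proj S u x) \<partial>law f)"
      by (rule nn_integral_eq_integral[OF FS.real_cond_exp_intg(1)[OF mi mF um] p, symmetric])
    also have "\<dots> = (\<integral>\<^sup>+x. ennreal (proj S u x) * indicator A (mask (x, one_vec S)) * ennreal (weight S x) \<partial>law f)"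
      by (intro nn_integral_cong) (auto simp: m_def indicator_def ennreal_mult' w_nonneg[OF S] mult.commute)
    finally show "(\<integral>\<^sup>+x. indicator A (mask (x, one_vec S)) * ennreal (weight S x * u x) \<partial>law f)
        = (\<integral>\<^sup>+x. ennreal (proj S u x) * indicator A (mask (x, one_vec S)) * ennreal (weight S x) \<partial>law f)" .
  qed
  also have "\<dots> = (\<integral>\<^sup>+z. ennreal (observed_mean u z) * indicator A z \<partial>Q0)"
    by (subst nn_integral_Q0) (simp_all add: observed_mean_mask)
  also have "\<dots> = emeasure (density Q0 (\<lambda>z. ennreal (observed_mean u z))) A"
    by (rule emeasure_density[symmetric]) simp_all
  finally show "emeasure (obs_law (\<lambda>x. u x * f x) K) A = emeasure (density Q0 (\<lambda>z. ennreal (observed_mean u z))) A" .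
qed simp

text \<open>The squared score of the observed data integrates to the Fisher information.\<close>

lemma integral_observed_mean_sq:
  assumes h: "square_integrable (law f) h"
  shows "(\<integral>z. (observed_mean h z)\<^sup>2 \<partial>Q0) = information h"
proof -
  have int: "integrable (law f) (\<lambda>x. weight S x * (proj S h x)\<^sup>2)" if S: "S \<in> patterns" for S
    using integrable_mult_square_integrable[OF square_integrable_w[OF S square_integrable_proj[OF S h]] square_integrable_proj[OF S h]]
    by (simp add: power2_eq_square mult.assoc)
  have "(\<integral>\<^sup>+z. ennreal ((observed_mean h z)\<^sup>2) \<partial>Q0)
      = (\<Sum>S\<in>patterns. \<integral>\<^sup>+x. ennreal (weight S x * (proj S h x)\<^sup>2) \<partial>law f)"
    by (subst nn_integral_Q0) (auto simp: observed_mean_mask ennreal_mult'' mult.commute simp del: insert_iff intro!: sum.cong nn_integral_cong)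
  also have "\<dots> = (\<Sum>S\<in>patterns. ennreal (\<integral>x. weight S x * (proj S h x)\<^sup>2 \<partial>law f))"
    by (intro sum.cong refl nn_integral_eq_integral int) (simp_all add: w_nonneg del: insert_iff)
  also have "\<dots> = ennreal (information h)"
    unfolding information_def by (intro sum_ennreal integral_nonneg_AE) (simp add: w_nonneg del: insert_iff)
  finally have "(\<integral>\<^sup>+z. ennreal ((observed_mean h z)\<^sup>2) \<partial>Q0) = ennreal (information h)" .
  moreover have "0 \<le> information h"
    by (rule information_nonneg)
  ultimately show ?thesis
    by (simp add: integral_eq_nn_integral)
qed

end

section \<open>Local perturbations of the density\<close>

lemma kfun_bounds: "1 / 2 < kfun u" "kfun u < 3 / 2"
proof -
  have "0 < exp (- 4 * u)" by simp
  then have "1 < 1 + exp (- 4 * u)" by simp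
  then have "0 < inverse (1 + exp (- 4 * u))" "inverse (1 + exp (- 4 * u)) < 1"
    by (simp_all add: inverse_less_1_iff add_pos_pos)
  then show "1 / 2 < kfun u" "kfun u < 3 / 2" by (simp_all add: kfun_def)
qed

lemma kfun_meas [measurable]: "kfun \<in> borel_measurable borel"
  unfolding kfun_def[abs_def] by measurable

text \<open>The second-order expansion at zero extends to all \<open>u\<close> because \<open>kfun u - 1 - u\<close> grows at most linearly.\<close>

lemma kfun_expansion:
  obtains C where "0 \<le> C" "\<And>u. \<bar>kfun u - 1 - u\<bar> \<le> C * u\<^sup>2"
proof -
  have "(\<lambda>u. kfun u - 1 - u) \<in> O[at 0](\<lambda>u. u\<^sup>2)"
    unfolding kfun_def by real_asymp
  then obtain C where C: "C > 0" and "eventually (\<lambda>u. norm (kfun u - 1 - u) \<le> C * norm (u\<^sup>2)) (at 0)"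
    by (elim landau_o.bigE)
  then obtain d where d: "d > 0" "\<And>u. u \<noteq> 0 \<Longrightarrow> \<bar>u\<bar> < d \<Longrightarrow> \<bar>kfun u - 1 - u\<bar> \<le> C * u\<^sup>2"
    by (auto simp: eventually_at dist_real_def)
  let ?C = "C + 1 / (2 * d\<^sup>2) + 1 / d"
  have "\<bar>kfun u - 1 - u\<bar> \<le> ?C * u\<^sup>2" for u
  proof (cases "u = 0")
    case True
    then show ?thesis by (simp add: kfun_def)
  next
    case False
    show ?thesis
    proof (cases "\<bar>u\<bar> < d")
      case True
      have "\<bar>kfun u - 1 - u\<bar> \<le> C * u\<^sup>2" by (rule d(2)[OF False True])
      also have "\<dots> \<le> ?C * u\<^sup>2" using d(1) by (intro mult_right_mono) auto
      finally show ?thesis .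
    next
      case False
      then have du: "1 \<le> \<bar>u\<bar> / d" using d(1) by simp
      have "\<bar>kfun u - 1 - u\<bar> \<le> 1 / 2 + \<bar>u\<bar>" using kfun_bounds[of u] by linarith
      also have "\<dots> \<le> (\<bar>u\<bar> / d)\<^sup>2 / 2 + \<bar>u\<bar> * (\<bar>u\<bar> / d)"
      proof (rule add_mono)
        show "1 / 2 \<le> (\<bar>u\<bar> / d)\<^sup>2 / 2" using one_le_power[OF du, of 2] by simp
        show "\<bar>u\<bar> \<le> \<bar>u\<bar> * (\<bar>u\<bar> / d)" using mult_left_mono[OF du, of "\<bar>u\<bar>"] by simp
      qed
      also have "\<dots> = (1 / (2 * d\<^sup>2) + 1 / d) * u\<^sup>2"
        using d(1) by (simp add: power_divide field_simps power2_eq_square flip: abs_mult)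
      also have "\<dots> \<le> ?C * u\<^sup>2" using C by (intro mult_right_mono) auto
      finally show ?thesis .
    qed
  qed
  then show ?thesis using C d(1) by (intro that[of ?C]) auto
qed

lemma root_step_size:
  "real (Suc N) powr (- 1 / 2) = 1 / sqrt (real (Suc N))"
  "0 < real (Suc N) powr (- 1 / 2)" "real (Suc N) powr (- 1 / 2) \<le> 1"
  "(\<lambda>N. real (Suc N) powr (- 1 / 2)) \<longlonglongrightarrow> 0"
proof -
  have e: "x powr (- 1 / 2) = 1 / sqrt x" if "0 \<le> x" for x :: real
    using powr_minus_divide[of x "1 / 2"] powr_half_sqrt[OF that] by simp
  show eN: "real (Suc N) powr (- 1 / 2) = 1 / sqrt (real (Suc N))" by (rule e) simp
  show "0 < real (Suc N) powr (- 1 / 2)" by (simp only: powr_gt_zero of_nat_eq_0_iff)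
  have "1 \<le> sqrt (real (Suc N))" by simp
  then show "real (Suc N) powr (- 1 / 2) \<le> 1" unfolding eN by (simp add: divide_le_eq_1)
  show "(\<lambda>N. real (Suc N) powr (- 1 / 2)) \<longlonglongrightarrow> 0"
    by (rule filterlim_compose[OF tendsto_neg_powr filterlim_compose[OF filterlim_real_sequentially filterlim_Suc]]) (simp_all add: filterlim_ident)
qed

context missing_data begin

lemma integral_law: 
  assumes "u \<in> borel_measurable borel"
  shows "(\<integral>x. u x \<partial>law f) = (\<integral>x. u x * f x \<partial>lborel)"
  using assms unfolding law_def by (subst integral_density) (auto simp: f_nonneg mult.commute)

lemma integrable_law:
  assumes "u \<in> borel_measurable borel"
  shows "integrable (law f) u \<longleftrightarrow> integrable lborel (\<lambda>x. u x * f x)"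
  using assms unfolding law_def by (subst integrable_density) (auto simp: f_nonneg mult.commute)

lemma L2_iff: "u \<in> L2 f \<longleftrightarrow> square_integrable (law f) u"
  by (auto simp: L2_def square_integrable_def integrable_law)

text \<open>The ratio of the perturbed density to \<open>f\<close>.\<close>

definition tilt :: "(real ^ 'n \<Rightarrow> real) \<Rightarrow> real ^ 'n \<Rightarrow> real" where
  "tilt h x = kfun (h x) / expectation (\<lambda>y. kfun (h y))"

lemma kfun_normalization:
  assumes [measurable]: "h \<in> borel_measurable borel"
  shows "integrable (law f) (\<lambda>x. kfun (h x))"
    and "1 / 2 \<le> expectation (\<lambda>y. kfun (h y))" and "expectation (\<lambda>y. kfun (h y)) \<le> 3 / 2"
proof -
  show i: "integrable (law f) (\<lambda>x. kfun (h x))"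
  proof (rule integrable_const_bound[where B = "3 / 2"])
    show "AE x in law f. norm (kfun (h x)) \<le> 3 / 2"
      using kfun_bounds by (intro AE_I2) (simp add: abs_if less_imp_le, smt (verit))
  qed simp
  show "1 / 2 \<le> expectation (\<lambda>y. kfun (h y))"
    by (rule integral_ge_const[OF i AE_I2[OF less_imp_le[OF kfun_bounds(1)]]])
  show "expectation (\<lambda>y. kfun (h y)) \<le> 3 / 2"
    by (rule integral_le_const[OF i AE_I2[OF less_imp_le[OF kfun_bounds(2)]]])
qed

lemma perturb_eq_tilt:
  assumes [measurable]: "h \<in> borel_measurable borel"
  shows "perturb f h = (\<lambda>x. tilt h x * f x)"
  by (auto simp: perturb_def tilt_def integral_law fun_eq_iff)

lemma tilt_meas [measurable]: "h \<in> borel_measurable borel \<Longrightarrow> tilt h \<in> borel_measurable borel"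
  unfolding tilt_def[abs_def]
  by (intro borel_measurable_divide borel_measurable_const measurable_compose[OF _ kfun_meas])

lemma tilt_bounds:
  assumes h: "h \<in> borel_measurable borel"
  shows "1 / 3 \<le> tilt h x" and "tilt h x \<le> 3"
proof -
  note c = kfun_normalization(2,3)[OF h]
  have "1 / 3 * expectation (\<lambda>y. kfun (h y)) \<le> kfun (h x)" using c kfun_bounds[of "h x"] by linarith
  then show "1 / 3 \<le> tilt h x" using c by (simp add: tilt_def field_simps)
  have "kfun (h x) \<le> 3 * expectation (\<lambda>y. kfun (h y))" using c kfun_bounds[of "h x"] by linarith
  then show "tilt h x \<le> 3" using c by (simp add: tilt_def field_simps)
qed

lemma integrable_tilt:
  assumes h[measurable]: "h \<in> borel_measurable borel"
  shows "integrable (law f) (tilt h)" and "expectation (tilt h) = 1"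
  using kfun_normalization[OF h] unfolding tilt_def[abs_def] by auto

lemma prob_density_perturb:
  assumes h[measurable]: "h \<in> borel_measurable borel"
  shows "prob_density (perturb f h)"
  unfolding prob_density_def perturb_eq_tilt[OF h]
proof (intro conjI allI)
  have t0: "0 \<le> tilt h x" for x using tilt_bounds(1)[OF h, of x] by simp
  then show "0 \<le> tilt h x * f x" for x by (simp add: f_nonneg)
  have "(\<integral>\<^sup>+x. ennreal (tilt h x * f x) \<partial>lborel) = (\<integral>\<^sup>+x. ennreal (f x) * ennreal (tilt h x) \<partial>lborel)"
    by (simp add: ennreal_mult t0 f_nonneg mult.commute)
  also have "\<dots> = (\<integral>\<^sup>+x. ennreal (tilt h x) \<partial>law f)"
    unfolding law_def by (rule nn_integral_density[symmetric]) measurable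
  also have "\<dots> = ennreal (expectation (tilt h))"
    by (rule nn_integral_eq_integral[OF integrable_tilt(1)[OF h]]) (simp add: t0)
  finally show "(\<integral>\<^sup>+x. ennreal (tilt h x * f x) \<partial>lborel) = 1" using integrable_tilt(2)[OF h] by simp
qed measurable

text \<open>The normalizing constant is \<open>1 + O(s\<^sup>2)\<close> as well, since \<open>h\<close> has mean zero; therefore the normalization
  does not affect the first-order term. The estimate is uniform in \<open>x\<close> as \<open>h\<close> is bounded.\<close>

lemma tilt_expansion:
  assumes h[measurable]: "h \<in> borel_measurable borel" and hb: "\<And>x. \<bar>h x\<bar> \<le> b" and Eh: "expectation h = 0"
  obtains C where "0 \<le> C" "\<And>s x. 0 \<le> s \<Longrightarrow> s \<le> 1 \<Longrightarrow> \<bar>tilt (\<lambda>x. s * h x) x - 1 - s * h x\<bar> \<le> C * s\<^sup>2"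
proof -
  obtain C where C0: "0 \<le> C" and C: "\<And>u. \<bar>kfun u - 1 - u\<bar> \<le> C * u\<^sup>2" using kfun_expansion by blast
  have b0: "0 \<le> b" using hb[of undefined] by simp
  have ih: "integrable (law f) h" by (rule integrable_const_bound[where B = b]) (simp_all add: hb)
  let ?A = "C * b\<^sup>2"
  have "\<bar>tilt (\<lambda>x. s * h x) x - 1 - s * h x\<bar> \<le> (2 * (2 * ?A + b * ?A)) * s\<^sup>2" if s: "0 \<le> s" "s \<le> 1" for s x
  proof -
    let ?k = "\<lambda>x. kfun (s * h x)"
    let ?c = "expectation ?k"
    have m: "(\<lambda>x. s * h x) \<in> borel_measurable borel" by measurable
    note c = kfun_normalization[OF m]
    have k: "\<bar>?k x - 1 - s * h x\<bar> \<le> ?A * s\<^sup>2" for x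
    proof -
      have "(h x)\<^sup>2 \<le> b\<^sup>2" using hb[of x] by (metis abs_ge_zero power2_abs power_mono)
      then have "C * (s * h x)\<^sup>2 \<le> C * (s\<^sup>2 * b\<^sup>2)"
        using C0 by (auto simp: power_mult_distrib intro!: mult_left_mono)
      with C[of "s * h x"] show ?thesis by (simp add: mult_ac)
    qed
    have "?c - 1 = expectation (\<lambda>x. ?k x - 1 - s * h x)"
      using c(1) ih Eh prob_space by simp
    also have "\<bar>\<dots>\<bar> \<le> expectation (\<lambda>x. \<bar>?k x - 1 - s * h x\<bar>)" by (rule integral_abs_bound)
    also have "\<dots> \<le> ?A * s\<^sup>2"
      using c(1) ih k by (intro integral_le_const) auto
    finally have c1: "\<bar>?c - 1\<bar> \<le> ?A * s\<^sup>2" .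
    have "\<bar>s * h x * (?c - 1)\<bar> \<le> b * (?A * s\<^sup>2)"
      unfolding abs_mult[of "s * h x"] using s hb[of x] c1 b0
      by (intro mult_mono) (auto simp: abs_mult intro: order_trans[OF mult_left_le_one_le])
    moreover have "tilt (\<lambda>x. s * h x) x - 1 - s * h x = ((?k x - 1 - s * h x) - (?c - 1) - s * h x * (?c - 1)) / ?c"
      using c(2) by (simp add: tilt_def field_simps)
    ultimately have "\<bar>tilt (\<lambda>x. s * h x) x - 1 - s * h x\<bar> \<le> (?A * s\<^sup>2 + ?A * s\<^sup>2 + b * (?A * s\<^sup>2)) / ?c"
      using k[of x] c1 c(2) by (simp add: divide_right_mono abs_divide) 
    also have "\<dots> \<le> (?A * s\<^sup>2 + ?A * s\<^sup>2 + b * (?A * s\<^sup>2)) / (1 / 2)"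
      using c(2) C0 b0 by (intro divide_left_mono) auto
    also have "\<dots> = (2 * (2 * ?A + b * ?A)) * s\<^sup>2" by (simp add: algebra_simps)
    finally show ?thesis .
  qed
  then show ?thesis using C0 b0 by (intro that[of "2 * (2 * ?A + b * ?A)"]) auto
qed

text \<open>The values of \<open>kfun\<close> lie between \<open>1/2\<close> and \<open>3/2\<close>, so the tilt lies between \<open>1/3\<close> and \<open>3\<close> and so does its
  conditional expectation, almost everywhere. Clamping makes these bounds hold at every point, which
  removes all null sets from the product densities.\<close>

definition obs_density :: "(real ^ 'n \<Rightarrow> real) \<Rightarrow> ('n \<Rightarrow> real option) \<Rightarrow> real" where
  "obs_density h z = max (1 / 3) (min 3 (observed_mean (tilt h) z))"

lemma obs_density_meas [measurable]: "obs_density h \<in> borel_measurable obs_space"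
  unfolding obs_density_def[abs_def] by measurable

lemma obs_density_bounds: "1 / 3 \<le> obs_density h z" "obs_density h z \<le> 3"
  by (auto simp: obs_density_def)

lemma obs_density_AE:
  assumes h[measurable]: "h \<in> borel_measurable borel"
  shows "AE z in Q0. obs_density h z = observed_mean (tilt h) z"
proof (rule AE_Q0I)
  fix S assume S: "S \<in> patterns"
  interpret FS: finite_measure_subalgebra "law f" "restr_algebra S" by (rule subalg_cond_exp[OF S])
  have "AE x in law f. 1 / 3 \<le> proj S (tilt h) x"
    by (rule FS.real_cond_exp_ge_c[OF integrable_tilt(1)[OF h] AE_I2[OF tilt_bounds(1)[OF h]]])
  moreover have "AE x in law f. proj S (tilt h) x \<le> 3"
    by (rule FS.real_cond_exp_le_c[OF integrable_tilt(1)[OF h] AE_I2[OF tilt_bounds(2)[OF h]]])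
  ultimately show "AE x in law f. obs_density h (mask (x, one_vec S)) = observed_mean (tilt h) (mask (x, one_vec S))"
    by eventually_elim (simp add: obs_density_def observed_mean_mask)
qed (unfold pred_def, intro borel_measurable_eq obs_density_meas observed_mean_meas)

lemma obs_law_perturb:
  assumes h[measurable]: "h \<in> borel_measurable borel"
  shows "obs_law (perturb f h) K = density Q0 (\<lambda>z. ennreal (obs_density h z))"
proof -
  have t0: "0 \<le> tilt h x" for x using tilt_bounds(1)[OF h, of x] by simp
  have "obs_law (perturb f h) K = density Q0 (\<lambda>z. ennreal (observed_mean (tilt h) z))"
    unfolding perturb_eq_tilt[OF h] by (rule obs_law_tilted[OF tilt_meas[OF h] t0 tilt_bounds(2)[OF h]])
  also have "\<dots> = density Q0 (\<lambda>z. ennreal (obs_density h z))"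
    by (rule density_cong) (use obs_density_AE[OF h] in auto)
  finally show ?thesis .
qed

lemma Q0_prob: "prob_space Q0" by (rule prob_space_obs_law[OF density_f])

lemma integral_obs_density:
  assumes h[measurable]: "h \<in> borel_measurable borel"
  shows "(\<integral>z. obs_density h z \<partial>Q0) = 1"
proof -
  interpret P: prob_space "obs_law (perturb f h) K" by (rule prob_space_obs_law[OF prob_density_perturb[OF h]])
  have p: "0 \<le> obs_density h z" for z using obs_density_bounds(1)[of h z] by simp
  have "(\<integral>\<^sup>+z. ennreal (obs_density h z) \<partial>Q0) = emeasure (obs_law (perturb f h) K) (space (obs_law (perturb f h) K))"
    unfolding obs_law_perturb[OF h] space_density
    by (subst emeasure_density[OF _ sets.top]) (simp_all cong: nn_integral_cong)
  then have "(\<integral>\<^sup>+z. ennreal (obs_density h z) \<partial>Q0) = 1" by (simp only: P.emeasure_space_1)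
  then show ?thesis by (simp add: integral_eq_nn_integral p)
qed

text \<open>The expansion of the tilt passes to the observed data since conditional expectation is linear and
  preserves uniform bounds.\<close>

lemma obs_density_expansion:
  assumes h[measurable]: "h \<in> borel_measurable borel" and hb: "\<And>x. \<bar>h x\<bar> \<le> b" and Eh: "expectation h = 0"
  obtains C where "\<And>s. 0 \<le> s \<Longrightarrow> s \<le> 1 \<Longrightarrow>
    AE z in Q0. \<bar>obs_density (\<lambda>x. s * (t * h x)) z - 1 - s * (t * observed_mean h z)\<bar> \<le> C * s\<^sup>2"
proof -
  let ?h = "\<lambda>x. t * h x"
  have hm[measurable]: "?h \<in> borel_measurable borel" by measurable
  have ih: "integrable (law f) h" by (rule integrable_const_bound[where B = b]) (simp_all add: hb)
  have hb': "\<bar>?h x\<bar> \<le> \<bar>t\<bar> * b" for x using hb[of x] by (simp add: abs_mult mult_left_mono)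
  have Eh': "expectation ?h = 0" using Eh by simp
  obtain C where C0: "0 \<le> C"
    and C: "\<And>s x. 0 \<le> s \<Longrightarrow> s \<le> 1 \<Longrightarrow> \<bar>tilt (\<lambda>x. s * ?h x) x - 1 - s * ?h x\<bar> \<le> C * s\<^sup>2"
    using tilt_expansion[OF hm hb' Eh'] by blast
  have "AE z in Q0. \<bar>obs_density (\<lambda>x. s * ?h x) z - 1 - s * (t * observed_mean h z)\<bar> \<le> C * s\<^sup>2"
    if s: "0 \<le> s" "s \<le> 1" for s
  proof -
    let ?t = "tilt (\<lambda>x. s * ?h x)"
    have m: "(\<lambda>x. s * ?h x) \<in> borel_measurable borel" by measurable
    have "AE z in Q0. \<bar>observed_mean ?t z - 1 - s * (t * observed_mean h z)\<bar> \<le> C * s\<^sup>2"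
    proof (rule AE_Q0I)
      fix S assume S: "S \<in> patterns"
      interpret FS: finite_measure_subalgebra "law f" "restr_algebra S" by (rule subalg_cond_exp[OF S])
      define v where "v = (\<lambda>x. ?t x - (1 + (s * t) * h x))"
      have vb: "\<bar>v x\<bar> \<le> C * s\<^sup>2" for x using C[OF s, of x] by (simp add: v_def algebra_simps)
      have it: "integrable (law f) ?t" by (rule integrable_tilt(1)[OF m])
      have i2: "integrable (law f) (\<lambda>x. (s * t) * h x)" using ih by simp
      have i1: "integrable (law f) (\<lambda>x. 1 + (s * t) * h x)" using ih by simp
      have iv: "integrable (law f) v" unfolding v_def by (intro Bochner_Integration.integrable_diff it i1)
      have "AE x in law f. proj S v x = proj S ?t x - proj S (\<lambda>x. 1 + (s * t) * h x) x"
        unfolding v_def by (rule FS.real_cond_exp_diff[OF it i1])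
      moreover have "AE x in law f. proj S (\<lambda>x. 1 + (s * t) * h x) x = proj S (\<lambda>_. 1) x + proj S (\<lambda>x. (s * t) * h x) x"
        by (rule FS.real_cond_exp_add[OF _ i2]) simp
      moreover have "AE x in law f. proj S (\<lambda>_. 1) x = 1"
        by (rule FS.real_cond_exp_F_meas) simp_all
      moreover have "AE x in law f. proj S (\<lambda>x. (s * t) * h x) x = (s * t) * proj S h x"
        by (rule FS.real_cond_exp_cmult[OF ih])
      moreover have "AE x in law f. - (C * s\<^sup>2) \<le> proj S v x"
        by (rule FS.real_cond_exp_ge_c[OF iv]) (rule AE_I2, use vb in \<open>simp add: abs_le_iff minus_le_iff\<close>)
      moreover have "AE x in law f. proj S v x \<le> C * s\<^sup>2"
        by (rule FS.real_cond_exp_le_c[OF iv]) (rule AE_I2, use vb in \<open>simp add: abs_le_iff\<close>)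
      ultimately show "AE x in law f. \<bar>observed_mean ?t (mask (x, one_vec S)) - 1
          - s * (t * observed_mean h (mask (x, one_vec S)))\<bar> \<le> C * s\<^sup>2"
      proof eventually_elim
        case (elim x)
        then have "observed_mean ?t (mask (x, one_vec S)) - 1 - s * (t * observed_mean h (mask (x, one_vec S))) = proj S v x"
          by (simp add: observed_mean_mask)
        with elim show ?case by (simp add: abs_le_iff)
      qed
    qed measurable
    with obs_density_AE[OF m] show ?thesis by eventually_elim simp
  qed
  then show ?thesis by (rule that)
qed

lemma observed_mean_bounded:
  assumes h[measurable]: "h \<in> borel_measurable borel" and hb: "\<And>x. \<bar>h x\<bar> \<le> b"
  shows "AE z in Q0. \<bar>observed_mean h z\<bar> \<le> b"
proof (rule AE_Q0I)
  fix S assume S: "S \<in> patterns"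
  interpret FS: finite_measure_subalgebra "law f" "restr_algebra S" by (rule subalg_cond_exp[OF S])
  have ih: "integrable (law f) h" by (rule integrable_const_bound[where B = b]) (simp_all add: hb)
  have "AE x in law f. - b \<le> proj S h x"
    by (rule FS.real_cond_exp_ge_c[OF ih]) (rule AE_I2, use hb in \<open>simp add: abs_le_iff minus_le_iff\<close>)
  moreover have "AE x in law f. proj S h x \<le> b"
    by (rule FS.real_cond_exp_le_c[OF ih]) (rule AE_I2, use hb in \<open>simp add: abs_le_iff\<close>)
  ultimately show "AE x in law f. \<bar>observed_mean h (mask (x, one_vec S))\<bar> \<le> b"
    by eventually_elim (simp add: observed_mean_mask abs_le_iff)
qed measurable

text \<open>The derivative of the functional: \<open>\<theta>\<close> of the perturbed density is the expectation of \<open>a\<close> times the tilt,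
  and the error in the tilt is uniform while \<open>a\<close> is integrable.\<close>

lemma theta_limit:
  assumes a: "square_integrable (law f) a"
    and h[measurable]: "h \<in> borel_measurable borel" and hb: "\<And>x. \<bar>h x\<bar> \<le> b" and Eh: "expectation h = 0"
    and s: "\<And>N. 0 < s N" "\<And>N. s N \<le> 1" "s \<longlonglongrightarrow> 0"
  shows "(\<lambda>N. (theta a (perturb f (\<lambda>x. s N * (t * h x))) - expectation a) / s N) \<longlonglongrightarrow> t * expectation (\<lambda>x. a x * h x)"
proof -
  let ?h = "\<lambda>x. t * h x"
  have hm[measurable]: "?h \<in> borel_measurable borel" by measurable
  have am[measurable]: "a \<in> borel_measurable borel" using square_integrableD(1)[OF a] by simp
  have hb': "\<bar>?h x\<bar> \<le> \<bar>t\<bar> * b" for x using hb[of x] by (simp add: abs_mult mult_left_mono)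
  have Eh': "expectation ?h = 0" using Eh by simp
  obtain C where C0: "0 \<le> C"
    and C: "\<And>s x. 0 \<le> s \<Longrightarrow> s \<le> 1 \<Longrightarrow> \<bar>tilt (\<lambda>x. s * ?h x) x - 1 - s * ?h x\<bar> \<le> C * s\<^sup>2"
    using tilt_expansion[OF hm hb' Eh'] by blast
  have ia: "integrable (law f) a" by (rule integrable_square_integrable[OF a])
  have iah: "integrable (law f) (\<lambda>x. a x * h x)"
    by (rule integrable_mult_square_integrable[OF a square_integrable_bounded[where b = b]]) (simp_all add: hb)
  have bound: "\<bar>(theta a (perturb f (\<lambda>x. s N * ?h x)) - expectation a) / s N - t * expectation (\<lambda>x. a x * h x)\<bar>
      \<le> (C * expectation (\<lambda>x. \<bar>a x\<bar>)) * s N" for N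
  proof -
    let ?t = "tilt (\<lambda>x. s N * ?h x)"
    have m[measurable]: "(\<lambda>x. s N * ?h x) \<in> borel_measurable borel" by measurable
    have "theta a (perturb f (\<lambda>x. s N * ?h x)) = (\<integral>x. a x * ?t x * f x \<partial>lborel)"
      by (simp add: theta_def perturb_eq_tilt[OF m] mult.assoc)
    also have "\<dots> = expectation (\<lambda>x. a x * ?t x)"
      by (rule integral_law[symmetric]) measurable
    finally have th: "theta a (perturb f (\<lambda>x. s N * ?h x)) = expectation (\<lambda>x. a x * ?t x)" .
    have iat: "integrable (law f) (\<lambda>x. a x * ?t x)"
    proof (rule Bochner_Integration.integrable_bound)
      show "integrable (law f) (\<lambda>x. 3 * a x)" using ia by simp
      have "norm (a x * ?t x) \<le> norm (3 * a x)" for x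
      proof -
        have "\<bar>?t x\<bar> \<le> 3" using tilt_bounds[OF m, of x] by simp
        then have "\<bar>a x\<bar> * \<bar>?t x\<bar> \<le> \<bar>a x\<bar> * 3" by (rule mult_left_mono) simp
        then show ?thesis by (simp add: abs_mult)
      qed
      then show "AE x in law f. norm (a x * ?t x) \<le> norm (3 * a x)" by simp
    qed measurable
    have "theta a (perturb f (\<lambda>x. s N * ?h x)) - expectation a - s N * (t * expectation (\<lambda>x. a x * h x))
        = expectation (\<lambda>x. a x * ?t x - a x - (s N * t) * (a x * h x))"
      unfolding th using iat ia iah by simp
    then have "\<bar>theta a (perturb f (\<lambda>x. s N * ?h x)) - expectation a - s N * (t * expectation (\<lambda>x. a x * h x))\<bar>
        \<le> expectation (\<lambda>x. \<bar>a x * ?t x - a x - (s N * t) * (a x * h x)\<bar>)"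
      by (simp only: integral_abs_bound)
    also have "\<dots> \<le> expectation (\<lambda>x. \<bar>a x\<bar> * (C * (s N)\<^sup>2))"
    proof (rule integral_mono)
      fix x
      have "a x * ?t x - a x - (s N * t) * (a x * h x) = a x * (?t x - 1 - s N * ?h x)" by (simp add: algebra_simps)
      then show "\<bar>a x * ?t x - a x - (s N * t) * (a x * h x)\<bar> \<le> \<bar>a x\<bar> * (C * (s N)\<^sup>2)"
        using C[of "s N" x] s(1,2)[of N] by (simp add: abs_mult mult_left_mono)
    qed (use iat ia iah in simp_all)
    also have "\<dots> = (C * expectation (\<lambda>x. \<bar>a x\<bar>)) * (s N)\<^sup>2" by simp
    finally have "\<bar>theta a (perturb f (\<lambda>x. s N * ?h x)) - expectation a - s N * (t * expectation (\<lambda>x. a x * h x))\<bar> / s N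
        \<le> (C * expectation (\<lambda>x. \<bar>a x\<bar>)) * (s N)\<^sup>2 / s N" using s(1)[of N] by (intro divide_right_mono) auto
    moreover have "(theta a (perturb f (\<lambda>x. s N * ?h x)) - expectation a) / s N - t * expectation (\<lambda>x. a x * h x)
        = (theta a (perturb f (\<lambda>x. s N * ?h x)) - expectation a - s N * (t * expectation (\<lambda>x. a x * h x))) / s N"
      using s(1)[of N] by (simp add: field_simps)
    ultimately show ?thesis using s(1)[of N] by (simp add: abs_divide power2_eq_square)
  qed
  show ?thesis
  proof (rule LIM_zero_cancel, rule Lim_null_comparison)
    show "(\<lambda>N. (C * expectation (\<lambda>x. \<bar>a x\<bar>)) * s N) \<longlonglongrightarrow> 0" using tendsto_mult[OF tendsto_const s(3)] by simp
  qed (use bound in auto)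
qed

end

section \<open>The local minimax bound\<close>

context missing_data begin

text \<open>The bound of Cramer-Rao type for one direction. The risk is below \<open>\<rho>\<close> for infinitely many \<open>N\<close> at all
  points of the grid \<open>i \<delta> h\<close>, whereas the bounds on the chi-square divergences hold for all large \<open>N\<close>.
  So the chain inequality holds infinitely often, which suffices in the limit because its left-hand
  side converges.\<close>

lemma linear_functional_le_risk:
  assumes a: "square_integrable (law f) a"
    and T: "\<And>N. T N \<in> borel_measurable (sample_space N)"
    and B: "0 \<le> B"
    and risk: "\<And>I. finite I \<Longrightarrow> I \<subseteq> L2 f \<Longrightarrow> liminf (\<lambda>N. SUP h\<in>I.
            scaled_risk a K N (T N) (perturb f (\<lambda>x. real N powr (- 1 / 2) * h x))) \<le> ennreal B"
    and h[measurable]: "h \<in> borel_measurable borel" and hb: "\<And>x. \<bar>h x\<bar> \<le> b" and Eh: "expectation h = 0"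
  shows "expectation (\<lambda>x. a x * h x) \<le> sqrt B * sqrt (information h)"
proof (rule slope_le_of_chain_bounds[OF _ B])
  interpret Q: prob_space Q0 by (rule Q0_prob)
  let ?J = "information h" and ?A = "expectation (\<lambda>x. a x * h x)"
  \<comment> \<open>Sample sizes are shifted by one: for \<open>N = 0\<close> the step \<open>N powr (- 1 / 2)\<close> is zero by convention.\<close>
  let ?s = "\<lambda>N. real (Suc N) powr (- 1 / 2)"
  have sh: "square_integrable (law f) h" by (rule square_integrable_bounded[where b = b]) (simp_all add: hb)
  show "0 \<le> ?J"
    by (rule information_nonneg)
  fix n :: nat and \<delta> \<rho> :: real
  assume d: "0 < \<delta>" "\<delta> < 1" and r: "B < \<rho>"
  define y where "y = \<delta>\<^sup>2 * ?J + \<delta> ^ 3"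
  define q where "q = (\<lambda>N i. obs_density (\<lambda>x. ?s N * ((real i * \<delta>) * h x)))"
  define \<tau> where "\<tau> = (\<lambda>N i. theta a (perturb f (\<lambda>x. ?s N * ((real i * \<delta>) * h x))))"
  define D where "D = (\<lambda>i x. (real i * \<delta>) * h x) ` {..n}"
  let ?R = "\<lambda>N. SUP h\<in>D. scaled_risk a K N (T N) (perturb f (\<lambda>x. real N powr (- 1 / 2) * h x))"
  have qm: "q N i \<in> borel_measurable obs_space" for N i unfolding q_def by measurable
  have q1: "Q.expectation (q N i) = 1" for N i
    unfolding q_def by (rule integral_obs_density) measurable

  have "D \<subseteq> L2 f" unfolding D_def L2_iff by (auto simp: L2_iff intro!: square_integrable_cmult[OF sh])
  moreover have "finite D" unfolding D_def by simp
  ultimately have "liminf ?R \<le> ennreal B" by (intro risk)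
  also have "\<dots> < ennreal \<rho>" using B r by (intro ennreal_lessI) auto
  finally have "liminf ?R < ennreal \<rho>" .
  then have "frequently (\<lambda>N. ?R N < ennreal \<rho>) sequentially"
    unfolding frequently_def not_less
    using Liminf_bounded[of "ennreal \<rho>" ?R sequentially] leD by blast
  then have freq: "frequently (\<lambda>N. ?R (Suc N) < ennreal \<rho>) sequentially"
    unfolding frequently_def eventually_sequentially_Suc[of "\<lambda>N. \<not> ?R N < ennreal \<rho>"] .

  have "eventually (\<lambda>N. \<forall>i\<in>{..<n}. Q.expectation (\<lambda>z. (q N (Suc i) z)\<^sup>2 / q N i z) \<le> 1 + y / real (Suc N)) sequentially"
  proof (intro eventually_ball_finite ballI)
    fix i assume "i \<in> {..<n}"
    obtain C where C: "\<And>s. 0 \<le> s \<Longrightarrow> s \<le> 1 \<Longrightarrow> AE z in Q0.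
        \<bar>obs_density (\<lambda>x. s * ((real i * \<delta>) * h x)) z - 1 - s * ((real i * \<delta>) * observed_mean h z)\<bar> \<le> C * s\<^sup>2"
      using obs_density_expansion[OF h hb Eh, of "real i * \<delta>"] by blast
    obtain C' where C': "\<And>s. 0 \<le> s \<Longrightarrow> s \<le> 1 \<Longrightarrow> AE z in Q0.
        \<bar>obs_density (\<lambda>x. s * ((real (Suc i) * \<delta>) * h x)) z - 1 - s * ((real (Suc i) * \<delta>) * observed_mean h z)\<bar> \<le> C' * s\<^sup>2"
      using obs_density_expansion[OF h hb Eh, of "real (Suc i) * \<delta>"] by blast
    have "(\<lambda>N. (Q.expectation (\<lambda>z. (q N (Suc i) z)\<^sup>2 / q N i z) - 1) / (?s N)\<^sup>2)
        \<longlonglongrightarrow> (real (Suc i) * \<delta> - real i * \<delta>)\<^sup>2 * Q.expectation (\<lambda>z. (observed_mean h z)\<^sup>2)"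
    proof (rule Q.chi_square_limit[OF root_step_size(2,3,4)])
      show "0 < (1 / 3 :: real)" by simp
      show "q N i z \<le> 3" "1 / 3 \<le> q N i z" for N z unfolding q_def by (rule obs_density_bounds)+
      show "\<bar>q N (Suc i) z\<bar> \<le> 3" for N z
        unfolding q_def using obs_density_bounds[of "\<lambda>x. ?s N * ((real (Suc i) * \<delta>) * h x)" z] by linarith
      show "AE z in Q0. \<bar>q N i z - 1 - ?s N * ((real i * \<delta>) * observed_mean h z)\<bar> \<le> C * (?s N)\<^sup>2" for N
        unfolding q_def by (rule C) (use root_step_size(2,3)[of N] in linarith)+
      show "AE z in Q0. \<bar>q N (Suc i) z - 1 - ?s N * ((real (Suc i) * \<delta>) * observed_mean h z)\<bar> \<le> C' * (?s N)\<^sup>2" for N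
        unfolding q_def by (rule C') (use root_step_size(2,3)[of N] in linarith)+
      show "AE z in Q0. \<bar>observed_mean h z\<bar> \<le> b" by (rule observed_mean_bounded[OF h hb])
    qed (use qm q1 in simp_all)
    also have "(real (Suc i) * \<delta> - real i * \<delta>)\<^sup>2 * Q.expectation (\<lambda>z. (observed_mean h z)\<^sup>2) = \<delta>\<^sup>2 * ?J"
      by (simp add: integral_observed_mean_sq[OF sh] algebra_simps)
    finally have lim: "(\<lambda>N. (Q.expectation (\<lambda>z. (q N (Suc i) z)\<^sup>2 / q N i z) - 1) / (?s N)\<^sup>2) \<longlonglongrightarrow> \<delta>\<^sup>2 * ?J" .
    \<comment> \<open>The margin \<open>\<delta> ^ 3\<close> makes the inequality strict, hence stable under the limit.\<close>
    have "\<delta>\<^sup>2 * ?J < y" unfolding y_def using d by simp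
    then have "eventually (\<lambda>N. (Q.expectation (\<lambda>z. (q N (Suc i) z)\<^sup>2 / q N i z) - 1) / (?s N)\<^sup>2 < y) sequentially"
      by (rule order_tendstoD(2)[OF lim])
    then show "eventually (\<lambda>N. Q.expectation (\<lambda>z. (q N (Suc i) z)\<^sup>2 / q N i z) \<le> 1 + y / real (Suc N)) sequentially"
    proof eventually_elim
      case (elim N)
      have "(?s N)\<^sup>2 = 1 / real (Suc N)" unfolding root_step_size(1) by (simp add: power_divide)
      with elim have "(Q.expectation (\<lambda>z. (q N (Suc i) z)\<^sup>2 / q N i z) - 1) * real (Suc N) < y" by simp
      then have "Q.expectation (\<lambda>z. (q N (Suc i) z)\<^sup>2 / q N i z) - 1 < y / real (Suc N)"
        by (simp only: pos_less_divide_eq[OF of_nat_0_less_iff[THEN iffD2, OF zero_less_Suc]])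
      then show ?case by linarith
    qed
  qed simp
  with freq have freq2: "frequently (\<lambda>N. ?R (Suc N) < ennreal \<rho> \<and>
      (\<forall>i\<in>{..<n}. Q.expectation (\<lambda>z. (q N (Suc i) z)\<^sup>2 / q N i z) \<le> 1 + y / real (Suc N))) sequentially"
    by (rule frequently_eventually_frequently)

  let ?rhs = "sqrt \<rho> * (2 + real n * sqrt (exp y - 1))"
  have step: "sqrt (real (Suc N)) * (\<tau> N n - \<tau> N 0) \<le> ?rhs"
    if R: "?R (Suc N) < ennreal \<rho>"
      and chi: "\<forall>i\<in>{..<n}. Q.expectation (\<lambda>z. (q N (Suc i) z)\<^sup>2 / q N i z) \<le> 1 + y / real (Suc N)" for N
  proof (rule Q.sample_chain_lower_bound)
    show "q N i \<in> borel_measurable Q0" for i using qm by simp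
    show "0 < (1 / 3 :: real)" by simp
    show "q N i z \<le> 3" "1 / 3 \<le> q N i z" for i z unfolding q_def by (rule obs_density_bounds)+
    show "Q.expectation (q N i) = 1" for i by (rule q1)
    have "sets (\<Pi>\<^sub>M k\<in>{..<Suc N}. Q0) = sets (sample_space (Suc N))"
      unfolding sample_space_def by (rule sets_PiM_cong) simp_all
    then show "T (Suc N) \<in> borel_measurable (\<Pi>\<^sub>M k\<in>{..<Suc N}. Q0)"
      using T[of "Suc N"] measurable_cong_sets by blast
    show "0 \<le> \<rho>" using B r by simp
    show "Q.expectation (\<lambda>z. (q N (Suc i) z)\<^sup>2 / q N i z) \<le> 1 + y / real (Suc N)" if "i < n" for i
      using chi that by simp
    fix i assume i: "i \<le> n"
    let ?d = "\<lambda>x. (real i * \<delta>) * h x"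
    have "?d \<in> D" unfolding D_def using i by auto
    then have "scaled_risk a K (Suc N) (T (Suc N)) (perturb f (\<lambda>x. ?s N * ?d x)) \<le> ?R (Suc N)"
      by (rule SUP_upper2) simp
    then have "scaled_risk a K (Suc N) (T (Suc N)) (perturb f (\<lambda>x. ?s N * ?d x)) \<le> ennreal \<rho>"
      using R by simp
    moreover have "sample_law (Suc N) (perturb f (\<lambda>x. ?s N * ?d x)) K
        = (\<Pi>\<^sub>M k\<in>{..<Suc N}. density Q0 (\<lambda>z. ennreal (q N i z)))"
      unfolding sample_law_def q_def by (subst obs_law_perturb) simp_all
    ultimately show "(\<integral>\<^sup>+z. ennreal (real (Suc N) * (T (Suc N) z - \<tau> N i)\<^sup>2)
        \<partial>(\<Pi>\<^sub>M k\<in>{..<Suc N}. density Q0 (\<lambda>z. ennreal (q N i z)))) \<le> ennreal \<rho>"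
      by (simp only: scaled_risk_def \<tau>_def)
  qed simp

  have lim: "(\<lambda>N. (\<tau> N i - expectation a) / ?s N) \<longlonglongrightarrow> (real i * \<delta>) * ?A" for i
    unfolding \<tau>_def by (rule theta_limit[OF a h hb Eh root_step_size(2,3,4)])
  have "(\<lambda>N. (\<tau> N n - expectation a) / ?s N - (\<tau> N 0 - expectation a) / ?s N) \<longlonglongrightarrow> (real n * \<delta>) * ?A - (real 0 * \<delta>) * ?A"
    by (intro tendsto_diff lim)
  moreover have "(\<tau> N n - expectation a) / ?s N - (\<tau> N 0 - expectation a) / ?s N = sqrt (real (Suc N)) * (\<tau> N n - \<tau> N 0)" for N
    unfolding root_step_size(1) by (simp add: algebra_simps)
  ultimately have lim2: "(\<lambda>N. sqrt (real (Suc N)) * (\<tau> N n - \<tau> N 0)) \<longlonglongrightarrow> real n * \<delta> * ?A" by simp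
  show "real n * \<delta> * ?A \<le> sqrt \<rho> * (2 + real n * sqrt (exp (\<delta>\<^sup>2 * ?J + \<delta> ^ 3) - 1))"
  proof (rule ccontr)
    assume "\<not> ?thesis"
    then have "?rhs < real n * \<delta> * ?A" unfolding y_def by simp
    then have "eventually (\<lambda>N. ?rhs < sqrt (real (Suc N)) * (\<tau> N n - \<tau> N 0)) sequentially"
      by (rule order_tendstoD(1)[OF lim2])
    from frequently_ex[OF frequently_eventually_frequently[OF freq2 this]] step show False
      by (meson not_less)
  qed
qed

text \<open>Membership rests on \<open>S0 \<subseteq> S\<close>: the weight is a function of \<open>x\<^sub>S\<close>, and the conditional expectation given
  \<open>X\<^bsub>S0\<^esub>\<close> is the weight times that of \<open>g\<close>, by the tower property.\<close>

lemma weighted_proj_in_H: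
  assumes S: "S \<in> patterns" and g: "square_integrable (law f) g" and g0: "AE x in law f. proj0 g x = 0"
  shows "(\<lambda>x. weight S x * proj S g x) \<in> H f S0 S"
proof -
  interpret F0: finite_measure_subalgebra "law f" "restr_algebra S0" by (rule subalg_cond_exp0)
  let ?\<alpha> = "\<lambda>x. weight S x * proj S g x"
  have s: "square_integrable (law f) ?\<alpha>" by (rule square_integrable_w[OF S square_integrable_proj[OF S g]])
  have F: "?\<alpha> \<in> borel_measurable (restr_algebra S)"
    by (rule borel_measurable_times[OF measurable_F0_F[OF S weight_meas0[OF S]] borel_measurable_cond_exp])
  have sw: "square_integrable (law f) (weight S)"
    by (rule square_integrable_bounded[OF w_meas[OF S], where b = 1]) (simp add: w_abs[OF S])
  have "expectation ?\<alpha> = expectation (\<lambda>x. weight S x * g x)"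
    by (rule proj_adjoint[OF S measurable_F0_F[OF S weight_meas0[OF S]] sw g])
  also have "\<dots> = 0" by (rule proj0_orthogonal[OF weight_meas0[OF S] sw g g0])
  finally have E: "(\<integral>x. ?\<alpha> x * f x \<partial>lborel) = 0"
    by (subst integral_law[symmetric]) (use square_integrableD(1)[OF s] in simp_all)
  have "AE x in law f. proj0 ?\<alpha> x = weight S x * proj0 (proj S g) x"
    by (rule F0.real_cond_exp_mult[OF weight_meas0[OF S] square_integrableD(1)[OF square_integrable_proj[OF S g]]
        integrable_square_integrable[OF s]])
  moreover have "AE x in law f. proj0 (proj S g) x = proj0 g x"
    by (rule F0.real_cond_exp_nested_subalg[OF subalg_F[OF S] subalg_F0[OF S] integrable_square_integrable[OF g]])
  ultimately have "AE x in law f. cond_given f S0 ?\<alpha> x = 0"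
    unfolding cond_given_def using g0 by eventually_elim simp
  moreover have "\<forall>x y. restr S x = restr S y \<longrightarrow> ?\<alpha> x = ?\<alpha> y"
    by (intro allI impI restr_algebra_function_eq[OF F])
  ultimately show ?thesis
    unfolding H_def mem_Collect_eq L2_iff by (intro conjI s E)
qed

lemma Lfun_nonneg: "0 \<le> Lfun f a S0 (incomplete_patterns f K) \<alpha> M"
  unfolding Lfun_def weight_def[symmetric]
  by (intro integral_nonneg_AE AE_I2 add_nonneg_nonneg mult_nonneg_nonneg sum_nonneg
      divide_nonneg_nonneg zero_le_power2 zero_le_one w_nonneg insertI1 insertI2)

text \<open>An almost least favourable direction \<open>h\<close> comes from \<open>approximate_solution\<close>; its bounded approximation
  \<open>k\<close> satisfies \<open>2 E[a k] - information k \<le> B\<close> by the risk bound and the inequality between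
  arithmetic and geometric mean. The two approximations share the error \<open>e\<close> equally.\<close>

lemma minimax_bound_le:
  assumes a: "square_integrable (law f) a"
    and T: "\<And>N. T N \<in> borel_measurable (sample_space N)"
    and B: "0 \<le> B"
    and risk: "\<And>I. finite I \<Longrightarrow> I \<subseteq> L2 f \<Longrightarrow> liminf (\<lambda>N. SUP h\<in>I.
            scaled_risk a K N (T N) (perturb f (\<lambda>x. real N powr (- 1 / 2) * h x))) \<le> ennreal B"
  shows "variance (cond_given f S0 a)
      + (INF \<alpha>\<in>(\<Pi>\<^sub>E S\<in>incomplete_patterns f K. H f S0 S). Lfun f a S0 (incomplete_patterns f K) \<alpha> M) \<le> B"
proof (rule field_le_epsilon)
  fix e :: real assume e: "0 < e"
  interpret F0: finite_measure_subalgebra "law f" "restr_algebra S0" by (rule subalg_cond_exp0)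
  let ?SS = "incomplete_patterns f K"
  have U: "UNIV \<notin> ?SS" by (simp add: incomplete_patterns_def)
  have int: "integrable (law f) a" by (rule integrable_square_integrable[OF a])
  have sa0: "square_integrable (law f) (proj0 a)" by (rule square_integrable_proj0[OF a])
  have "AE x in law f. proj0 (\<lambda>x. a x - proj0 a x) x = proj0 a x - proj0 (proj0 a) x"
    by (intro F0.real_cond_exp_diff int integrable_square_integrable[OF sa0])
  moreover have "AE x in law f. proj0 (proj0 a) x = proj0 a x"
    by (intro F0.real_cond_exp_F_meas integrable_square_integrable[OF sa0]) simp
  ultimately have b0: "AE x in law f. proj0 (\<lambda>x. a x - proj0 a x) x = 0" by eventually_elim simp
  \<comment> \<open>The residual enters the final estimate divided by \<open>c\<close>.\<close>
  have "0 < e / 2 * c" using e c_pos by simp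
  from approximate_solution[OF square_integrable_diff[OF a sa0] b0 this]
  obtain g r where g: "square_integrable (law f) g" and r: "square_integrable (law f) r"
    and g0: "AE x in law f. proj0 g x = 0" and eq: "AE x in law f. a x - proj0 a x = avg g x + r x"
    and r2: "expectation (\<lambda>x. (r x)\<^sup>2) \<le> e / 2 * c" by blast
  define h where "h = (\<lambda>x. proj0 a x - expectation a + g x)"
  note dual = loss_le_dual_value[OF a g r g0 eq, folded h_def]
  have "0 < e / 2" using e by simp
  from bounded_direction_approximation[OF a dual(1,2) this]
  obtain k b where k: "k \<in> borel_measurable (law f)" and kb: "\<And>x. \<bar>k x\<bar> \<le> b" and Ek: "expectation k = 0"
    and approx: "2 * expectation (\<lambda>x. a x * h x) - information h - e / 2
        \<le> 2 * expectation (\<lambda>x. a x * k x) - information k" by blast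
  have k': "k \<in> borel_measurable borel" using k by simp
  have J0: "0 \<le> information k"
    by (rule information_nonneg)
  have "expectation (\<lambda>x. a x * k x) \<le> sqrt B * sqrt (information k)"
    by (rule linear_functional_le_risk[OF a T B risk k' kb Ek])
  moreover have "2 * (sqrt B * sqrt (information k)) \<le> B + information k"
    using sum_squares_bound[of "sqrt B" "sqrt (information k)"] B J0 by simp
  ultimately have kB: "2 * expectation (\<lambda>x. a x * k x) - information k \<le> B" by simp

  define \<alpha> where "\<alpha> = (\<lambda>S\<in>?SS. \<lambda>x. weight S x * proj S g x)"
  have "\<alpha> \<in> (\<Pi>\<^sub>E S\<in>?SS. H f S0 S)"
    unfolding \<alpha>_def using weighted_proj_in_H[OF _ g g0] by auto
  then have "(INF \<alpha>\<in>(\<Pi>\<^sub>E S\<in>?SS. H f S0 S). Lfun f a S0 ?SS \<alpha> M) \<le> Lfun f a S0 ?SS \<alpha> M"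
    by (intro cINF_lower bdd_belowI2[of _ 0] Lfun_nonneg)
  also have "Lfun f a S0 ?SS \<alpha> M = (\<integral>x. 1 / weight UNIV x * (a x - proj0 a x - (\<Sum>S\<in>?SS. weight S x * proj S g x))\<^sup>2
      + (\<Sum>S\<in>?SS. (weight S x * proj S g x)\<^sup>2 / weight S x) \<partial>law f)"
    unfolding Lfun_def cond_given_def weight_def[symmetric] by (simp add: \<alpha>_def)
  finally have inf: "(INF \<alpha>\<in>(\<Pi>\<^sub>E S\<in>?SS. H f S0 S). Lfun f a S0 ?SS \<alpha> M)
      \<le> (\<integral>x. 1 / weight UNIV x * (a x - proj0 a x - (\<Sum>S\<in>?SS. weight S x * proj S g x))\<^sup>2
      + (\<Sum>S\<in>?SS. (weight S x * proj S g x)\<^sup>2 / weight S x) \<partial>law f)" .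
  have pat: "patterns - {UNIV} = ?SS" using U by auto
  have dual3: "variance (proj0 a) + (\<integral>x. 1 / weight UNIV x * (a x - proj0 a x - (\<Sum>S\<in>?SS. weight S x * proj S g x))\<^sup>2
      + (\<Sum>S\<in>?SS. (weight S x * proj S g x)\<^sup>2 / weight S x) \<partial>law f)
      \<le> 2 * expectation (\<lambda>x. a x * h x) - information h + expectation (\<lambda>x. (r x)\<^sup>2) / c"
    using loss_le_dual_value(3)[OF a g r g0 eq] unfolding h_def pat .
  have "expectation (\<lambda>x. (r x)\<^sup>2) / c \<le> e / 2" using r2 c_pos by (simp add: field_simps)
  with dual3 inf approx kB show "variance (cond_given f S0 a)
      + (INF \<alpha>\<in>(\<Pi>\<^sub>E S\<in>?SS. H f S0 S). Lfun f a S0 ?SS \<alpha> M) \<le> B + e"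
    unfolding cond_given_def by linarith
qed

end

theorem theorem17:
  fixes f a :: "real ^ 'n \<Rightarrow> real"
    and K :: "real ^ 'n \<Rightarrow> ('n \<Rightarrow> bool) pmf"
    and S0 :: "'n set"
    and M :: "'n set \<Rightarrow> ('n \<Rightarrow> real) \<Rightarrow> real"
    and SS SSp :: "'n set set"
    and T :: "nat \<Rightarrow> (nat \<Rightarrow> 'n \<Rightarrow> real option) \<Rightarrow> real"
  assumes "CARD('n) \<ge> 2"
    and "prob_density f"
    and "a \<in> L2 f"
    and "markov_kernel K"
    and "SS = incomplete_patterns f K"
    and "SSp = SS \<union> {UNIV}"
    and "\<forall>S\<in>SS. S0 \<subseteq> S"
    and "\<forall>S\<in>SSp. M S \<in> borel_measurable (coord_space S0)"
    and "\<forall>S\<in>SSp. \<forall>y\<in>space (coord_space S0). M S y \<in> {0..1}"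
    and "\<forall>S\<in>SSp. AE x in law f. pmf (K x) (one_vec S) = M S (restr S0 x)"
    and "(INF y\<in>space (coord_space S0). Min ((\<lambda>S. M S y) ` SSp)) > 0"
    and "\<forall>N. T N \<in> borel_measurable (sample_space N)"
  shows "(SUP I\<in>{I. finite I \<and> I \<subseteq> L2 f}. liminf (\<lambda>N. SUP h\<in>I.
            scaled_risk a K N (T N) (perturb f (\<lambda>x. real N powr (- 1 / 2) * h x))))
         \<ge> ennreal (prob_space.variance (law f) (cond_given f S0 a)
             + (INF \<alpha>\<in>(\<Pi>\<^sub>E S\<in>SS. H f S0 S). Lfun f a S0 SS \<alpha> M))"
    (is "?V \<le> ?R")
proof (cases "?R" rule: ennreal_cases)
  case top
  then show ?thesis by (simp only: top_greatest)
next
  case B: (real B)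
  define c where "c = (INF y\<in>space (coord_space S0). Min ((\<lambda>S. M S y) ` SSp))"
  have SSp: "SSp = insert UNIV (incomplete_patterns f K)" using assms(5,6) by simp
  have fin: "finite SSp" by simp
  have M01: "0 \<le> M S y" "M S y \<le> 1" if "S \<in> SSp" "y \<in> space (coord_space S0)" for S y
    using assms(9) that by auto
  have c_le: "c \<le> M S y" if S: "S \<in> SSp" and y: "y \<in> space (coord_space S0)" for S y
  proof -
    have "c \<le> Min ((\<lambda>S. M S y) ` SSp)"
      unfolding c_def
    proof (rule cINF_lower[OF _ y])
      show "bdd_below ((\<lambda>y. Min ((\<lambda>S. M S y) ` SSp)) ` space (coord_space S0))"
      proof (rule bdd_belowI2[of _ 0])
        fix z assume z: "z \<in> space (coord_space S0)"
        show "0 \<le> Min ((\<lambda>S. M S z) ` SSp)"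
        proof (rule Min.boundedI)
          show "0 \<le> m" if "m \<in> (\<lambda>S. M S z) ` SSp" for m using that M01(1)[OF _ z] by blast
        qed (simp_all add: SSp)
      qed
    qed
    also have "\<dots> \<le> M S y" using S fin by (intro Min_le) auto
    finally show ?thesis .
  qed
  interpret missing_data f K S0 M c
  proof
    show "prob_density f" "markov_kernel K" by (fact assms(2), fact assms(4))
    show "0 < c" unfolding c_def by (fact assms(11))
    show "S0 \<subseteq> S" if "S \<in> incomplete_patterns f K" for S using assms(5,7) that by blast
    fix S assume "S \<in> insert UNIV (incomplete_patterns f K)"
    then have S: "S \<in> SSp" by (simp only: SSp)
    show "M S \<in> borel_measurable (coord_space S0)" using assms(8) S by blast
    show "AE x in law f. pmf (K x) (one_vec S) = M S (restr S0 x)" using assms(10) S by blast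
    fix y assume y: "y \<in> space (coord_space S0)"
    show "c \<le> M S y" by (rule c_le[OF S y])
    show "M S y \<le> 1" by (rule M01(2)[OF S y])
  qed
  have "liminf (\<lambda>N. SUP h\<in>I. scaled_risk a K N (T N) (perturb f (\<lambda>x. real N powr (- 1 / 2) * h x))) \<le> ennreal B"
    if "finite I" "I \<subseteq> L2 f" for I
    unfolding B(2)[symmetric] by (rule SUP_upper) (use that in simp)
  then have "prob_space.variance (law f) (cond_given f S0 a)
      + (INF \<alpha>\<in>(\<Pi>\<^sub>E S\<in>SS. H f S0 S). Lfun f a S0 SS \<alpha> M) \<le> B"
    unfolding assms(5)
    by (rule minimax_bound_le[OF assms(3)[unfolded L2_iff] assms(12)[rule_format] B(1)])
  then show ?thesis unfolding B(2) by (rule ennreal_leI)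
qed

end
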